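(* Let $\mathcal{J}$ be a proper operator ideal. Let $A\in\mathcal{B}(\mathcal{H})$ be a diagonalizable operator with infinite point spectrum and spectral projections $\{P_n\}_{n\geq 1}$ (the spectral projections associated to its distinct eigenvalues). Assume that there is a family $\{E_n\}_{n\geq 1}$ of diagonal projections (diagonal with respect to the fixed orthonormal basis $\{e_n\}_{n\geq 1}$) such that $$\sum_{n \geq 1}(I-E_n) P_n \in \mathcal{J} \quad \text{ and } \quad \sum_{n \geq 1}E_n (I-P_n) \in \mathcal{J},$$ where both series are assumed to converge in the weak operator topology. Then $A$ is $\mathcal{U}_\mathcal{J}(\mathcal{H})$-diagonalizable. Conversely, if $A$ (a diagonalizable operator with infinite point spectrum and spectral projections $\{P_n\}_{n\geq 1}$) is $\mathcal{U}_\mathcal{J}(\mathcal{H})$-diagonalizable and $\mathcal{J}$ is in addition arithmetic mean closed, then there is a family $\{E_n\}_{n\geq 1}$ of diagonal projections such that $\sum_{n \geq 1}(I-E_n) P_n \in \mathcal{J}$ and $\sum_{n \geq 1}E_n (I-P_n) \in \mathcal{J}$, with both series converging in the weak operator topology.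
   Context: $\mathcal{H}$ is a separable infinite-dimensional complex Hilbert space, $\mathcal{B}(\mathcal{H})$ the algebra of bounded operators on it, and $\{e_n\}_{n\geq 1}$ a fixed orthonormal basis of $\mathcal{H}$; an operator is diagonal if it is diagonal with respect to this basis. A proper operator ideal is a two-sided ideal $\mathcal{J}$ of $\mathcal{B}(\mathcal{H})$ with $\{0\}\neq\mathcal{J}\neq\mathcal{B}(\mathcal{H})$. $\mathcal{U}_\mathcal{J}(\mathcal{H})=\{U \text{ unitary}: U-I\in\mathcal{J}\}$. An operator $A$ is diagonalizable if $UAU^*$ is diagonal for some unitary $U$, and $\mathcal{U}_\mathcal{J}(\mathcal{H})$-diagonalizable if such $U$ can be chosen in $\mathcal{U}_\mathcal{J}(\mathcal{H})$. $\mathcal{J}$ is arithmetic mean closed if it equals $\{A \text{ compact}: \exists\, \alpha\in\Sigma(\mathcal{J}),\ s(A)_a=O(\alpha_a)\}$, where $s(A)$ is the singular value sequence, $\Sigma(\mathcal{J})=\{s(B): B\in\mathcal{J}\}$, and $(\alpha_a)_n=\frac1n(\alpha_1+\dots+\alpha_n)$. *)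

theory Defs
  imports Complex_Main "HOL-Library.Landau_Symbols"
begin

text \<open>The Hilbert space H is identified with l2(nat) over the complex numbers via the fixed
orthonormal basis e_n (the n-th unit vector).  Bounded operators are represented by their
matrices M i j = inner e_i (T e_j) with respect to this basis.\<close>

type_synonym vec = "nat \<Rightarrow> complex"
type_synonym mat = "nat \<Rightarrow> nat \<Rightarrow> complex"

definition l2 :: "vec set" where
  "l2 = {x. summable (\<lambda>n. (cmod (x n))^2)}"

definition l2norm :: "vec \<Rightarrow> real" where
  "l2norm x = sqrt (\<Sum>n. (cmod (x n))^2)"

definition l2inner :: "vec \<Rightarrow> vec \<Rightarrow> complex" where
  "l2inner x y = (\<Sum>n. cnj (x n) * y n)"

definition mat_apply :: "mat \<Rightarrow> vec \<Rightarrow> vec" where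
  "mat_apply M x = (\<lambda>i. \<Sum>j. M i j * x j)"

definition bounded_op :: "mat \<Rightarrow> bool" where
  "bounded_op M \<longleftrightarrow> (\<forall>i. (\<lambda>j. M i j) \<in> l2) \<and>
     (\<exists>C. \<forall>x\<in>l2. mat_apply M x \<in> l2 \<and> l2norm (mat_apply M x) \<le> C * l2norm x)"

definition mat_mult :: "mat \<Rightarrow> mat \<Rightarrow> mat" where
  "mat_mult M N = (\<lambda>i k. \<Sum>j. M i j * N j k)"

definition mat_adj :: "mat \<Rightarrow> mat" where
  "mat_adj M = (\<lambda>i j. cnj (M j i))"

definition mat_id :: mat where
  "mat_id = (\<lambda>i j. if i = j then 1 else 0)"

definition mat_zero :: mat where
  "mat_zero = (\<lambda>i j. 0)"

definition mat_add :: "mat \<Rightarrow> mat \<Rightarrow> mat" where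
  "mat_add M N = (\<lambda>i j. M i j + N i j)"

definition mat_diff :: "mat \<Rightarrow> mat \<Rightarrow> mat" where
  "mat_diff M N = (\<lambda>i j. M i j - N i j)"

definition opnorm :: "mat \<Rightarrow> real" where
  "opnorm M = Sup ((\<lambda>x. l2norm (mat_apply M x)) ` {x \<in> l2. l2norm x \<le> 1})"

definition rank_le :: "mat \<Rightarrow> nat \<Rightarrow> bool" where
  "rank_le F n \<longleftrightarrow> (\<exists>V. finite V \<and> card V \<le> n \<and> V \<subseteq> l2 \<and>
     (\<forall>x\<in>l2. \<exists>c. mat_apply F x = (\<lambda>i. \<Sum>v\<in>V. c v * v i)))"

definition finite_rank :: "mat \<Rightarrow> bool" where
  "finite_rank F \<longleftrightarrow> (\<exists>n. rank_le F n)"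

definition compact_op :: "mat \<Rightarrow> bool" where
  "compact_op A \<longleftrightarrow> bounded_op A \<and>
     (\<forall>\<epsilon>>0. \<exists>F. bounded_op F \<and> finite_rank F \<and> opnorm (mat_diff A F) < \<epsilon>)"

text \<open>singular value sequence, 0-indexed: sing_val A n = s_{n+1}(A)
  (given by the approximation numbers, which coincide with the singular values)\<close>
definition sing_val :: "mat \<Rightarrow> nat \<Rightarrow> real" where
  "sing_val A n = Inf {opnorm (mat_diff A F) | F. bounded_op F \<and> rank_le F n}"

definition arith_mean :: "(nat \<Rightarrow> real) \<Rightarrow> nat \<Rightarrow> real" where
  "arith_mean a n = (\<Sum>k\<le>n. a k) / real (Suc n)"

definition ideal_op :: "mat set \<Rightarrow> bool" where
  "ideal_op J \<longleftrightarrow> J \<subseteq> {M. bounded_op M} \<and> mat_zero \<in> J \<and>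
     (\<forall>X\<in>J. \<forall>Y\<in>J. mat_add X Y \<in> J) \<and>
     (\<forall>X\<in>J. \<forall>M. bounded_op M \<longrightarrow> mat_mult M X \<in> J \<and> mat_mult X M \<in> J)"

definition proper_ideal :: "mat set \<Rightarrow> bool" where
  "proper_ideal J \<longleftrightarrow> ideal_op J \<and> J \<noteq> {mat_zero} \<and> J \<noteq> {M. bounded_op M}"

definition sing_seqs :: "mat set \<Rightarrow> (nat \<Rightarrow> real) set" where
  "sing_seqs J = {sing_val B | B. B \<in> J}"

definition am_closed :: "mat set \<Rightarrow> bool" where
  "am_closed J \<longleftrightarrow> J = {A. compact_op A \<and>
     (\<exists>\<alpha>\<in>sing_seqs J. arith_mean (sing_val A) \<in> O(arith_mean \<alpha>))}"

definition is_proj :: "mat \<Rightarrow> bool" where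
  "is_proj P \<longleftrightarrow> bounded_op P \<and> mat_adj P = P \<and> mat_mult P P = P"

definition diagonal :: "mat \<Rightarrow> bool" where
  "diagonal M \<longleftrightarrow> (\<forall>i j. i \<noteq> j \<longrightarrow> M i j = 0)"

definition unitary :: "mat \<Rightarrow> bool" where
  "unitary U \<longleftrightarrow> bounded_op U \<and> mat_mult (mat_adj U) U = mat_id \<and> mat_mult U (mat_adj U) = mat_id"

definition diagonalizable :: "mat \<Rightarrow> bool" where
  "diagonalizable A \<longleftrightarrow> (\<exists>U. unitary U \<and> diagonal (mat_mult (mat_mult U A) (mat_adj U)))"

definition unitary_J :: "mat set \<Rightarrow> mat set" where
  "unitary_J J = {U. unitary U \<and> mat_diff U mat_id \<in> J}"

definition UJ_diagonalizable :: "mat set \<Rightarrow> mat \<Rightarrow> bool" where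
  "UJ_diagonalizable J A \<longleftrightarrow> (\<exists>U\<in>unitary_J J. diagonal (mat_mult (mat_mult U A) (mat_adj U)))"

definition point_spectrum :: "mat \<Rightarrow> complex set" where
  "point_spectrum A = {c. \<exists>x\<in>l2. x \<noteq> (\<lambda>_. 0) \<and> mat_apply A x = (\<lambda>i. c * x i)}"

definition spectral_proj :: "mat \<Rightarrow> complex \<Rightarrow> mat \<Rightarrow> bool" where
  "spectral_proj A c P \<longleftrightarrow> is_proj P \<and>
     (\<forall>x\<in>l2. mat_apply P x = x \<longleftrightarrow> mat_apply A x = (\<lambda>i. c * x i))"

definition wot_has_sum :: "(nat \<Rightarrow> mat) \<Rightarrow> mat \<Rightarrow> bool" where
  "wot_has_sum B S \<longleftrightarrow> bounded_op S \<and>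
     (\<forall>x\<in>l2. \<forall>y\<in>l2. (\<lambda>N. l2inner x (mat_apply (\<lambda>i j. \<Sum>n<N. B n i j) y))
        \<longlonglongrightarrow> l2inner x (mat_apply S y))"

end

(*
Sufficiency: the sum of the E n is the identity plus a diagonal element of J with integer
entries, so all but finitely many basis vectors carry exactly one label n.  With
X = 1 - sum (1 - E n) P n and Q a projection onto far-out coordinates, Q X is a partial isometry up
to a small element of J; its polar part V differs from the identity by an element of J and sends
eigenspaces to diagonal subspaces.  The kernel of V has as many dimensions as were cut off by Q
(a trace computation) and is spanned by eigenvectors, so V can be completed to a unitary.
Necessity: with K = U* - 1 both sums equal (K - block diagonal part of K) U.  Taking the block
diagonal part does not increase the arithmetic means of singular values by more than a constant:
this follows from pairing with orthonormal systems and a dyadic splitting of K into finite-rank pieces.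
*)

theory Submission
  imports Defs "HOL-Analysis.Analysis"
begin

text \<open>An ideal need not be norm closed, so being a limit of members proves nothing: with
  \<open>1 - K\<close> the square root of \<open>1 - L\<close>, membership of \<open>K\<close> comes
  from \<open>L = 2 K - K^2\<close>, which makes \<open>K\<close> a multiple of \<open>L\<close>.
  Closure under adjoints and smallness of far tails are derived too, the first from a polar
  factorisation, the second from properness. The polar part \<open>V\<close> has final projection
  \<open>Q\<close>, and its kernel must have dimension exactly \<open>N\<close>. This is an
  index-zero statement: \<open>Z = 1 - Q * S\<close> is invertible and maps the kernel onto the span
  of the first \<open>N\<close> basis vectors; the traces of \<open>Zi * Z\<close> and
  \<open>Z * Zi\<close> on these two spaces compare their dimensions. In the converse the obstacle
  is that the block diagonal part of a member can leave a general ideal. Passing to it contracts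
  both the operator norm and the trace norm, so by interpolation it respects the sums of the first m
  singular values up to a constant, which is the comparison that arithmetic mean closure tolerates.
  Singular values are used only as approximation numbers, with near-optimal approximants and
  near-maximal vectors; hence constants such as 12 and 48.\<close>

subsection \<open>Square-summable sequences\<close>

lemma l2_zero: "(\<lambda>_. 0) \<in> l2"
  by (simp add: l2_def)

lemma cmod_add_sq_le: "(cmod (a + b))\<^sup>2 \<le> 2 * (cmod a)\<^sup>2 + 2 * (cmod b)\<^sup>2"
proof -
  have "(cmod (a + b))\<^sup>2 \<le> (cmod a + cmod b)\<^sup>2"
    by (simp add: norm_triangle_ineq)
  also have "\<dots> \<le> 2 * (cmod a)\<^sup>2 + 2 * (cmod b)\<^sup>2"
    using sum_squares_bound[of "cmod a" "cmod b"] by (simp add: power2_sum)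
  finally show ?thesis .
qed

lemma l2_add: "x \<in> l2 \<Longrightarrow> y \<in> l2 \<Longrightarrow> (\<lambda>i. x i + y i) \<in> l2"
  unfolding l2_def mem_Collect_eq
  by (rule summable_comparison_test'[where g = "\<lambda>n. 2 * (cmod (x n))\<^sup>2 + 2 * (cmod (y n))\<^sup>2"])
     (auto intro!: summable_add summable_mult cmod_add_sq_le)

lemma l2_scale: "x \<in> l2 \<Longrightarrow> (\<lambda>i. c * x i) \<in> l2"
  by (simp add: l2_def norm_mult power_mult_distrib summable_mult)

lemma l2_prod_summable_norm:
  assumes "x \<in> l2" "y \<in> l2"
  shows "summable (\<lambda>n. cmod (cnj (x n) * y n))"
proof (rule summable_comparison_test')
  show "summable (\<lambda>n. (cmod (x n))\<^sup>2 + (cmod (y n))\<^sup>2)"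
    using assms by (simp add: l2_def summable_add)
  show "norm (cmod (cnj (x n) * y n)) \<le> (cmod (x n))\<^sup>2 + (cmod (y n))\<^sup>2" for n
  proof -
    have "cmod (x n) * cmod (y n) \<le> 2 * cmod (x n) * cmod (y n)" by simp
    also have "\<dots> \<le> (cmod (x n))\<^sup>2 + (cmod (y n))\<^sup>2" by (rule sum_squares_bound)
    finally show ?thesis by (simp add: norm_mult)
  qed
qed

lemma l2_prod_summable: "x \<in> l2 \<Longrightarrow> y \<in> l2 \<Longrightarrow> summable (\<lambda>n. cnj (x n) * y n)"
  by (rule summable_norm_cancel) (rule l2_prod_summable_norm)

text \<open>As a type, the space can instantiate \<open>real_inner\<close> and
  \<open>banach\<close>. These classes know real scalars only, so the complex structure is carried
  alongside by \<open>cin\<close> and \<open>cscale\<close>, and the real inner product is the real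
  part of \<open>cin\<close>.\<close>

typedef ell2 = l2 morphisms coord Abs_ell2
  using l2_zero by blast

setup_lifting type_definition_ell2

lemma coord_eqI: "(\<And>i. coord x i = coord y i) \<Longrightarrow> x = y"
  by (metis coord_inject ext)

lemma coord_Abs: "x \<in> l2 \<Longrightarrow> coord (Abs_ell2 x) = x"
  by (rule Abs_ell2_inverse)

definition cin :: "ell2 \<Rightarrow> ell2 \<Rightarrow> complex" where
  "cin x y = l2inner (coord x) (coord y)"

lift_definition cscale :: "complex \<Rightarrow> ell2 \<Rightarrow> ell2" (infixr "*\<^sub>C" 75)
  is "\<lambda>c x i. c * x i" by (rule l2_scale)

lift_definition bas :: "nat \<Rightarrow> ell2" is "\<lambda>k i. if i = k then 1 else 0"
  unfolding l2_def mem_Collect_eq by (rule summable_finite[of "{k}" for k]) auto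

instantiation ell2 :: real_inner
begin

lift_definition zero_ell2 :: ell2 is "\<lambda>_. 0" by (rule l2_zero)
lift_definition plus_ell2 :: "ell2 \<Rightarrow> ell2 \<Rightarrow> ell2" is "\<lambda>x y i. x i + y i" by (rule l2_add)
lift_definition uminus_ell2 :: "ell2 \<Rightarrow> ell2" is "\<lambda>x i. - x i" by (simp add: l2_def)
lift_definition minus_ell2 :: "ell2 \<Rightarrow> ell2 \<Rightarrow> ell2" is "\<lambda>x y i. x i - y i"
  subgoal for x y using l2_add[of x "\<lambda>i. - y i"] by (simp add: l2_def) done
lift_definition scaleR_ell2 :: "real \<Rightarrow> ell2 \<Rightarrow> ell2" is "\<lambda>r x i. of_real r * x i" by (rule l2_scale)

definition inner_ell2 :: "ell2 \<Rightarrow> ell2 \<Rightarrow> real" where "inner_ell2 x y = Re (cin x y)"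
definition norm_ell2 :: "ell2 \<Rightarrow> real" where "norm_ell2 x = sqrt (inner x x)"
definition dist_ell2 :: "ell2 \<Rightarrow> ell2 \<Rightarrow> real" where "dist_ell2 x y = norm (x - y)"
definition sgn_ell2 :: "ell2 \<Rightarrow> ell2" where "sgn_ell2 x = inverse (norm x) *\<^sub>R x"
definition uniformity_ell2 :: "(ell2 \<times> ell2) filter" where
  "uniformity_ell2 = (INF e\<in>{0<..}. principal {(x, y). dist x y < e})"
definition open_ell2 :: "ell2 set \<Rightarrow> bool" where
  "open_ell2 U \<longleftrightarrow> (\<forall>x\<in>U. eventually (\<lambda>(x', y). x' = x \<longrightarrow> y \<in> U) uniformity)"

lemma coord_summable: "summable (\<lambda>n. cnj (coord x n) * coord y n)"
  using coord l2_prod_summable by auto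

lemma coord_simps [simp]:
  "coord 0 i = 0" "coord (x + y) i = coord x i + coord y i" "coord (- x) i = - coord x i"
  "coord (x - y) i = coord x i - coord y i" "coord (r *\<^sub>R x) i = of_real r * coord x i"
  "coord (c *\<^sub>C x) i = c * coord x i" "coord (bas k) i = (if i = k then 1 else 0)"
  by (transfer; simp)+

lemma cin_commute: "cin x y = cnj (cin y x)"
proof -
  have "cnj (cin y x) = (\<Sum>n. cnj (cnj (coord y n) * coord x n))"
    unfolding cin_def l2inner_def by (rule bounded_linear.suminf[OF bounded_linear_cnj coord_summable])
  thus ?thesis by (simp add: cin_def l2inner_def mult.commute)
qed

lemma cin_add_right: "cin x (y + z) = cin x y + cin x z"
  unfolding cin_def l2inner_def
  by (simp add: suminf_add[OF coord_summable coord_summable] distrib_left)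

lemma cin_scale_right: "cin x (c *\<^sub>C y) = c * cin x y"
  unfolding cin_def l2inner_def
  by (simp add: suminf_mult[OF coord_summable, symmetric] mult.left_commute)

lemma cin_add_left: "cin (x + y) z = cin x z + cin y z"
  by (metis cin_add_right cin_commute complex_cnj_add)

lemma cin_scale_left: "cin (c *\<^sub>C x) y = cnj c * cin x y"
  by (metis cin_scale_right cin_commute complex_cnj_mult)

lemma scaleR_cscale: "r *\<^sub>R (x :: ell2) = of_real r *\<^sub>C x"
  by (rule coord_eqI) simp

lemma cin_self: "cin x x = of_real (\<Sum>n. (cmod (coord x n))\<^sup>2)"
proof -
  have "summable (\<lambda>n. (cmod (coord x n))\<^sup>2)"
    using coord[of x] by (simp add: l2_def)
  hence "(\<Sum>n. of_real ((cmod (coord x n))\<^sup>2) :: complex) = of_real (\<Sum>n. (cmod (coord x n))\<^sup>2)"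
    by (rule suminf_of_real[symmetric])
  thus ?thesis
    by (simp add: cin_def l2inner_def complex_norm_square mult.commute del: of_real_power)
qed

instance
proof
  fix x y z :: ell2 and r s :: real
  show "x + y + z = x + (y + z)" "x + y = y + x" "0 + x = x" "- x + x = 0" "x - y = x + - y"
    "r *\<^sub>R (x + y) = r *\<^sub>R x + r *\<^sub>R y" "(r + s) *\<^sub>R x = r *\<^sub>R x + s *\<^sub>R x"
    "r *\<^sub>R s *\<^sub>R x = (r * s) *\<^sub>R x" "1 *\<^sub>R x = x"
    by (rule coord_eqI; simp add: algebra_simps)+
  show "dist x y = norm (x - y)" by (rule dist_ell2_def)
  show "sgn x = inverse (norm x) *\<^sub>R x" by (rule sgn_ell2_def)
  show "uniformity = (INF e\<in>{0<..}. principal {(x, y :: ell2). dist x y < e})"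
    by (rule uniformity_ell2_def)
  show "open U \<longleftrightarrow> (\<forall>x\<in>U. eventually (\<lambda>(x', y). x' = x \<longrightarrow> y \<in> U) uniformity)" for U :: "ell2 set"
    by (rule open_ell2_def)
  show "inner x y = inner y x"
    unfolding inner_ell2_def by (metis cin_commute cnj.simps(1))
  show "inner (x + y) z = inner x z + inner y z"
    by (simp add: inner_ell2_def cin_add_left)
  show "inner (r *\<^sub>R x) y = r * inner x y"
    by (simp add: inner_ell2_def scaleR_cscale cin_scale_left)
  have sm: "summable (\<lambda>n. (cmod (coord x n))\<^sup>2)"
    using coord[of x] by (simp add: l2_def)
  show "0 \<le> inner x x"
    by (simp add: inner_ell2_def cin_self suminf_nonneg[OF sm])
  show "inner x x = 0 \<longleftrightarrow> x = 0"
  proof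
    assume "inner x x = 0"
    hence "\<And>n. (cmod (coord x n))\<^sup>2 = 0"
      using suminf_eq_zero_iff[OF sm] by (simp add: inner_ell2_def cin_self)
    thus "x = 0" by (intro coord_eqI) simp
  qed (simp add: inner_ell2_def cin_self)
  show "norm x = sqrt (inner x x)" by (rule norm_ell2_def)
qed

end

lemma cin_norm: "cin x x = of_real ((norm x)\<^sup>2)"
  by (metis cin_self inner_ell2_def Re_complex_of_real dot_square_norm)

lemma norm_eq_cin: "(norm x)\<^sup>2 = Re (cin x x)"
  by (simp add: cin_norm)

lemma norm_ell2_l2norm: "norm x = l2norm (coord x)"
  by (simp add: norm_ell2_def inner_ell2_def cin_self l2norm_def)

lemma cin_zero [simp]: "cin 0 x = 0" "cin x 0 = 0"
  by (simp_all add: cin_def l2inner_def)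

lemma cin_minus: "cin (- x) y = - cin x y" "cin x (- y) = - cin x y"
  by (metis add.right_inverse cin_add_left cin_zero(1) eq_neg_iff_add_eq_0 add.commute,
      metis add.right_inverse cin_add_right cin_zero(2) eq_neg_iff_add_eq_0 add.commute)

lemma cin_diff_left: "cin (x - y) z = cin x z - cin y z"
  by (simp only: diff_conv_add_uminus cin_add_left cin_minus)

lemma cin_diff_right: "cin x (y - z) = cin x y - cin x z"
  by (simp only: diff_conv_add_uminus cin_add_right cin_minus)

lemma cin_sum_left: "cin (sum f A) z = (\<Sum>i\<in>A. cin (f i) z)"
  by (induction A rule: infinite_finite_induct) (auto simp: cin_add_left)

lemma cin_sum_right: "cin z (sum f A) = (\<Sum>i\<in>A. cin z (f i))"
  by (induction A rule: infinite_finite_induct) (auto simp: cin_add_right)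

lemmas cin_simps = cin_add_left cin_add_right cin_diff_left cin_diff_right cin_minus
  cin_scale_left cin_scale_right cin_sum_left cin_sum_right

lemma coord_sum: "coord (sum f A) i = (\<Sum>a\<in>A. coord (f a) i)"
  by (induction A rule: infinite_finite_induct) auto

lemma cin_bas [simp]: "cin (bas i) x = coord x i"
proof -
  have "(\<lambda>n. cnj (coord (bas i) n) * coord x n) sums (\<Sum>n\<in>{i}. cnj (coord (bas i) n) * coord x n)"
    by (rule sums_finite) auto
  thus ?thesis by (simp add: cin_def l2inner_def sums_iff)
qed

lemma cin_bas_right [simp]: "cin x (bas i) = cnj (coord x i)"
  by (metis cin_bas cin_commute)

lemma norm_bas [simp]: "norm (bas i) = 1"
  using cin_norm[of "bas i"] power2_eq_1_iff[of "norm (bas i)"] norm_ge_zero[of "bas i"]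
  by (simp del: norm_ge_zero) (smt (verit) of_real_eq_1_iff of_real_power)

lemma cin_cauchy_schwarz: "cmod (cin x y) \<le> norm x * norm y"
proof (cases "cin x y = 0")
  case False
  \<comment> \<open>The phase that turns \<open>cin x y\<close> into its modulus; it reduces the
    claim to the real Cauchy-Schwarz inequality.\<close>
  define c where "c = cnj (cin x y) / of_real (cmod (cin x y))"
  have c: "cmod c = 1" using False by (simp add: c_def norm_divide)
  have "c * cin x y = of_real (cmod (cin x y))"
    using False by (simp add: c_def complex_norm_square[symmetric] power2_eq_square mult.commute divide_simps)
  hence "cmod (cin x y) = inner x (c *\<^sub>C y)"
    by (simp add: inner_ell2_def cin_scale_right)
  also have "\<dots> \<le> norm x * norm (c *\<^sub>C y)" by (rule norm_cauchy_schwarz)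
  also have "norm (c *\<^sub>C y) = norm y"
    using c by (simp add: norm_ell2_l2norm l2norm_def norm_mult)
  finally show ?thesis .
qed simp

lemma norm_cscale [simp]: "norm (c *\<^sub>C x) = cmod c * norm x"
proof -
  have "cin (c *\<^sub>C x) (c *\<^sub>C x) = of_real ((cmod c)\<^sup>2) * cin x x"
    by (simp add: cin_scale_left cin_scale_right complex_norm_square mult.commute mult.left_commute
        del: of_real_power)
  also have "\<dots> = of_real ((cmod c * norm x)\<^sup>2)"
    by (simp add: cin_norm power_mult_distrib)
  finally have "(norm (c *\<^sub>C x))\<^sup>2 = (cmod c * norm x)\<^sup>2"
    by (simp only: norm_eq_cin[of "c *\<^sub>C x"] Re_complex_of_real)
  thus ?thesis by (simp add: power2_eq_iff_nonneg)
qed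

lemma cscale_simps:
  "c *\<^sub>C (x + y) = c *\<^sub>C x + c *\<^sub>C y" "(c + d) *\<^sub>C x = c *\<^sub>C x + d *\<^sub>C x"
  "c *\<^sub>C (x - y) = c *\<^sub>C x - c *\<^sub>C y" "(c - d) *\<^sub>C x = c *\<^sub>C x - d *\<^sub>C x"
  "c *\<^sub>C d *\<^sub>C x = (c * d) *\<^sub>C x"
  by (rule coord_eqI; simp add: algebra_simps)+

lemma cscale_trivial [simp]: "0 *\<^sub>C x = 0" "1 *\<^sub>C x = x" "c *\<^sub>C 0 = 0"
  by (rule coord_eqI; simp)+

lemma cscale_sum: "c *\<^sub>C sum f A = (\<Sum>a\<in>A. c *\<^sub>C f a)"
  by (rule coord_eqI) (simp add: coord_sum sum_distrib_left)

lemma cin_eq_0_imp: "cin x x = 0 \<Longrightarrow> x = 0"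
  by (simp add: cin_norm)


lemma cmod_coord_le: "cmod (coord x i) \<le> norm x"
  using cin_cauchy_schwarz[of "bas i" x] by simp

lemma norm_sums: "(\<lambda>n. (cmod (coord x n))\<^sup>2) sums (norm x)\<^sup>2"
proof -
  have sm: "summable (\<lambda>n. (cmod (coord x n))\<^sup>2)"
    using coord[of x] by (simp add: l2_def)
  thus ?thesis
    by (simp add: norm_ell2_l2norm l2norm_def suminf_nonneg summable_sums)
qed

lemma sum_coord_le: "finite A \<Longrightarrow> (\<Sum>i\<in>A. (cmod (coord x i))\<^sup>2) \<le> (norm x)\<^sup>2"
  using norm_sums[of x] sum_le_suminf[of "\<lambda>n. (cmod (coord x n))\<^sup>2" A] by (simp add: sums_iff)

text \<open>The common source of operators given by coordinates (adjoints, \<open>pr\<close>, row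
  operators, block-diagonal parts): one bound on partial sums yields both square summability and the
  operator bound.\<close>

lemma l2I_bounded:
  assumes "\<And>n. (\<Sum>i<n. (cmod (f i))\<^sup>2) \<le> K\<^sup>2" "K \<ge> 0"
  shows "f \<in> l2" "norm (Abs_ell2 f) \<le> K"
proof -
  show f: "f \<in> l2"
    unfolding l2_def mem_Collect_eq
    by (rule summableI_nonneg_bounded[where x = "K\<^sup>2"]) (use assms in auto)
  have "(norm (Abs_ell2 f))\<^sup>2 \<le> K\<^sup>2"
    by (rule LIMSEQ_le_const2[OF norm_sums[of "Abs_ell2 f", unfolded sums_def coord_Abs[OF f]]])
       (use assms in auto)
  thus "norm (Abs_ell2 f) \<le> K" using assms(2) power2_le_imp_le by blast
qed

definition trunc :: "nat \<Rightarrow> ell2 \<Rightarrow> ell2" where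
  "trunc n x = (\<Sum>i<n. coord x i *\<^sub>C bas i)"

lemma coord_trunc: "coord (trunc n x) i = (if i < n then coord x i else 0)"
proof -
  have "coord (trunc n x) i = (\<Sum>j<n. if i = j then coord x j else 0)"
    unfolding trunc_def coord_sum by (rule sum.cong) auto
  thus ?thesis by (simp add: sum.delta')
qed

lemma norm_trunc: "(norm (trunc n x))\<^sup>2 = (\<Sum>i<n. (cmod (coord x i))\<^sup>2)"
proof -
  have "(\<lambda>i. (cmod (coord (trunc n x) i))\<^sup>2) sums (\<Sum>i<n. (cmod (coord (trunc n x) i))\<^sup>2)"
    by (rule sums_finite) (auto simp: coord_trunc)
  also have "(\<Sum>i<n. (cmod (coord (trunc n x) i))\<^sup>2) = (\<Sum>i<n. (cmod (coord x i))\<^sup>2)"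
    by (rule sum.cong) (auto simp: coord_trunc)
  finally show ?thesis using norm_sums sums_unique2 by blast
qed

lemma norm_sub_trunc: "(norm (x - trunc n x))\<^sup>2 = (norm x)\<^sup>2 - (norm (trunc n x))\<^sup>2"
proof -
  have "cin (trunc n x) x = (\<Sum>i<n. of_real ((cmod (coord x i))\<^sup>2))"
    unfolding trunc_def cin_sum_left by (rule sum.cong) (auto simp: cin_simps complex_norm_square mult.commute simp del: of_real_power)
  also have "\<dots> = of_real ((norm (trunc n x))\<^sup>2)" by (simp add: norm_trunc)
  finally have 1: "cin (trunc n x) x = of_real ((norm (trunc n x))\<^sup>2)" .
  hence 2: "cin x (trunc n x) = of_real ((norm (trunc n x))\<^sup>2)"
    by (metis cin_commute complex_cnj_complex_of_real)
  have "cin (x - trunc n x) (x - trunc n x) =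
      cin x x - cin x (trunc n x) - (cin (trunc n x) x - cin (trunc n x) (trunc n x))"
    by (simp add: cin_diff_left cin_diff_right)
  also have "\<dots> = of_real ((norm x)\<^sup>2 - (norm (trunc n x))\<^sup>2)"
    by (simp add: 1 2 cin_norm)
  finally show ?thesis by (simp only: norm_eq_cin[of "x - trunc n x"] Re_complex_of_real)
qed

lemma trunc_tendsto: "(\<lambda>n. trunc n x) \<longlonglongrightarrow> x"
proof -
  have "(\<lambda>n. (norm x)\<^sup>2 - (norm (trunc n x))\<^sup>2) \<longlonglongrightarrow> (norm x)\<^sup>2 - (norm x)\<^sup>2"
    unfolding norm_trunc by (intro tendsto_intros norm_sums[unfolded sums_def])
  hence "(\<lambda>n. sqrt ((norm (x - trunc n x))\<^sup>2)) \<longlonglongrightarrow> sqrt 0"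
    unfolding norm_sub_trunc by (intro tendsto_real_sqrt) simp
  hence "(\<lambda>n. norm (trunc n x - x)) \<longlonglongrightarrow> 0"
    by (simp add: norm_minus_commute)
  hence "(\<lambda>n. trunc n x - x) \<longlonglongrightarrow> 0" by (rule tendsto_norm_zero_cancel)
  thus ?thesis by (rule LIM_zero_cancel)
qed

instance ell2 :: banach
proof
  fix X :: "nat \<Rightarrow> ell2" assume X: "Cauchy X"
  have "Cauchy (\<lambda>n. coord (X n) i)" for i
  proof (rule CauchyI)
    fix e :: real assume "e > 0"
    then obtain M where M: "\<forall>m\<ge>M. \<forall>n\<ge>M. norm (X m - X n) < e" using X CauchyD by blast
    thus "\<exists>M. \<forall>m\<ge>M. \<forall>n\<ge>M. norm (coord (X m) i - coord (X n) i) < e"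
      using cmod_coord_le[of "X m - X n" i for m n] by (metis coord_simps(4) le_less_trans)
  qed
  then obtain f where f: "\<And>i. (\<lambda>n. coord (X n) i) \<longlonglongrightarrow> f i"
    unfolding Cauchy_convergent_iff convergent_def by metis
  have tail: "\<exists>M. \<forall>m\<ge>M. (\<lambda>i. coord (X m) i - f i) \<in> l2 \<and> norm (Abs_ell2 (\<lambda>i. coord (X m) i - f i)) \<le> e"
    if "e > 0" for e
  proof -
    from that X CauchyD obtain M where M: "\<And>m n. m\<ge>M \<Longrightarrow> n\<ge>M \<Longrightarrow> norm (X m - X n) < e" by blast
    have "(\<Sum>i<k. (cmod (coord (X m) i - f i))\<^sup>2) \<le> e\<^sup>2" if "m \<ge> M" for m k
    proof (rule LIMSEQ_le_const2)
      show "(\<lambda>n. \<Sum>i<k. (cmod (coord (X m) i - coord (X n) i))\<^sup>2) \<longlonglongrightarrow> (\<Sum>i<k. (cmod (coord (X m) i - f i))\<^sup>2)"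
        by (intro tendsto_intros f)
      have "(\<Sum>i<k. (cmod (coord (X m) i - coord (X n) i))\<^sup>2) \<le> e\<^sup>2" if "n \<ge> M" for n
      proof -
        have "(\<Sum>i<k. (cmod (coord (X m) i - coord (X n) i))\<^sup>2) \<le> (norm (X m - X n))\<^sup>2"
          using sum_coord_le[of "{..<k}" "X m - X n"] by simp
        also have "\<dots> \<le> e\<^sup>2" using M[OF \<open>m \<ge> M\<close> that] \<open>e > 0\<close> by (intro power_mono) auto
        finally show ?thesis .
      qed
      thus "\<exists>N. \<forall>n\<ge>N. (\<Sum>i<k. (cmod (coord (X m) i - coord (X n) i))\<^sup>2) \<le> e\<^sup>2" by blast
    qed
    hence "(\<lambda>i. coord (X m) i - f i) \<in> l2 \<and> norm (Abs_ell2 (\<lambda>i. coord (X m) i - f i)) \<le> e" if "m \<ge> M" for m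
      using l2I_bounded[of "\<lambda>i. coord (X m) i - f i" e] \<open>e > 0\<close> that by auto
    thus ?thesis by blast
  qed
  obtain M where "(\<lambda>i. coord (X M) i - f i) \<in> l2" using tail[of 1] by auto
  hence "(\<lambda>i. coord (X M) i + (- 1) * (coord (X M) i - f i)) \<in> l2"
    using coord by (intro l2_add l2_scale) auto
  hence fl2: "f \<in> l2" by simp
  have eq: "Abs_ell2 (\<lambda>i. coord (X m) i - f i) = X m - Abs_ell2 f" if "(\<lambda>i. coord (X m) i - f i) \<in> l2" for m
    using that fl2 by (intro coord_eqI) (simp add: coord_Abs)
  have "X \<longlonglongrightarrow> Abs_ell2 f"
  proof (rule LIMSEQ_I)
    fix r :: real assume "r > 0"
    then obtain M where "\<forall>m\<ge>M. (\<lambda>i. coord (X m) i - f i) \<in> l2 \<and> norm (Abs_ell2 (\<lambda>i. coord (X m) i - f i)) \<le> r/2"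
      using tail[of "r/2"] by auto
    hence "\<forall>m\<ge>M. norm (X m - Abs_ell2 f) < r" using eq \<open>r > 0\<close> by fastforce
    thus "\<exists>M. \<forall>m\<ge>M. norm (X m - Abs_ell2 f) < r" by blast
  qed
  thus "convergent X" by (rule convergentI)
qed

lemma bounded_linear_cin: "bounded_linear (cin y)"
proof (rule bounded_linear_intro[where K = "norm y"])
  show "norm (cin y x) \<le> norm x * norm y" for x
    using cin_cauchy_schwarz[of y x] by (simp add: mult.commute)
qed (simp_all add: cin_simps scaleR_cscale scaleR_conv_of_real)

lemmas tendsto_cin = bounded_linear.tendsto[OF bounded_linear_cin]

lifting_update ell2.lifting
lifting_forget ell2.lifting

subsection \<open>Bounded operators\<close>

text \<open>The type of bounded linear maps is real-linear. The complex-linear maps form a closed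
  subalgebra, so norm and completeness are inherited, and power series and iterations converge
  inside the type.\<close>

typedef bop = "{f :: ell2 \<Rightarrow>\<^sub>L ell2. \<forall>c x. blinfun_apply f (c *\<^sub>C x) = c *\<^sub>C blinfun_apply f x}"
  morphisms blin_of Abs_bop
  by (rule exI[of _ 0]) (simp add: zero_blinfun.rep_eq)

setup_lifting type_definition_bop

lift_definition ap :: "bop \<Rightarrow> ell2 \<Rightarrow> ell2" is blinfun_apply .

lemma ap_scale: "ap M (c *\<^sub>C x) = c *\<^sub>C ap M x"
  by transfer simp

lemma bop_eqI: "(\<And>x. ap M x = ap N x) \<Longrightarrow> M = N"
  by transfer (simp add: blinfun_eqI)

instantiation bop :: real_normed_algebra_1
begin

lift_definition zero_bop :: bop is 0 by (simp add: zero_blinfun.rep_eq)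
lift_definition one_bop :: bop is id_blinfun by simp
lift_definition plus_bop :: "bop \<Rightarrow> bop \<Rightarrow> bop" is "(+)"
  by (simp add: blinfun.add_left cscale_simps)
lift_definition uminus_bop :: "bop \<Rightarrow> bop" is uminus
  by (simp add: blinfun.minus_left) (metis cscale_simps(3) cscale_trivial(3) diff_0)
lift_definition minus_bop :: "bop \<Rightarrow> bop \<Rightarrow> bop" is "(-)"
  by (simp add: blinfun.diff_left cscale_simps)
lift_definition scaleR_bop :: "real \<Rightarrow> bop \<Rightarrow> bop" is "scaleR"
  by (simp add: blinfun.scaleR_left scaleR_cscale cscale_simps mult.commute)
lift_definition times_bop :: "bop \<Rightarrow> bop \<Rightarrow> bop" is "(o\<^sub>L)" by simp
lift_definition norm_bop :: "bop \<Rightarrow> real" is norm .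
definition dist_bop :: "bop \<Rightarrow> bop \<Rightarrow> real" where "dist_bop x y = norm (x - y)"
definition sgn_bop :: "bop \<Rightarrow> bop" where "sgn_bop x = inverse (norm x) *\<^sub>R x"
definition uniformity_bop :: "(bop \<times> bop) filter" where
  "uniformity_bop = (INF e\<in>{0<..}. principal {(x, y). dist x y < e})"
definition open_bop :: "bop set \<Rightarrow> bool" where
  "open_bop U \<longleftrightarrow> (\<forall>x\<in>U. eventually (\<lambda>(x', y). x' = x \<longrightarrow> y \<in> U) uniformity)"

lemma ap_simps [simp]:
  "ap 0 x = 0" "ap 1 x = x" "ap (M + N) x = ap M x + ap N x" "ap (- M) x = - ap M x"
  "ap (M - N) x = ap M x - ap N x" "ap (M * N) x = ap M (ap N x)" "ap (r *\<^sub>R M) x = r *\<^sub>R ap M x"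
  by (transfer; simp add: blinfun.bilinear_simps)+

lemma ap_lin:
  "ap M (x + y) = ap M x + ap M y" "ap M (x - y) = ap M x - ap M y" "ap M (- x) = - ap M x"
  "ap M 0 = 0" "ap M (r *\<^sub>R x) = r *\<^sub>R ap M x"
  by (transfer; simp add: blinfun.bilinear_simps)+

instance
proof
  fix a b c :: bop and r s :: real
  show "a + b + c = a + (b + c)" "a + b = b + a" "0 + a = a" "- a + a = 0" "a - b = a + - b"
    "r *\<^sub>R (a + b) = r *\<^sub>R a + r *\<^sub>R b" "(r + s) *\<^sub>R a = r *\<^sub>R a + s *\<^sub>R a"
    "r *\<^sub>R s *\<^sub>R a = (r * s) *\<^sub>R a" "1 *\<^sub>R a = a"
    "a * b * c = a * (b * c)" "(a + b) * c = a * c + b * c" "a * (b + c) = a * b + a * c"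
    "1 * a = a" "a * 1 = a" "r *\<^sub>R a * b = r *\<^sub>R (a * b)" "a * r *\<^sub>R b = r *\<^sub>R (a * b)"
    by (rule bop_eqI; simp add: ap_lin algebra_simps)+
  show "(0::bop) \<noteq> 1"
  proof
    assume "(0::bop) = 1"
    hence "ap 0 (bas 0) = ap 1 (bas 0)" by simp
    thus False by (metis ap_simps(1,2) norm_bas norm_zero zero_neq_one)
  qed
  show "dist a b = norm (a - b)" by (rule dist_bop_def)
  show "sgn a = inverse (norm a) *\<^sub>R a" by (rule sgn_bop_def)
  show "uniformity = (INF e\<in>{0<..}. principal {(x, y :: bop). dist x y < e})"
    by (rule uniformity_bop_def)
  show "open U \<longleftrightarrow> (\<forall>x\<in>U. eventually (\<lambda>(x', y). x' = x \<longrightarrow> y \<in> U) uniformity)" for U :: "bop set"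
    by (rule open_bop_def)
  show "norm a = 0 \<longleftrightarrow> a = 0" "norm (a + b) \<le> norm a + norm b" "norm (r *\<^sub>R a) = \<bar>r\<bar> * norm a"
    by (transfer; simp add: norm_triangle_ineq)+
  show "norm (a * b) \<le> norm a * norm b"
    by transfer (rule norm_blinfun_compose)
  show "norm (1 :: bop) = 1"
  proof (rule antisym)
    show "norm (1 :: bop) \<le> 1" by transfer (rule norm_blinfun_id_le)
    have "norm (ap 1 (bas 0)) \<le> norm (1 :: bop) * norm (bas 0)"
      by transfer (rule norm_blinfun)
    thus "1 \<le> norm (1 :: bop)" by simp
  qed
qed

end

lemma ap_sum_left: "ap (sum M A) x = (\<Sum>a\<in>A. ap (M a) x)"
  by (induction A rule: infinite_finite_induct) auto

lemma ap_sum: "ap M (sum f A) = (\<Sum>a\<in>A. ap M (f a))"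
  by (induction A rule: infinite_finite_induct) (auto simp: ap_lin)

lemma norm_ap: "norm (ap M x) \<le> norm M * norm x"
  by transfer (rule norm_blinfun)

lemma norm_bop_le: "b \<ge> 0 \<Longrightarrow> (\<And>x. norm (ap M x) \<le> b * norm x) \<Longrightarrow> norm M \<le> b"
  by transfer (simp add: norm_blinfun_bound)

lemma bop_ext: "\<exists>M. \<forall>x. ap M x = f x"
  if "\<And>x y. f (x + y) = f x + f y" "\<And>c x. f (c *\<^sub>C x) = c *\<^sub>C f x" "\<And>x. norm (f x) \<le> b * norm x"
proof -
  have "bounded_linear f"
    by (rule bounded_linear_intro[where K = b])
       (use that in \<open>auto simp: scaleR_cscale mult.commute\<close>)
  hence "ap (Abs_bop (Blinfun f)) x = f x" for x
    using that(2) by (simp add: ap.rep_eq Abs_bop_inverse bounded_linear_Blinfun_apply)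
  thus ?thesis by blast
qed

lemma tendsto_ap: "(f \<longlongrightarrow> a) F \<Longrightarrow> ((\<lambda>n. ap M (f n)) \<longlongrightarrow> ap M a) F"
  by transfer (rule bounded_linear.tendsto[OF blinfun.bounded_linear_right])

instance bop :: banach
proof
  fix X :: "nat \<Rightarrow> bop" assume X: "Cauchy X"
  have "Cauchy (\<lambda>n. blin_of (X n))"
    using X unfolding Cauchy_def dist_norm by transfer
  then obtain L where L: "(\<lambda>n. blin_of (X n)) \<longlonglongrightarrow> L"
    using Cauchy_convergent_iff convergent_def by blast
  have "blinfun_apply L (c *\<^sub>C x) = c *\<^sub>C blinfun_apply L x" for c x
  proof (rule LIMSEQ_unique)
    show "(\<lambda>n. blinfun_apply (blin_of (X n)) (c *\<^sub>C x)) \<longlonglongrightarrow> blinfun_apply L (c *\<^sub>C x)"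
      by (rule bounded_linear.tendsto[OF blinfun.bounded_linear_left L])
    have "bounded_linear (\<lambda>y. c *\<^sub>C y)"
      by (rule bounded_linear_intro[where K = "cmod c"]) (auto simp: cscale_simps scaleR_cscale mult.commute)
    from bounded_linear.tendsto[OF this bounded_linear.tendsto[OF blinfun.bounded_linear_left L]]
    have "(\<lambda>n. c *\<^sub>C blinfun_apply (blin_of (X n)) x) \<longlonglongrightarrow> c *\<^sub>C blinfun_apply L x" .
    thus "(\<lambda>n. blinfun_apply (blin_of (X n)) (c *\<^sub>C x)) \<longlonglongrightarrow> c *\<^sub>C blinfun_apply L x"
      by (simp add: ap_scale[unfolded ap.rep_eq])
  qed
  hence L': "blin_of (Abs_bop L) = L" by (simp add: Abs_bop_inverse)
  have "X \<longlonglongrightarrow> Abs_bop L"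
    using L unfolding LIMSEQ_def dist_norm norm_bop.rep_eq minus_bop.rep_eq L' .
  thus "convergent X" by (rule convergentI)
qed

lemma bop_eq_bas: "(\<And>j. ap M (bas j) = ap N (bas j)) \<Longrightarrow> M = N"
proof (rule bop_eqI)
  fix x assume *: "\<And>j. ap M (bas j) = ap N (bas j)"
  have "ap M (trunc n x) = ap N (trunc n x)" for n
    by (simp add: trunc_def ap_sum ap_scale *)
  thus "ap M x = ap N x"
    using tendsto_ap[OF trunc_tendsto[of x], of M] tendsto_ap[OF trunc_tendsto[of x], of N]
      LIMSEQ_unique by simp
qed

subsection \<open>Adjoints\<close>

lemma le_of_square_le: "a * a \<le> a * b \<Longrightarrow> 0 \<le> a \<Longrightarrow> 0 \<le> b \<Longrightarrow> a \<le> (b :: real)"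
  by (cases "a = 0") auto

text \<open>The adjoint is written down by coordinates. For the truncation \<open>z\<close> of the
  candidate vector, \<open>(norm z)^2\<close> equals \<open>cin (ap M z) x\<close>, hence is at most
  \<open>norm M * norm z * norm x\<close>; cancelling \<open>norm z\<close> bounds all truncations
  uniformly.\<close>

lemma adj_exists: "\<exists>N. \<forall>x y. cin x (ap M y) = cin (ap N x) y"
proof -
  define f where "f x j = cin (ap M (bas j)) x" for x j
  have bd: "(\<Sum>i<n. (cmod (f x i))\<^sup>2) \<le> (norm M * norm x)\<^sup>2" for x n
  proof -
    define z where "z = (\<Sum>i<n. f x i *\<^sub>C bas i)"
    define S where "S = (\<Sum>i<n. (cmod (f x i))\<^sup>2)"
    have "coord z i = (if i < n then f x i else 0)" for i
    proof -
      have "coord z i = (\<Sum>j<n. if i = j then f x j else 0)"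
        unfolding z_def coord_sum by (rule sum.cong) auto
      thus ?thesis by (simp add: sum.delta')
    qed
    hence "trunc n z = z" "\<And>i. i < n \<Longrightarrow> coord z i = f x i" by (auto intro!: coord_eqI simp: coord_trunc)
    hence nz: "(norm z)\<^sup>2 = S" using norm_trunc[of n z] by (simp add: S_def)
    have "cin (ap M z) x = of_real S"
      unfolding z_def S_def by (simp add: ap_sum ap_scale cin_sum_left cin_scale_left f_def[symmetric]
          complex_norm_square mult.commute del: of_real_power)
    hence "S \<le> norm (ap M z) * norm x" using cin_cauchy_schwarz[of "ap M z" x]
      by (metis Re_complex_of_real complex_Re_le_cmod order_trans)
    also have "\<dots> \<le> (norm M * norm z) * norm x" by (intro mult_right_mono norm_ap) auto
    finally have "norm z * norm z \<le> norm z * (norm M * norm x)"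
      using nz by (simp add: power2_eq_square algebra_simps)
    hence "norm z \<le> norm M * norm x"
      by (rule le_of_square_le) simp_all
    hence "(norm z)\<^sup>2 \<le> (norm M * norm x)\<^sup>2" by (intro power_mono) auto
    thus ?thesis using nz S_def by simp
  qed
  note l = l2I_bounded[OF bd, OF mult_nonneg_nonneg[OF norm_ge_zero norm_ge_zero]]
  have c: "coord (Abs_ell2 (f x)) i = f x i" for x i using coord_Abs[OF l(1)] by simp
  obtain N where N: "\<And>x. ap N x = Abs_ell2 (f x)"
  proof -
    have "\<exists>N. \<forall>x. ap N x = Abs_ell2 (f x)"
      by (rule bop_ext[of _ "norm M"])
         (auto intro!: coord_eqI l(2) simp: c f_def cin_add_right cin_scale_right)
    thus ?thesis using that by blast
  qed
  have "cin x (ap M y) = cin (ap N x) y" for x y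
  proof (rule LIMSEQ_unique)
    show "(\<lambda>n. cin x (ap M (trunc n y))) \<longlonglongrightarrow> cin x (ap M y)"
      by (intro tendsto_cin tendsto_ap trunc_tendsto)
    have "(\<lambda>n. cin (ap N x) (trunc n y)) \<longlonglongrightarrow> cin (ap N x) y"
      by (intro tendsto_cin trunc_tendsto)
    moreover have "cin x (ap M (trunc n y)) = cin (ap N x) (trunc n y)" for n
      unfolding trunc_def
      by (simp add: ap_sum ap_scale cin_sum_right cin_scale_right N c f_def cin_commute[of x])
    ultimately show "(\<lambda>n. cin x (ap M (trunc n y))) \<longlonglongrightarrow> cin (ap N x) y" by simp
  qed
  thus ?thesis by blast
qed

definition adj :: "bop \<Rightarrow> bop" where
  "adj M = (SOME N. \<forall>x y. cin x (ap M y) = cin (ap N x) y)"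

lemma adj_right: "cin x (ap M y) = cin (ap (adj M) x) y"
  unfolding adj_def using someI_ex[OF adj_exists[of M]] by blast

lemma adj_left: "cin (ap M x) y = cin x (ap (adj M) y)"
  by (metis adj_right cin_commute)

lemma cin_ext: "(\<And>z. cin x z = cin y z) \<Longrightarrow> x = y"
  by (metis cin_diff_left cin_eq_0_imp right_minus_eq)

lemma adj_unique: "(\<And>x y. cin x (ap M y) = cin (ap N x) y) \<Longrightarrow> adj M = N"
  by (rule bop_eqI, rule cin_ext) (metis adj_right)

lemma adj_adj [simp]: "adj (adj M) = M"
  by (rule adj_unique) (simp add: adj_left)

lemma adj_simps [simp]:
  "adj (M * N) = adj N * adj M" "adj (M + N) = adj M + adj N"
  "adj (M - N) = adj M - adj N" "adj (- M) = - adj M" "adj 1 = 1" "adj 0 = 0"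
  "adj (r *\<^sub>R M) = r *\<^sub>R adj M"
  by (rule adj_unique; simp add: adj_right cin_simps scaleR_cscale)+

lemma norm_adj_le: "norm (adj M) \<le> norm M"
proof (rule norm_bop_le)
  fix x
  let ?y = "ap (adj M) x"
  have "of_real ((norm ?y)\<^sup>2) = cin x (ap M ?y)" by (simp add: adj_right cin_norm)
  hence "(norm ?y)\<^sup>2 \<le> norm x * norm (ap M ?y)" using cin_cauchy_schwarz[of x "ap M ?y"]
    by (metis Re_complex_of_real complex_Re_le_cmod order_trans)
  also have "\<dots> \<le> norm x * (norm M * norm ?y)" by (intro mult_left_mono norm_ap) auto
  finally have "norm ?y * norm ?y \<le> norm ?y * (norm M * norm x)" by (simp add: power2_eq_square algebra_simps)
  thus "norm ?y \<le> norm M * norm x"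
    by (rule le_of_square_le) simp_all
qed simp

lemma norm_adj [simp]: "norm (adj M) = norm M"
  using norm_adj_le[of M] norm_adj_le[of "adj M"] by simp

lemma tendsto_adj: "(f \<longlongrightarrow> M) F \<Longrightarrow> ((\<lambda>n. adj (f n)) \<longlongrightarrow> adj M) F"
proof -
  have "bounded_linear adj" by (rule bounded_linear_intro[where K = 1]) auto
  thus "(f \<longlongrightarrow> M) F \<Longrightarrow> ?thesis" by (rule bounded_linear.tendsto)
qed

lemma norm_adj_mult_eq: "(norm (ap M x))\<^sup>2 = Re (cin x (ap (adj M * M) x))"
  by (simp add: norm_eq_cin adj_left)

subsection \<open>Rank-one operators and coordinate projections\<close>

lemma r1_exists: "\<exists>M. \<forall>x. ap M x = cin v x *\<^sub>C u"
proof (rule bop_ext[of _ "norm v * norm u"])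
  fix x
  have "cmod (cin v x) * norm u \<le> (norm v * norm x) * norm u"
    by (rule mult_right_mono[OF cin_cauchy_schwarz]) simp
  thus "norm (cin v x *\<^sub>C u) \<le> norm v * norm u * norm x" by (simp add: mult_ac)
qed (simp_all add: cin_simps cscale_simps)

definition r1 :: "ell2 \<Rightarrow> ell2 \<Rightarrow> bop" where
  "r1 u v = (SOME M. \<forall>x. ap M x = cin v x *\<^sub>C u)"

lemma ap_r1 [simp]: "ap (r1 u v) x = cin v x *\<^sub>C u"
  unfolding r1_def using someI_ex[OF r1_exists[of v u]] by blast

lemma pr_exists: "\<exists>M. \<forall>x i. coord (ap M x) i = (if i \<in> I then coord x i else 0)"
proof -
  define f where "f x i = (if i \<in> I then coord x i else 0)" for x i
  have bd: "(\<Sum>i<n. (cmod (f x i))\<^sup>2) \<le> (norm x)\<^sup>2" for x n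
    by (rule order_trans[OF sum_mono sum_coord_le[of "{..<n}"]]) (auto simp: f_def)
  note l = l2I_bounded[OF bd, OF norm_ge_zero]
  have c: "coord (Abs_ell2 (f x)) i = f x i" for x i using coord_Abs[OF l(1)] by simp
  have "\<exists>N. \<forall>x. ap N x = Abs_ell2 (f x)"
    by (rule bop_ext[of _ 1]) (auto intro!: coord_eqI order_trans[OF l(2)] simp: c f_def)
  then obtain N where "\<And>x. ap N x = Abs_ell2 (f x)" by blast
  thus ?thesis by (intro exI[of _ N]) (simp add: c f_def)
qed

definition pr :: "nat set \<Rightarrow> bop" where
  "pr I = (SOME M. \<forall>x i. coord (ap M x) i = (if i \<in> I then coord x i else 0))"

lemma coord_pr [simp]: "coord (ap (pr I) x) i = (if i \<in> I then coord x i else 0)"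
  unfolding pr_def using someI_ex[OF pr_exists[of I]] by blast

lemma pr_mult [simp]: "pr I * pr K = pr (I \<inter> K)"
  by (rule bop_eqI, rule coord_eqI) simp

lemma pr_bas [simp]: "ap (pr I) (bas i) = (if i \<in> I then bas i else 0)"
  by (rule coord_eqI) auto

lemma pr_UNIV [simp]: "pr UNIV = 1" and pr_empty [simp]: "pr {} = 0"
  by (rule bop_eqI, rule coord_eqI, simp)+

lemma pr_compl: "1 - pr I = pr (- I)"
  by (rule bop_eqI, rule coord_eqI) auto

lemma adj_pr [simp]: "adj (pr I) = pr I"
proof (rule bop_eq_bas, rule coord_eqI)
  fix i j
  have "coord (ap (adj (pr I)) (bas j)) i = cin (bas i) (ap (adj (pr I)) (bas j))" by simp
  also have "\<dots> = cin (ap (pr I) (bas i)) (bas j)" by (simp only: adj_left)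
  also have "\<dots> = coord (ap (pr I) (bas j)) i" by simp
  finally show "coord (ap (adj (pr I)) (bas j)) i = coord (ap (pr I) (bas j)) i" .
qed

lemma pr_atLeast: "ap (pr {n..}) x = x - trunc n x"
  by (rule coord_eqI) (auto simp: coord_trunc)

lemma norm_pr_ap: "norm (ap (pr I) x) \<le> norm x"
proof -
  have "(norm (ap (pr I) x))\<^sup>2 \<le> (norm x)\<^sup>2"
    by (rule sums_le[OF _ norm_sums[of "ap (pr I) x"] norm_sums[of x]]) simp
  thus ?thesis by (rule power2_le_imp_le) simp
qed

lemma norm_pr_le: "norm (pr I) \<le> 1"
  by (rule norm_bop_le) (auto simp: norm_pr_ap)

lemma pr_finite: "finite I \<Longrightarrow> pr I = (\<Sum>i\<in>I. r1 (bas i) (bas i))"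
proof (rule bop_eqI, rule coord_eqI)
  fix x k assume I: "finite I"
  have "coord (ap (\<Sum>i\<in>I. r1 (bas i) (bas i)) x) k = (\<Sum>i\<in>I. if k = i then coord x i else 0)"
    by (simp add: ap_sum_left coord_sum if_distrib cong: if_cong)
  also have "\<dots> = (if k \<in> I then coord x k else 0)"
    by (simp only: sum.delta[OF I] sum.delta'[OF I])
  finally show "coord (ap (pr I) x) k = coord (ap (\<Sum>i\<in>I. r1 (bas i) (bas i)) x) k" by simp
qed

lemma pr_atLeast_tendsto: "(\<lambda>n. ap (pr {n..}) x) \<longlonglongrightarrow> 0"
  unfolding pr_atLeast using tendsto_diff[OF tendsto_const[of x] trunc_tendsto[of x]] by simp

subsection \<open>Matrices\<close>

definition mt :: "bop \<Rightarrow> mat" where "mt M i j = coord (ap M (bas j)) i"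

lemma mt_inj: "mt M = mt N \<Longrightarrow> M = N"
  by (rule bop_eq_bas, rule coord_eqI) (metis mt_def)

lemma mt_cin: "mt M i j = cin (bas i) (ap M (bas j))"
  by (simp add: mt_def)

lemma mt_row: "mt M i j = cnj (coord (ap (adj M) (bas i)) j)"
  unfolding mt_cin adj_right cin_bas_right ..

lemma mt_adj: "mt (adj M) = mat_adj (mt M)"
  unfolding mat_adj_def by (intro ext) (subst mt_row, simp add: mt_def)

lemma mat_apply_mt: "mat_apply (mt M) (coord x) = coord (ap M x)"
proof
  fix i
  have "coord (ap M x) i = cin (ap (adj M) (bas i)) x" by (simp add: adj_right[symmetric])
  thus "mat_apply (mt M) (coord x) i = coord (ap M x) i"
    by (simp add: mat_apply_def cin_def l2inner_def mt_row)
qed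

lemma mt_mult: "mt (M * N) = mat_mult (mt M) (mt N)"
proof (intro ext)
  fix i j
  have "mt (M * N) i j = mat_apply (mt M) (coord (ap N (bas j))) i"
    by (simp add: mat_apply_mt) (simp add: mt_def)
  thus "mt (M * N) i j = mat_mult (mt M) (mt N) i j"
    by (simp add: mat_apply_def mat_mult_def mt_def[of N])
qed

lemma mt_one: "mt 1 = mat_id"
  by (intro ext) (simp add: mt_def mat_id_def)

lemma mt_zero: "mt 0 = mat_zero"
  by (intro ext) (simp add: mt_def mat_zero_def)

lemma mt_add: "mt (M + N) = mat_add (mt M) (mt N)"
  by (intro ext) (simp add: mt_def mat_add_def)

lemma mt_diff: "mt (M - N) = mat_diff (mt M) (mt N)"
  by (intro ext) (simp add: mt_def mat_diff_def)

lemma mt_sum: "mt (sum M A) = (\<lambda>i j. \<Sum>a\<in>A. mt (M a) i j)"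
  by (intro ext) (simp add: mt_def ap_sum_left coord_sum)

lemma bounded_op_mt: "bounded_op (mt M)"
  unfolding bounded_op_def
proof (intro conjI allI exI ballI)
  fix i
  have "(\<lambda>j. cnj (coord (ap (adj M) (bas i)) j)) \<in> l2"
    using coord[of "ap (adj M) (bas i)"] by (simp add: l2_def)
  thus "(\<lambda>j. mt M i j) \<in> l2" by (simp add: mt_row)
next
  fix x assume "x \<in> l2"
  then obtain x' where x': "x = coord x'" using coord_Abs by metis
  show "mat_apply (mt M) x \<in> l2" by (simp add: x' mat_apply_mt coord)
  show "l2norm (mat_apply (mt M) x) \<le> norm M * l2norm x"
    by (simp add: x' mat_apply_mt norm_ell2_l2norm[symmetric] norm_ap)
qed

text \<open>Square-summable rows make the series in \<open>mat_apply\<close> converge; only then is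
  \<open>suminf\<close> additive and the matrix action linear.\<close>

lemma bounded_op_imp_mt:
  assumes "bounded_op B"
  obtains M where "B = mt M"
proof -
  from assms obtain C where row: "\<And>i. (\<lambda>j. B i j) \<in> l2"
    and C: "\<And>x. x \<in> l2 \<Longrightarrow> mat_apply B x \<in> l2 \<and> l2norm (mat_apply B x) \<le> C * l2norm x"
    unfolding bounded_op_def by blast
  have cl: "coord x \<in> l2" for x by (rule coord)
  define f where "f x = Abs_ell2 (mat_apply B (coord x))" for x
  have cf: "coord (f x) = mat_apply B (coord x)" for x
    unfolding f_def using C[OF cl] by (simp add: coord_Abs)
  have row': "(\<lambda>j. cnj (B i j)) \<in> l2" for i using row[of i] by (simp add: l2_def)
  have sm: "summable (\<lambda>j. B i j * coord x j)" for i x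
    using l2_prod_summable[OF row'[of i] cl[of x]] by simp
  have "\<exists>M. \<forall>x. ap M x = f x"
  proof (rule bop_ext)
    show "f (x + y) = f x + f y" for x y
      by (rule coord_eqI) (simp add: cf mat_apply_def distrib_left suminf_add[OF sm sm])
    show "f (c *\<^sub>C x) = c *\<^sub>C f x" for c x
      by (rule coord_eqI) (simp add: cf mat_apply_def suminf_mult[OF sm, symmetric] mult.left_commute)
    show "norm (f x) \<le> C * norm x" for x
      using C[OF cl[of x]] by (simp add: norm_ell2_l2norm cf)
  qed
  then obtain M where M: "\<And>x. ap M x = f x" by blast
  have "B = mt M"
  proof (intro ext)
    fix i j
    have "(\<lambda>k. B i k * coord (bas j) k) sums (\<Sum>k\<in>{j}. B i k * coord (bas j) k)"
      by (rule sums_finite) auto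
    thus "B i j = mt M i j" by (simp add: mt_def M cf mat_apply_def sums_iff)
  qed
  thus thesis by (rule that)
qed

lemma opnorm_mt: "opnorm (mt M) = norm M"
proof -
  define A where "A = (\<lambda>x. l2norm (mat_apply (mt M) x)) ` {x \<in> l2. l2norm x \<le> 1}"
  have A: "A = (\<lambda>x. norm (ap M x)) ` {x. norm x \<le> 1}"
  proof -
    have "{x \<in> l2. l2norm x \<le> 1} = coord ` {x. norm x \<le> 1}"
      by (auto simp: norm_ell2_l2norm coord) (metis coord_Abs imageI mem_Collect_eq)
    thus ?thesis unfolding A_def by (simp add: image_image mat_apply_mt norm_ell2_l2norm[symmetric])
  qed
  have ne: "A \<noteq> {}" using A by (auto intro!: exI[of _ 0])
  have le: "a \<le> norm M" if "a \<in> A" for a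
    using that norm_ap[of M] unfolding A
    by auto (meson mult_left_le norm_ge_zero order_trans)
  have bdd: "bdd_above A" using le by (rule bdd_aboveI)
  have "Sup A \<le> norm M" using cSup_least[OF ne le] .
  moreover have "norm M \<le> Sup A"
  proof (rule norm_bop_le)
    have "norm (ap M 0) \<in> A" unfolding A by (rule imageI) simp
    thus s0: "Sup A \<ge> 0" using cSup_upper[OF _ bdd] by (metis norm_ge_zero order_trans)
    fix x
    show "norm (ap M x) \<le> Sup A * norm x"
    proof (cases "x = 0")
      case False
      have "norm (ap M (inverse (norm x) *\<^sub>R x)) \<in> A" unfolding A using False by (intro imageI) simp
      hence "norm (ap M (inverse (norm x) *\<^sub>R x)) \<le> Sup A" using cSup_upper[OF _ bdd] by blast
      thus ?thesis using False by (simp add: ap_lin field_simps)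
    qed (simp add: ap_lin)
  qed
  ultimately show ?thesis unfolding opnorm_def A_def by simp
qed

section \<open>Operator-theoretic tools: square roots, orthonormal systems, polar factorisation,
  ideals\<close>

subsection \<open>Inverses and square roots of operators close to the identity\<close>

lemma neumann:
  fixes B :: bop
  assumes "norm B < 1"
  obtains W where "(1 - B) * W = 1" "W * (1 - B) = 1"
proof -
  have s: "summable (\<lambda>k. B ^ k)" by (rule complete_algebra_summable_geometric[OF assms])
  define W where "W = (\<Sum>k. B ^ k)"
  have 1: "B * W = W - 1"
    using suminf_mult[OF s, of B] suminf_split_head[OF s] by (simp add: W_def)
  have 2: "W * B = W - 1"
    using suminf_mult2[OF s, of B] suminf_split_head[OF s] by (simp add: W_def power_commutes)
  show thesis by (rule that[of W]) (simp_all add: algebra_simps 1 2)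
qed

lemma inverse_commute:
  fixes G M Z :: "'a :: ring_1"
  assumes "G * M = 1" "M * G = 1" "Z * G = G * Z"
  shows "Z * M = M * Z"
proof -
  have "Z * M = M * G * Z * M" by (simp add: assms)
  also have "\<dots> = M * Z * (G * M)" by (simp add: assms(3) mult.assoc flip: mult.assoc[of Z])
  finally show ?thesis by (simp add: assms)
qed

text \<open>The iteration \<open>N \<mapsto> (L + N\<^sup>2) / 2\<close> is dominated by the scalar iteration \<open>t \<mapsto> (c + t\<^sup>2) / 2\<close>,
  which increases to its fixed point; hence it converges even in the boundary case \<open>c = 1\<close>.\<close>

lemma sqrt_one_minus:
  fixes L :: bop
  assumes L: "norm L \<le> c" and b: "c + b\<^sup>2 = 2 * b" "b \<ge> 0" and sa: "adj L = L"
  obtains N where "norm N \<le> b" "adj N = N" "(1 - N) * (1 - N) = 1 - L"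
    "\<And>Z. Z * L = L * Z \<Longrightarrow> Z * N = N * Z"
proof -
  have c: "c \<ge> 0" using L norm_ge_zero order_trans by blast
  define N where "N = rec_nat 0 (\<lambda>_ M. (1/2) *\<^sub>R (L + M * M))"
  define t where "t = rec_nat (0::real) (\<lambda>_ s. (1/2) * (c + s * s))"
  have N: "N 0 = 0" "N (Suc k) = (1/2) *\<^sub>R (L + N k * N k)" for k by (simp_all add: N_def)
  have t: "t 0 = 0" "t (Suc k) = (1/2) * (c + t k * t k)" for k by (simp_all add: t_def)
  have tb: "0 \<le> t k \<and> t k \<le> b" for k
  proof (induction k)
    case (Suc k)
    hence "t k * t k \<le> b * b" by (intro mult_mono) auto
    thus ?case using Suc c b by (simp add: t power2_eq_square)
  qed (use b in \<open>simp add: t\<close>)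
  have tm: "t k \<le> t (Suc k)" for k
  proof (induction k)
    case (Suc k)
    hence "t k * t k \<le> t (Suc k) * t (Suc k)" using tb by (intro mult_mono) auto
    thus ?case by (simp add: t(2)[of "Suc k"]) (simp add: t)
  qed (use c in \<open>simp add: t\<close>)
  have Nt: "norm (N k) \<le> t k" for k
  proof (induction k)
    case (Suc k)
    have "norm (N (Suc k)) \<le> (1/2) * (norm L + norm (N k * N k))"
      by (simp add: N norm_triangle_ineq)
    also have "\<dots> \<le> (1/2) * (c + t k * t k)"
      by (intro mult_left_mono add_mono L order_trans[OF norm_mult_ineq] mult_mono Suc) (auto simp: tb)
    finally show ?case by (simp add: t)
  qed (simp add: N t)
  have d: "norm (N (Suc k) - N k) \<le> t (Suc k) - t k" for k
  proof (induction k)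
    case (Suc k)
    \<comment> \<open>Non-commutative difference of squares,
      \<open>a a - b b = a (a - b) + (a - b) b\<close>; its scalar analogue is the increment of
      \<open>t\<close>.\<close>
    have "N (Suc (Suc k)) - N (Suc k) =
        (1/2) *\<^sub>R (N (Suc k) * (N (Suc k) - N k) + (N (Suc k) - N k) * N k)"
      unfolding N(2)[of "Suc k"] N(2)[of k, symmetric]
      by (subst (3) N(2)) (simp add: algebra_simps)
    hence "norm (N (Suc (Suc k)) - N (Suc k)) \<le>
        (1/2) * (norm (N (Suc k) * (N (Suc k) - N k)) + norm ((N (Suc k) - N k) * N k))"
      by (simp add: norm_triangle_ineq)
    also have "\<dots> \<le> (1/2) * (t (Suc k) * (t (Suc k) - t k) + (t (Suc k) - t k) * t k)"
      by (intro mult_left_mono add_mono order_trans[OF norm_mult_ineq] mult_mono Suc Nt) (auto simp: tb tm)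
    also have "\<dots> = t (Suc (Suc k)) - t (Suc k)"
      by (simp add: t(2)[of "Suc k"]) (simp add: t(2)[of k] algebra_simps)
    finally show ?case .
  qed (use L in \<open>simp add: N t\<close>)
  have "convergent t"
    by (rule Bseq_monoseq_convergent)
       (use tb tm in \<open>auto intro!: BseqI'[of _ b] simp: monoseq_Suc\<close>)
  hence "summable (\<lambda>k. t (Suc k) - t k)"
    unfolding convergent_def using telescope_summable by blast
  hence "summable (\<lambda>k. N (Suc k) - N k)"
    by (rule summable_comparison_test') (rule d)
  hence "(\<lambda>n. \<Sum>k<n. N (Suc k) - N k) \<longlonglongrightarrow> (\<Sum>k. N (Suc k) - N k)"
    by (rule summable_LIMSEQ)
  moreover define M where "M = (\<Sum>k. N (Suc k) - N k)"
  ultimately have lim: "N \<longlonglongrightarrow> M"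
    unfolding sum_lessThan_telescope by (simp only: N(1) diff_zero)
  show thesis
  proof (rule that[of M])
    show "norm M \<le> b"
      by (rule LIMSEQ_le_const2[OF tendsto_norm[OF lim]]) (meson Nt tb order_trans)
    have "adj (N k) = N k" for k by (induction k) (simp_all add: N sa)
    with tendsto_adj[OF lim] have "N \<longlonglongrightarrow> adj M" by simp
    thus "adj M = M" using lim LIMSEQ_unique by blast
    have "(\<lambda>k. N (Suc k)) \<longlonglongrightarrow> (1/2) *\<^sub>R (L + M * M)"
      unfolding N by (intro tendsto_intros lim)
    hence "M = (1/2) *\<^sub>R (L + M * M)" using LIMSEQ_Suc[OF lim] LIMSEQ_unique by blast
    hence "2 *\<^sub>R M = 2 *\<^sub>R ((1/2) *\<^sub>R (L + M * M))" by (rule arg_cong)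
    hence "M + M = L + M * M" by (simp add: scaleR_2)
    thus "(1 - M) * (1 - M) = 1 - L" by (simp add: algebra_simps)
    show "Z * M = M * Z" if Z: "Z * L = L * Z" for Z
    proof -
      have "Z * N k = N k * Z" for k
      proof (induction k)
        case (Suc k)
        have "Z * (N k * N k) = N k * N k * Z" by (metis Suc mult.assoc)
        thus ?case by (simp add: N algebra_simps Z)
      qed (simp add: N)
      hence "(\<lambda>k. Z * N k) \<longlonglongrightarrow> M * Z"
        using tendsto_mult[OF lim tendsto_const[of Z]] by simp
      thus ?thesis using tendsto_mult[OF tendsto_const[of Z] lim] LIMSEQ_unique by blast
    qed
  qed
qed

subsection \<open>Orthonormal systems\<close>

text \<open>Orthonormal systems may contain zero vectors; this saves all reindexing.\<close>

definition ons :: "(nat \<Rightarrow> ell2) \<Rightarrow> bool" where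
  "ons g \<longleftrightarrow> (\<forall>k l. k \<noteq> l \<longrightarrow> cin (g k) (g l) = 0) \<and> (\<forall>k. norm (g k) = 0 \<or> norm (g k) = 1)"

lemma ons_orth: "ons g \<Longrightarrow> k \<noteq> l \<Longrightarrow> cin (g k) (g l) = 0"
  by (simp add: ons_def)

lemma ons_self: "ons g \<Longrightarrow> cin (g k) (g k) *\<^sub>C g k = g k"
  unfolding ons_def cin_norm by (cases "norm (g k) = 0") auto

lemma ons_self_mult: "ons g \<Longrightarrow> cin (g k) (g k) * cin (g k) x = cin (g k) x"
  by (metis ons_self cin_scale_left cin_commute)

lemma ons_norm: "ons g \<Longrightarrow> norm (g k) \<le> 1"
  unfolding ons_def by (metis order_refl zero_le_one)

lemma ons_sum:
  assumes "ons g" "finite A" "k \<in> A"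
  shows "(\<Sum>l\<in>A. c l * cin (g k) (g l)) = c k * cin (g k) (g k)"
proof -
  have "(\<Sum>l\<in>A. c l * cin (g k) (g l)) = (\<Sum>l\<in>A. if l = k then c k * cin (g k) (g k) else 0)"
    by (rule sum.cong) (auto simp: ons_orth[OF assms(1)])
  thus ?thesis using assms by simp
qed

lemma ons_norm_sum:
  assumes "ons g" "finite A"
  shows "(norm (x - (\<Sum>k\<in>A. cin (g k) x *\<^sub>C g k)))\<^sup>2 = (norm x)\<^sup>2 - (\<Sum>k\<in>A. (cmod (cin (g k) x))\<^sup>2)"
proof -
  define p where "p = (\<Sum>k\<in>A. cin (g k) x *\<^sub>C g k)"
  define S where "S = (\<Sum>k\<in>A. (cmod (cin (g k) x))\<^sup>2)"
  have px: "cin p x = of_real S"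
    unfolding p_def S_def by (simp add: cin_sum_left cin_scale_left complex_norm_square mult.commute del: of_real_power)
  have "cin p p = (\<Sum>k\<in>A. cnj (cin (g k) x) * (\<Sum>l\<in>A. cin (g l) x * cin (g k) (g l)))"
    unfolding p_def cin_sum_left cin_scale_left by (simp only: cin_sum_right cin_scale_right)
  also have "\<dots> = (\<Sum>k\<in>A. cnj (cin (g k) x) * cin (g k) x)"
  proof (rule sum.cong)
    fix k assume "k \<in> A"
    thus "cnj (cin (g k) x) * (\<Sum>l\<in>A. cin (g l) x * cin (g k) (g l)) = cnj (cin (g k) x) * cin (g k) x"
      using ons_sum[OF assms, of k "\<lambda>l. cin (g l) x"] ons_self_mult[OF assms(1), of k x]
      by (simp add: mult.commute)
  qed simp
  also have "\<dots> = of_real S"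
    unfolding S_def by (simp add: complex_norm_square mult.commute del: of_real_power)
  finally have pp: "cin p p = of_real S" .
  have "cin x p = of_real S" using px by (metis cin_commute complex_cnj_complex_of_real)
  hence "cin (x - p) (x - p) = of_real ((norm x)\<^sup>2 - S)"
    by (simp add: cin_diff_left cin_diff_right px pp cin_norm[of x])
  thus ?thesis unfolding p_def[symmetric] S_def[symmetric]
    by (simp only: norm_eq_cin[of "x - p"] Re_complex_of_real)
qed

lemma bessel:
  assumes "ons g" "finite A"
  shows "(\<Sum>k\<in>A. (cmod (cin (g k) x))\<^sup>2) \<le> (norm x)\<^sup>2"
  using ons_norm_sum[OF assms, of x] zero_le_power2[of "norm (x - (\<Sum>k\<in>A. cin (g k) x *\<^sub>C g k))"] by linarith

definition oproj :: "(nat \<Rightarrow> ell2) \<Rightarrow> nat \<Rightarrow> bop" where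
  "oproj g m = (\<Sum>l<m. r1 (g l) (g l))"

lemma ap_oproj: "ap (oproj g m) x = (\<Sum>l<m. cin (g l) x *\<^sub>C g l)"
  by (simp add: oproj_def ap_sum_left)

lemma cin_oproj:
  assumes "ons g" "j < m"
  shows "cin (g j) (ap (oproj g m) x) = cin (g j) x"
  using assms(2) ons_self_mult[OF assms(1), of j x]
  by (simp add: ap_oproj cin_simps ons_sum[OF assms(1)] mult.commute)

lemma oproj_idem:
  assumes "ons g"
  shows "ap (oproj g m) (ap (oproj g m) x) = ap (oproj g m) x"
proof -
  have "(\<Sum>l<m. cin (g l) (ap (oproj g m) x) *\<^sub>C g l) = (\<Sum>l<m. cin (g l) x *\<^sub>C g l)"
    by (rule sum.cong) (simp_all add: cin_oproj[OF assms])
  thus ?thesis by (simp only: ap_oproj[of g m "ap (oproj g m) x"]) (simp only: ap_oproj[of g m x])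
qed

lemma norm_sub_oproj:
  assumes "ons g"
  shows "norm (x - ap (oproj g m) x) \<le> norm x"
proof (rule power2_le_imp_le)
  have "0 \<le> (\<Sum>l<m. (cmod (cin (g l) x))\<^sup>2)" by (intro sum_nonneg) simp
  thus "(norm (x - ap (oproj g m) x))\<^sup>2 \<le> (norm x)\<^sup>2"
    using ons_norm_sum[OF assms finite_lessThan, of x m] unfolding ap_oproj by linarith
qed simp

lemma adj_oproj: "adj (oproj g m) = oproj g m"
  by (rule adj_unique) (simp add: ap_oproj cin_simps cin_commute[of _ "g _"] mult.commute)

text \<open>Packs infinitely many coefficient functionals into one operator \<open>G\<close>;
  \<open>adj G\<close> then synthesises, sending basis vectors to the \<open>g k\<close>.\<close>

lemma rows_exists:
  assumes "\<And>x n. (\<Sum>k<n. (cmod (cin (g k) x))\<^sup>2) \<le> (K * norm x)\<^sup>2" "K \<ge> 0"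
  obtains G where "\<And>x k. coord (ap G x) k = cin (g k) x" "norm G \<le> K" "\<And>k. ap (adj G) (bas k) = g k"
proof -
  define f where "f x k = cin (g k) x" for x k
  have bd: "(\<Sum>i<n. (cmod (f x i))\<^sup>2) \<le> (K * norm x)\<^sup>2" for x n
    unfolding f_def by (rule assms)
  note l = l2I_bounded[OF bd, OF mult_nonneg_nonneg[OF assms(2) norm_ge_zero]]
  have c: "coord (Abs_ell2 (f x)) i = f x i" for x i using coord_Abs[OF l(1)] by simp
  have "\<exists>N. \<forall>x. ap N x = Abs_ell2 (f x)"
    by (rule bop_ext[of _ K]) (auto intro!: coord_eqI l(2) simp: c f_def cin_add_right cin_scale_right)
  then obtain G where G: "\<And>x. ap G x = Abs_ell2 (f x)" by blast
  have 1: "coord (ap G x) k = cin (g k) x" for x k by (simp add: G c f_def)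
  show thesis
  proof (rule that[of G])
    show "norm G \<le> K" by (rule norm_bop_le[OF assms(2)]) (simp add: G l(2))
    show "ap (adj G) (bas k) = g k" for k
      by (rule cin_ext) (simp add: adj_right[symmetric] 1)
  qed (rule 1)
qed

lemma ons_rows:
  assumes "ons g"
  obtains G where "\<And>x k. coord (ap G x) k = cin (g k) x" "norm G \<le> 1" "\<And>k. ap (adj G) (bas k) = g k"
  by (rule rows_exists[of g 1]) (use bessel[OF assms] in auto)

text \<open>The process runs on preimages: it returns \<open>h\<close> rather than just the
  orthonormal vectors \<open>ap S (h k)\<close>, so that \<open>polar_factor\<close> can apply a
  second operator with the same Gram matrix to the same \<open>h\<close>.\<close>

lemma gram_schmidt:
  obtains h where "ons (\<lambda>k. ap S (h k))"
    "\<And>k. ap S (bas k) = (\<Sum>l\<le>k. cin (ap S (h l)) (ap S (bas k)) *\<^sub>C ap S (h l))"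
proof -
  define r where "r f k = bas k - (\<Sum>l<k. cin (ap S (f l)) (ap S (bas k)) *\<^sub>C f l)" for f :: "nat \<Rightarrow> ell2" and k
  \<comment> \<open>Since \<open>inverse 0 = 0\<close>, a dependent vector yields
    \<open>h k = 0\<close>, which \<open>ons\<close> tolerates. \<open>P f k\<close> looks at
    \<open>f\<close> only below \<open>k\<close>, as the well-founded choice requires.\<close>
  define P where "P f k x \<longleftrightarrow> x = inverse (norm (ap S (r f k))) *\<^sub>R r f k" for f k x
  have "\<exists>h. \<forall>k. P h k (h k)"
  proof (rule dependent_wf_choice[OF wf_less])
    show "P f k x = P g k x" if "\<And>z. (z, k) \<in> {(x, y). x < y} \<Longrightarrow> f z = g z" for f g k x
    proof -
      have "r f k = r g k" unfolding r_def using that by simp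
      thus ?thesis by (simp add: P_def)
    qed
    show "\<exists>x. P f k x" for f k by (simp add: P_def)
  qed
  then obtain h where h: "\<And>k. h k = inverse (norm (ap S (r h k))) *\<^sub>R r h k" unfolding P_def by blast
  define q where "q k = ap S (h k)" for k
  define w where "w k = ap S (bas k)" for k
  define u where "u k = ap S (r h k)" for k
  have q: "q k = inverse (norm (u k)) *\<^sub>R u k" for k
    unfolding q_def u_def by (subst h) (simp add: ap_lin)
  have n: "norm (q k) = 0 \<or> norm (q k) = 1" for k
    unfolding q by (cases "u k = 0") auto
  have qq: "cin (q k) (q k) * cin (q k) x = cin (q k) x" for k x
  proof (cases "q k = 0")
    case False
    thus ?thesis using n[of k] by (simp add: cin_norm)
  qed simp
  have u: "u k = w k - (\<Sum>l<k. cin (q l) (w k) *\<^sub>C q l)" for k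
    unfolding u_def r_def by (simp add: ap_lin ap_sum ap_scale q_def w_def)
  have orth: "\<forall>l<k. cin (q l) (q k) = 0" for k
  proof (induction k rule: less_induct)
    case (less k)
    have "cin (q l) (u k) = 0" if "l < k" for l
    proof -
      have "(\<Sum>j<k. cin (q j) (w k) * cin (q l) (q j)) =
          (\<Sum>j<k. if j = l then cin (q l) (w k) else 0)"
      proof (rule sum.cong)
        fix j assume j: "j \<in> {..<k}"
        have "cin (q l) (q j) = 0" if "j \<noteq> l"
          using less.IH[of j] less.IH[of l] \<open>l < k\<close> j that by (metis cin_commute complex_cnj_zero lessThan_iff linorder_neqE_nat)
        thus "cin (q j) (w k) * cin (q l) (q j) = (if j = l then cin (q l) (w k) else 0)"
          using qq[of l "w k"] by (auto simp: mult.commute)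
      qed simp
      thus ?thesis unfolding u using that by (simp add: cin_simps)
    qed
    thus ?case unfolding q[of k] by (simp add: scaleR_cscale cin_scale_right)
  qed
  show thesis
  proof (rule that[of h])
    show "ons (\<lambda>k. ap S (h k))"
      unfolding ons_def q_def[symmetric]
      using n orth by (metis cin_commute complex_cnj_zero linorder_neqE_nat)
    fix k
    have "(\<Sum>l<k. cin (q l) (w k) * cin (q k) (q l)) = 0"
      using orth[of k] by (intro sum.neutral) (metis cin_commute complex_cnj_zero lessThan_iff mult_zero_right)
    hence "cin (q k) (w k) = cin (q k) (u k)" unfolding u by (simp add: cin_simps)
    also have "cin (q k) (u k) *\<^sub>C q k = u k"
    proof (cases "u k = 0")
      case False
      hence "u k = of_real (norm (u k)) *\<^sub>C q k" unfolding q
        by (simp add: scaleR_cscale cscale_simps)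
      have "inverse a * (a * a) * inverse a = 1" if "a \<noteq> 0" for a :: complex
        using that by (simp add: mult.assoc[symmetric])
      thus ?thesis using False q[of k]
        by (simp add: cin_scale_right scaleR_cscale cin_scale_left cin_norm cscale_simps power2_eq_square)
    qed simp
    ultimately have "w k = (\<Sum>l<k. cin (q l) (w k) *\<^sub>C q l) + cin (q k) (w k) *\<^sub>C q k"
      by (simp add: u)
    also have "\<dots> = (\<Sum>l\<le>k. cin (q l) (w k) *\<^sub>C q l)"
      by (simp add: lessThan_Suc_atMost[symmetric])
    finally show "ap S (bas k) = (\<Sum>l\<le>k. cin (ap S (h l)) (ap S (bas k)) *\<^sub>C ap S (h l))"
      unfolding q_def w_def .
  qed
qed

lemma gram_schmidt_finite:
  assumes "finite V"
  obtains g where "ons g" "\<And>v. v \<in> V \<Longrightarrow> v = (\<Sum>l<card V. cin (g l) v *\<^sub>C g l)"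
proof -
  obtain e where e: "bij_betw e {..<card V} V"
    using ex_bij_betw_nat_finite[OF assms] by (auto simp: atLeast0LessThan)
  \<comment> \<open>An operator whose first columns enumerate \<open>V\<close>, so that the general
    process applies.\<close>
  define S where "S = (\<Sum>k<card V. r1 (e k) (bas k))"
  have S: "ap S (bas k) = e k" if "k < card V" for k
  proof -
    have "ap S (bas k) = (\<Sum>j<card V. if j = k then e k else 0)"
      unfolding S_def ap_sum_left by (rule sum.cong) auto
    thus ?thesis using that by simp
  qed
  obtain h where h: "ons (\<lambda>k. ap S (h k))"
    "\<And>k. ap S (bas k) = (\<Sum>l\<le>k. cin (ap S (h l)) (ap S (bas k)) *\<^sub>C ap S (h l))"
    using gram_schmidt by blast
  show thesis
  proof (rule that[OF h(1)])
    fix v assume "v \<in> V"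
    then obtain k where k: "k < card V" "v = e k" using e by (auto simp: bij_betw_def)
    have v: "v = (\<Sum>l\<le>k. cin (ap S (h l)) v *\<^sub>C ap S (h l))"
      using h(2)[of k] by (simp add: S k)
    have "(\<Sum>l<card V. cin (ap S (h l)) v *\<^sub>C ap S (h l)) = (\<Sum>l\<le>k. cin (ap S (h l)) v *\<^sub>C ap S (h l))"
    proof (rule sum.mono_neutral_right)
      show "\<forall>l\<in>{..<card V} - {..k}. cin (ap S (h l)) v *\<^sub>C ap S (h l) = 0"
      proof
        fix l assume l: "l \<in> {..<card V} - {..k}"
        have "cin (ap S (h l)) v = (\<Sum>j\<le>k. cin (ap S (h j)) v * cin (ap S (h l)) (ap S (h j)))"
          by (subst v) (simp add: cin_simps)
        also have "\<dots> = 0" using l by (intro sum.neutral) (auto simp: ons_orth[OF h(1)])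
        finally show "cin (ap S (h l)) v *\<^sub>C ap S (h l) = 0" by simp
      qed
    qed (use k in auto)
    thus "v = (\<Sum>l<card V. cin (ap S (h l)) v *\<^sub>C ap S (h l))" using v by simp
  qed
qed

lemma span_ons:
  assumes "\<And>v. v \<in> V \<Longrightarrow> v = (\<Sum>l<n. cin (g l) v *\<^sub>C g l)"
  shows "(\<Sum>v\<in>V. c v *\<^sub>C v) = (\<Sum>l<n. cin (g l) (\<Sum>v\<in>V. c v *\<^sub>C v) *\<^sub>C g l)"
proof -
  have "(\<Sum>v\<in>V. c v *\<^sub>C v) = (\<Sum>v\<in>V. c v *\<^sub>C (\<Sum>l<n. cin (g l) v *\<^sub>C g l))"
    by (rule sum.cong) (use assms in auto)
  also have "\<dots> = (\<Sum>l<n. \<Sum>v\<in>V. (c v * cin (g l) v) *\<^sub>C g l)"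
    by (subst sum.swap) (simp add: cscale_sum cscale_simps)
  also have "\<dots> = (\<Sum>l<n. cin (g l) (\<Sum>v\<in>V. c v *\<^sub>C v) *\<^sub>C g l)"
    by (rule sum.cong) (auto intro!: coord_eqI simp: cin_simps coord_sum sum_distrib_right)
  finally show ?thesis .
qed

subsection \<open>The adjoint of an operator is a two-sided multiple of it\<close>

lemma adj_rows_rows:
  assumes g: "ons g" and G: "\<And>x k. coord (ap G x) k = cin (g k) x" "\<And>k. ap (adj G) (bas k) = g k"
  shows "ap (adj G) (ap G (\<Sum>l\<in>A. c l *\<^sub>C g l)) = (\<Sum>l\<in>A. c l *\<^sub>C g l)"
proof -
  have "ap G (g l) = cin (g l) (g l) *\<^sub>C bas l" for l
    by (rule coord_eqI) (auto simp: G ons_orth[OF g])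
  hence "ap (adj G) (ap G (g l)) = g l" for l
    by (simp add: ap_scale G ons_self[OF g])
  thus ?thesis by (simp add: ap_sum ap_scale)
qed

text \<open>Equal Gram operators make \<open>S x\<close> to \<open>R x\<close> isometric. Instead of
  extending this map by continuity, \<open>C\<close> is obtained by analysing along the orthonormal
  \<open>ap S (h k)\<close> and synthesising with the matching \<open>ap R (h k)\<close>.\<close>

lemma polar_factor:
  assumes "adj S * S = adj R * R"
  obtains C where "C * S = R" "adj C * R = S"
proof -
  have SR: "cin (ap S x) (ap S y) = cin (ap R x) (ap R y)" for x y
    by (simp only: adj_left ap_simps(6)[symmetric] assms)
  have nSR: "norm (ap S x) = norm (ap R x)" for x
    by (rule power2_eq_imp_eq) (simp_all add: norm_eq_cin SR)
  obtain h where h: "ons (\<lambda>k. ap S (h k))"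
    "\<And>k. ap S (bas k) = (\<Sum>l\<le>k. cin (ap S (h l)) (ap S (bas k)) *\<^sub>C ap S (h l))"
    using gram_schmidt by blast
  have hR: "ons (\<lambda>k. ap R (h k))" using h(1) unfolding ons_def by (simp add: SR nSR)
  have hR2: "ap R (bas k) = (\<Sum>l\<le>k. cin (ap R (h l)) (ap R (bas k)) *\<^sub>C ap R (h l))" for k
  proof -
    define y where "y = bas k - (\<Sum>l\<le>k. cin (ap S (h l)) (ap S (bas k)) *\<^sub>C h l)"
    have "ap S y = 0" using h(2)[of k] by (simp add: y_def ap_lin ap_sum ap_scale)
    hence "ap R y = 0" using nSR[of y] by simp
    thus ?thesis by (simp add: y_def ap_lin ap_sum ap_scale SR)
  qed
  obtain G where G: "\<And>x k. coord (ap G x) k = cin (ap S (h k)) x" "norm G \<le> 1" "\<And>k. ap (adj G) (bas k) = ap S (h k)"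
    by (rule ons_rows[OF h(1)], rule that)
  obtain H where H: "\<And>x k. coord (ap H x) k = cin (ap R (h k)) x" "norm H \<le> 1" "\<And>k. ap (adj H) (bas k) = ap R (h k)"
    by (rule ons_rows[OF hR], rule that)
  have GH: "G * S = H * R"
    by (rule bop_eqI, rule coord_eqI) (simp add: G H SR)
  have 1: "adj G * (G * S) = S"
  proof (rule bop_eq_bas)
    fix j
    have "ap (adj G) (ap G (ap S (bas j))) = ap S (bas j)"
      using adj_rows_rows[OF h(1) G(1,3), of "\<lambda>l. cin (ap S (h l)) (ap S (bas j))" "{..j}"]
      unfolding h(2)[of j, symmetric] .
    thus "ap (adj G * (G * S)) (bas j) = ap S (bas j)" by simp
  qed
  have 2: "adj H * (H * R) = R"
  proof (rule bop_eq_bas)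
    fix j
    have "ap (adj H) (ap H (ap R (bas j))) = ap R (bas j)"
      using adj_rows_rows[OF hR H(1,3), of "\<lambda>l. cin (ap R (h l)) (ap R (bas j))" "{..j}"]
      unfolding hR2[of j, symmetric] .
    thus "ap (adj H * (H * R)) (bas j) = ap R (bas j)" by simp
  qed
  show thesis
    by (rule that[of "adj H * G"]) (use 1 2 GH in \<open>simp_all add: mult.assoc\<close>)
qed

text \<open>Expanding the square, the quadratic term is at most half the cross term. This puts
  \<open>adj S * S\<close>, rescaled, into the boundary case \<open>c = b = 1\<close> of
  \<open>sqrt_one_minus\<close>.\<close>

lemma norm_one_minus_square:
  assumes "norm S \<le> K" "K > 0"
  shows "norm (1 - (1 / K\<^sup>2) *\<^sub>R (adj S * S)) \<le> 1"
proof (rule norm_bop_le)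
  fix x
  define y where "y = ap (adj S * S) x"
  have yK: "(norm y)\<^sup>2 \<le> K\<^sup>2 * (norm (ap S x))\<^sup>2"
  proof -
    have "norm y \<le> norm S * norm (ap S x)" using norm_ap[of "adj S" "ap S x"] by (simp add: y_def)
    also have "\<dots> \<le> K * norm (ap S x)" using assms by (intro mult_right_mono) auto
    finally have "(norm y)\<^sup>2 \<le> (K * norm (ap S x))\<^sup>2" by (intro power_mono) auto
    thus ?thesis by (simp add: power_mult_distrib)
  qed
  have i1: "inner x y = (norm (ap S x))\<^sup>2"
    using norm_adj_mult_eq[of S x] by (simp add: y_def inner_ell2_def)
  hence i: "inner x y = (norm (ap S x))\<^sup>2" "inner y x = (norm (ap S x))\<^sup>2"
    by (simp_all add: inner_commute)
  define s where "s = 1 / K\<^sup>2"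
  have "(norm (x - s *\<^sub>R y))\<^sup>2 = (norm x)\<^sup>2 - 2 * s * (norm (ap S x))\<^sup>2 + s\<^sup>2 * (norm y)\<^sup>2"
    unfolding power2_norm_eq_inner by (simp add: inner_diff_left inner_diff_right i power2_eq_square)
       (simp add: power2_norm_eq_inner[symmetric] power2_eq_square algebra_simps)
  also have "s\<^sup>2 * (norm y)\<^sup>2 \<le> s\<^sup>2 * (K\<^sup>2 * (norm (ap S x))\<^sup>2)" by (intro mult_left_mono yK) auto
  also have "\<dots> = s * (norm (ap S x))\<^sup>2" using assms(2) by (simp add: s_def power2_eq_square)
  finally have "(norm (x - s *\<^sub>R y))\<^sup>2 \<le> (norm x)\<^sup>2 - s * (norm (ap S x))\<^sup>2" by (simp add: algebra_simps)
  also have "\<dots> \<le> (norm x)\<^sup>2" by (simp add: s_def)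
  finally have "norm (x - s *\<^sub>R y) \<le> norm x" by (rule power2_le_imp_le) simp
  thus "norm (ap (1 - (1 / K\<^sup>2) *\<^sub>R (adj S * S)) x) \<le> 1 * norm x" by (simp add: y_def s_def)
qed simp

text \<open>With \<open>R\<close> the modulus of \<open>S\<close>, \<open>C * S = R\<close> and
  \<open>adj C * R = S\<close> give \<open>adj S = R * C = C * S * C\<close>. This is how ideals,
  defined by sums and products only, turn out to be closed under adjoints.\<close>

lemma adj_factor:
  obtains C where "adj S = C * S * C"
proof -
  \<comment> \<open>The added 1 keeps \<open>K\<close> positive for \<open>S = 0\<close>.\<close>
  define K where "K = norm S + 1"
  have K: "K > 0" "norm S \<le> K" unfolding K_def by (simp_all add: add_nonneg_pos)
  obtain N where N: "adj N = N" "(1 - N) * (1 - N) = 1 - (1 - (1 / K\<^sup>2) *\<^sub>R (adj S * S))"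
    by (rule sqrt_one_minus[of "1 - (1 / K\<^sup>2) *\<^sub>R (adj S * S)" 1 1])
       (use norm_one_minus_square[OF K(2,1)] in auto)
  define R where "R = K *\<^sub>R (1 - N)"
  have R: "adj R = R" by (simp add: R_def N)
  have "R * R = adj S * S" unfolding R_def using K(1) by (simp add: N(2) power2_eq_square)
  then obtain C where "C * S = R" "adj C * R = S" using polar_factor[of S R] R by auto
  hence "adj S = R * C" by (metis R adj_adj adj_simps(1))
  thus thesis using that[of C] \<open>C * S = R\<close> by simp
qed

subsection \<open>Ideals\<close>

locale bop_ideal =
  fixes I :: "bop set"
  assumes zero_mem: "0 \<in> I"
    and add_mem: "X \<in> I \<Longrightarrow> Y \<in> I \<Longrightarrow> X + Y \<in> I"
    and mult_left_mem: "X \<in> I \<Longrightarrow> M * X \<in> I"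
    and mult_right_mem: "X \<in> I \<Longrightarrow> X * M \<in> I"
    and nonzero: "\<exists>X\<in>I. X \<noteq> 0"
    and proper: "1 \<notin> I"
begin

lemma uminus_mem: "X \<in> I \<Longrightarrow> - X \<in> I"
  using mult_left_mem[of X "- 1"] by simp

lemma diff_mem: "X \<in> I \<Longrightarrow> Y \<in> I \<Longrightarrow> X - Y \<in> I"
  using add_mem[of X "- Y"] uminus_mem by simp

lemma sum_mem: "(\<And>a. a \<in> A \<Longrightarrow> f a \<in> I) \<Longrightarrow> sum f A \<in> I"
  by (induction A rule: infinite_finite_induct) (auto intro: zero_mem add_mem)

lemma adj_mem: "X \<in> I \<Longrightarrow> adj X \<in> I"
  using adj_factor[of X] mult_left_mem mult_right_mem by metis

text \<open>Sandwiching a nonzero element between rank-one operators gives a nonzero multiple of any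
  prescribed rank-one operator; the factor \<open>cin y y\<close> is compensated in
  \<open>u\<close>.\<close>

lemma r1_mem: "r1 u v \<in> I"
proof -
  obtain X where X: "X \<in> I" "X \<noteq> 0" using nonzero by blast
  then obtain j where j: "ap X (bas j) \<noteq> 0" using bop_eq_bas[of X 0] by auto
  define y where "y = ap X (bas j)"
  have "cin y y \<noteq> 0" using j cin_eq_0_imp y_def by blast
  have "r1 (cin y y *\<^sub>C inverse (cin y y) *\<^sub>C u) v = r1 u v"
    using \<open>cin y y \<noteq> 0\<close> by (simp add: cscale_simps)
  moreover have "r1 (cin y y *\<^sub>C u') v \<in> I" for u'
  proof -
    have "r1 u' y * X * r1 (bas j) v = r1 (cin y y *\<^sub>C u') v"
      by (rule bop_eqI) (simp add: y_def ap_scale cin_scale_right cscale_simps mult.commute)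
    thus ?thesis using X mult_left_mem mult_right_mem by metis
  qed
  ultimately show ?thesis by metis
qed

lemma pr_finite_mem: "finite A \<Longrightarrow> pr A \<in> I"
  by (simp add: pr_finite sum_mem r1_mem)

end

lemma one_factors_through:
  fixes x :: "nat \<Rightarrow> ell2"
  assumes orth: "\<And>k l. k \<noteq> l \<Longrightarrow> cin (x k) (x l) = 0" "\<And>k l. k \<noteq> l \<Longrightarrow> cin (ap B (x k)) (ap B (x l)) = 0"
    and x: "\<And>k. norm (x k) = 1" and e: "\<epsilon> > 0" "\<And>k. norm (ap B (x k)) \<ge> \<epsilon>"
  obtains C D where "C * B * D = 1"
proof -
  have "ons x" using orth(1) x by (simp add: ons_def)
  obtain G where G: "\<And>z k. coord (ap G z) k = cin (x k) z" "norm G \<le> 1" "\<And>k. ap (adj G) (bas k) = x k"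
    by (rule ons_rows[OF \<open>ons x\<close>], rule that)
  define c where "c k = complex_of_real (1 / norm (ap B (x k)))" for k
  have B0: "ap B (x k) \<noteq> 0" for k using e(1) e(2)[of k] by auto
  define y where "y k = c k *\<^sub>C ap B (x k)" for k
  have cn: "cmod (c k) \<le> 1 / \<epsilon>" for k
    using e(1) e(2)[of k] by (simp add: c_def norm_divide frac_le)
  have "ons y" unfolding ons_def y_def
    using orth(2) B0 by (simp add: cin_simps c_def norm_divide)
  \<comment> \<open>One factor \<open>c k\<close> normalises the image, the second makes
    \<open>cin (z k) (ap B (x k)) = 1\<close>. The lower bound on the images bounds
    \<open>c\<close>, and with it the operator with rows \<open>z k\<close>.\<close>
  define z where "z k = c k *\<^sub>C y k" for k
  have bd: "(\<Sum>k<n. (cmod (cin (z k) v))\<^sup>2) \<le> (1 / \<epsilon> * norm v)\<^sup>2" for n v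
  proof -
    have "(\<Sum>k<n. (cmod (cin (z k) v))\<^sup>2) \<le> (\<Sum>k<n. (1/\<epsilon>)\<^sup>2 * (cmod (cin (y k) v))\<^sup>2)"
    proof (rule sum_mono)
      fix k
      have "cmod (cin (z k) v) \<le> (1/\<epsilon>) * cmod (cin (y k) v)"
        unfolding z_def cin_scale_left norm_mult complex_mod_cnj by (rule mult_right_mono[OF cn]) simp
      hence "(cmod (cin (z k) v))\<^sup>2 \<le> ((1/\<epsilon>) * cmod (cin (y k) v))\<^sup>2" by (intro power_mono) auto
      thus "(cmod (cin (z k) v))\<^sup>2 \<le> (1/\<epsilon>)\<^sup>2 * (cmod (cin (y k) v))\<^sup>2" by (simp only: power_mult_distrib)
    qed
    also have "\<dots> = (1/\<epsilon>)\<^sup>2 * (\<Sum>k<n. (cmod (cin (y k) v))\<^sup>2)" by (simp only: sum_distrib_left)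
    also have "\<dots> \<le> (1/\<epsilon>)\<^sup>2 * (norm v)\<^sup>2" by (intro mult_left_mono bessel \<open>ons y\<close>) auto
    finally show ?thesis by (simp only: power_mult_distrib)
  qed
  obtain H where H: "\<And>v k. coord (ap H v) k = cin (z k) v" "norm H \<le> 1 / \<epsilon>" "\<And>k. ap (adj H) (bas k) = z k"
    by (rule rows_exists[OF bd], use e in simp, rule that)
  have "H * B * adj G = 1"
  proof (rule bop_eq_bas, rule coord_eqI)
    fix j i
    have "cin (z i) (ap B (x j)) = (if i = j then 1 else 0)"
      using orth(2)[of i j] B0[of i]
      by (auto simp: z_def y_def cin_scale_left c_def cin_norm power2_eq_square)
    thus "coord (ap (H * B * adj G) (bas j)) i = coord (ap 1 (bas j)) i"
      by (simp add: G H)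
  qed
  thus thesis by (rule that)
qed

lemma pr_tail_sum: "(\<lambda>n. \<Sum>l<m. norm (ap (pr {n..}) (g l))) \<longlonglongrightarrow> 0"
proof -
  have "(\<lambda>n. \<Sum>l<m. norm (ap (pr {n..}) (g l))) \<longlonglongrightarrow> (\<Sum>l<m. norm (0::ell2))"
    by (intro tendsto_intros pr_atLeast_tendsto)
  thus ?thesis by simp
qed

lemma norm_pr_finite_rank:
  assumes "ons g" and F: "\<And>x. ap F x = (\<Sum>l<m. cin (g l) (ap F x) *\<^sub>C g l)"
  shows "norm (pr A * F) \<le> (\<Sum>l<m. norm (ap (pr A) (g l))) * norm F"
proof (rule norm_bop_le)
  fix x
  have "norm (ap (pr A) (ap F x)) = norm (\<Sum>l<m. cin (g l) (ap F x) *\<^sub>C ap (pr A) (g l))"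
    by (subst F) (simp add: ap_sum ap_scale)
  also have "\<dots> \<le> (\<Sum>l<m. norm (cin (g l) (ap F x) *\<^sub>C ap (pr A) (g l)))" by (rule norm_sum)
  also have "\<dots> \<le> (\<Sum>l<m. norm (ap (pr A) (g l)) * (norm F * norm x))"
  proof (rule sum_mono)
    fix l
    have "cmod (cin (g l) (ap F x)) \<le> norm (g l) * norm (ap F x)" by (rule cin_cauchy_schwarz)
    also have "\<dots> \<le> 1 * (norm F * norm x)" by (intro mult_mono norm_ap ons_norm assms) auto
    finally have "cmod (cin (g l) (ap F x)) * norm (ap (pr A) (g l)) \<le> norm F * norm x * norm (ap (pr A) (g l))"
      by (intro mult_right_mono) auto
    thus "norm (cin (g l) (ap F x) *\<^sub>C ap (pr A) (g l)) \<le> norm (ap (pr A) (g l)) * (norm F * norm x)"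
      by (simp add: mult.commute)
  qed
  finally show "norm (ap (pr A * F) x) \<le> (\<Sum>l<m. norm (ap (pr A) (g l))) * norm F * norm x"
    by (simp add: sum_distrib_right mult.assoc)
qed (simp add: sum_nonneg)

text \<open>If the tails of \<open>X\<close> did not vanish, one could choose greedily an infinite sequence of orthogonal
  vectors with orthogonal images, and the identity would factor through \<open>X\<close>.\<close>

lemma (in bop_ideal) tail_small:
  assumes X: "X \<in> I" and e: "\<epsilon> > 0"
  obtains N where "\<And>M. M \<ge> N \<Longrightarrow> norm (pr {M..} * X) \<le> \<epsilon>"
proof -
  \<comment> \<open>Cutting off on the left of \<open>X\<close> becomes restricting the argument of
    \<open>adj X\<close>, where orthogonality conditions can be imposed.\<close>
  define B where "B = adj X"
  define P where "P f k x \<longleftrightarrow> norm x = 1 \<and> norm (ap B x) \<ge> \<epsilon> / 2 \<and>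
      (\<forall>j<k. cin (f j) x = 0 \<and> cin (ap B (f j)) (ap B x) = 0)" for f :: "nat \<Rightarrow> ell2" and k :: nat and x
  have "\<exists>f k. \<forall>x. \<not> P f k x"
  proof (rule ccontr)
    assume "\<not> ?thesis"
    hence ex: "\<exists>x. P f k x" for f k by blast
    have "\<exists>x. \<forall>k. P x k (x k)"
    proof (rule dependent_wf_choice[OF wf_less])
      show "P f k x = P g k x" if "\<And>z. (z, k) \<in> {(x, y). x < y} \<Longrightarrow> f z = g z" for f g k x
        using that unfolding P_def by auto
    qed (rule ex)
    then obtain x where x: "\<And>k. P x k (x k)" by blast
    have lt: "cin (x j) (x k) = 0 \<and> cin (ap B (x j)) (ap B (x k)) = 0" if "j < k" for j k
      using x[of k] that unfolding P_def by blast
    hence ne: "cin (x j) (x k) = 0 \<and> cin (ap B (x j)) (ap B (x k)) = 0" if "j \<noteq> k" for j k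
      using that by (metis cin_commute complex_cnj_zero linorder_neqE_nat)
    obtain C D where "C * B * D = 1"
      by (rule one_factors_through[of x B "\<epsilon> / 2"]) (use ne x e in \<open>auto simp: P_def\<close>)
    hence "adj (C * B * D) = 1" by simp
    hence "adj D * X * adj C = 1" by (simp add: B_def mult.assoc)
    thus False using proper mult_left_mem mult_right_mem X by metis
  qed
  then obtain f k where nP: "\<And>x. \<not> P f k x" by blast
  \<comment> \<open>The greedy choice is stuck after \<open>k\<close> vectors. Moving
    \<open>B\<close> to the other side, its requirements become orthogonality to these finitely many
    vectors, so \<open>B\<close> is small on the orthogonal complement of \<open>V\<close>.\<close>
  define V where "V = f ` {..<k} \<union> (\<lambda>j. ap (adj B) (ap B (f j))) ` {..<k}"
  have V: "norm (ap B x) \<le> \<epsilon> / 2 * norm x" if "\<And>v. v \<in> V \<Longrightarrow> cin v x = 0" for x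
  proof (cases "x = 0")
    case False
    define u where "u = inverse (norm x) *\<^sub>R x"
    have "cin v u = 0" if "v \<in> V" for v
      using \<open>\<And>v. v \<in> V \<Longrightarrow> cin v x = 0\<close>[OF that] by (simp add: u_def scaleR_cscale cin_scale_right)
    hence "\<forall>j<k. cin (f j) u = 0 \<and> cin (ap B (f j)) (ap B u) = 0"
      unfolding V_def by (auto simp: adj_right)
    moreover have "norm u = 1" using False by (simp add: u_def)
    ultimately have "norm (ap B u) < \<epsilon> / 2" using nP[of u] unfolding P_def by force
    thus ?thesis using False by (simp add: u_def ap_lin field_simps)
  qed (simp add: ap_lin)
  have "finite V" by (simp add: V_def)
  obtain g where g: "ons g" "\<And>v. v \<in> V \<Longrightarrow> v = (\<Sum>l<card V. cin (g l) v *\<^sub>C g l)"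
    by (rule gram_schmidt_finite[OF \<open>finite V\<close>], rule that)
  define Q where "Q = oproj g (card V)"
  have gQ: "cin (g j) (ap Q x) = cin (g j) x" if "j < card V" for j x
    unfolding Q_def using g(1) that by (rule cin_oproj)
  have nQ: "norm (x - ap Q x) \<le> norm x" for x
    unfolding Q_def by (rule norm_sub_oproj[OF g(1)])
  have "norm (B * (1 - Q)) \<le> \<epsilon> / 2"
  proof (rule norm_bop_le)
    fix x
    have "cin v (x - ap Q x) = 0" if "v \<in> V" for v
    proof -
      have "cin v (x - ap Q x) = cin (\<Sum>l<card V. cin (g l) v *\<^sub>C g l) (x - ap Q x)"
        using g(2)[OF that] by (rule arg_cong)
      thus ?thesis by (simp add: cin_simps gQ)
    qed
    hence "norm (ap B (x - ap Q x)) \<le> \<epsilon> / 2 * norm (x - ap Q x)" by (rule V)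
    also have "\<dots> \<le> \<epsilon> / 2 * norm x" using nQ e by (intro mult_left_mono) auto
    finally show "norm (ap (B * (1 - Q)) x) \<le> \<epsilon> / 2 * norm x" by simp
  qed (use e in simp)
  hence "norm (adj (B * (1 - Q))) \<le> \<epsilon> / 2" by (simp only: norm_adj)
  moreover have "adj Q = Q" unfolding Q_def by (rule adj_oproj)
  ultimately have 1: "norm ((1 - Q) * X) \<le> \<epsilon> / 2" by (simp add: B_def algebra_simps)
  have QX: "ap (Q * X) x = (\<Sum>l<card V. cin (g l) (ap (Q * X) x) *\<^sub>C g l)" for x
    using oproj_idem[OF g(1), of "card V" "ap X x"] by (simp add: Q_def flip: ap_oproj)
  have "(\<lambda>n. (\<Sum>l<card V. norm (ap (pr {n..}) (g l))) * norm (Q * X)) \<longlonglongrightarrow> 0 * norm (Q * X)"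
    by (intro tendsto_intros pr_tail_sum)
  hence "\<forall>\<^sub>F n in sequentially. (\<Sum>l<card V. norm (ap (pr {n..}) (g l))) * norm (Q * X) < \<epsilon> / 2"
    using e by (intro order_tendstoD) auto
  then obtain N where N: "\<And>n. n \<ge> N \<Longrightarrow> (\<Sum>l<card V. norm (ap (pr {n..}) (g l))) * norm (Q * X) < \<epsilon> / 2"
    unfolding eventually_sequentially by blast
  show thesis
  proof (rule that)
    fix M assume "M \<ge> N"
    have "norm (pr {M..} * X) \<le> norm (pr {M..} * (Q * X)) + norm (pr {M..} * ((1 - Q) * X))"
      by (rule order_trans[OF _ norm_triangle_ineq]) (simp add: algebra_simps)
    also have "norm (pr {M..} * (Q * X)) \<le> \<epsilon> / 2"
      using norm_pr_finite_rank[OF g(1) QX, of "{M..}"] N[OF \<open>M \<ge> N\<close>] by linarith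
    also have "norm (pr {M..} * ((1 - Q) * X)) \<le> 1 * (\<epsilon> / 2)"
      by (rule order_trans[OF norm_mult_ineq]) (intro mult_mono norm_pr_le 1, auto)
    finally show "norm (pr {M..} * X) \<le> \<epsilon>" by simp
  qed
qed

subsection \<open>Diagonalizable operators\<close>

locale spectral_family =
  fixes A :: bop and lam :: "nat \<Rightarrow> complex" and P :: "nat \<Rightarrow> bop"
  assumes inj_lam: "inj lam"
    and eigenvalue: "x \<noteq> 0 \<Longrightarrow> ap A x = c *\<^sub>C x \<Longrightarrow> c \<in> range lam"
    and adj_P: "adj (P n) = P n"
    and P_idem: "P n * P n = P n"
    and P_range: "ap (P n) x = x \<longleftrightarrow> ap A x = lam n *\<^sub>C x"

text \<open>Equal ranges give \<open>E * F = F\<close> and \<open>F * E = E\<close>, which are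
  adjoint to each other.\<close>

lemma proj_eqI:
  assumes "adj E = E" "adj F = F" "E * E = E" "F * F = F" "\<And>x. ap E x = x \<longleftrightarrow> ap F x = x"
  shows "E = F"
proof -
  have 1: "E * F = F"
    by (rule bop_eqI) (metis ap_simps(6) assms(4,5))
  have 2: "F * E = E"
    by (rule bop_eqI) (metis ap_simps(6) assms(3,5))
  have "F = adj (E * F)" by (simp only: 1 assms)
  also have "\<dots> = E" by (simp only: adj_simps assms 2)
  finally show ?thesis ..
qed

lemma diagonal_coord:
  assumes "\<And>i. ap D (bas i) = d i *\<^sub>C bas i"
  shows "coord (ap D x) i = d i * coord x i"
proof -
  have 1: "ap (adj D) (bas i) = cnj (d i) *\<^sub>C bas i"
  proof (rule coord_eqI)
    fix j
    have "coord (ap (adj D) (bas i)) j = cin (ap D (bas j)) (bas i)"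
      by (simp only: cin_bas[symmetric] adj_left)
    thus "coord (ap (adj D) (bas i)) j = coord (cnj (d i) *\<^sub>C bas i) j"
      by (auto simp: assms cin_scale_left)
  qed
  have "coord (ap D x) i = cin (ap (adj D) (bas i)) x"
    by (simp only: cin_bas[symmetric] adj_right)
  thus ?thesis by (simp add: 1 cin_scale_left)
qed

lemma coord_eq_iff: "x = y \<longleftrightarrow> (\<forall>i. coord x i = coord y i)"
  using coord_eqI by auto

text \<open>The first \<open>n\<close> coordinates carry finitely many labels. Once \<open>K\<close>
  exceeds them, the error is a coordinate projection of the truncation error.\<close>

lemma pr_label_tendsto: "(\<lambda>K. ap (pr {i. lb i < K}) x) \<longlonglongrightarrow> x" for lb :: "nat \<Rightarrow> nat"
proof (rule LIMSEQ_I)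
  fix r :: real assume "r > 0"
  then obtain n where n: "norm (trunc n x - x) < r"
    using LIMSEQ_D[OF trunc_tendsto[of x]] by blast
  have "norm (ap (pr {i. lb i < K}) x - x) < r" if K: "K \<ge> Suc (Max (lb ` {..<n}))" for K
  proof -
    have lt: "lb i < K" if "i < n" for i
    proof -
      have "lb i \<le> Max (lb ` {..<n})" using that by (intro Max_ge) auto
      thus ?thesis using K by linarith
    qed
    have "ap (pr {i. lb i < K}) x - x = ap (pr (- {i. lb i < K})) (trunc n x - x)"
      by (rule coord_eqI) (use lt in \<open>auto simp: coord_trunc\<close>)
    thus ?thesis using norm_pr_ap n by (metis le_less_trans)
  qed
  thus "\<exists>K0. \<forall>K\<ge>K0. norm (ap (pr {i. lb i < K}) x - x) < r" by blast
qed

context spectral_family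
begin

text \<open>Each diagonal entry of the diagonalised operator is an eigenvalue, hence
  \<open>lam n\<close> for some \<open>n\<close>, unique by injectivity; \<open>lb\<close> records
  this index. In the coordinates given by \<open>W\<close> all spectral projections are then
  coordinate projections.\<close>

lemma P_conj:
  assumes W: "adj W * W = 1" "W * adj W = 1"
    and D: "\<And>i. \<exists>c. ap (W * A * adj W) (bas i) = c *\<^sub>C bas i"
  obtains lb where "\<And>n. P n = adj W * pr {i. lb i = n} * W"
proof -
  obtain d where d: "\<And>i. ap (W * A * adj W) (bas i) = d i *\<^sub>C bas i" using D by metis
  have WW: "ap (adj W) (ap W x) = x" "ap W (ap (adj W) x) = x" for x
    by (simp_all only: ap_simps(6)[symmetric] W ap_simps(2))
  have "d i \<in> range lam" for i
  proof (rule eigenvalue)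
    show "ap (adj W) (bas i) \<noteq> 0"
    proof
      assume "ap (adj W) (bas i) = 0"
      hence "bas i = 0" using WW(2)[of "bas i"] by (simp add: ap_lin)
      thus False using norm_bas[of i] by simp
    qed
    have "ap (adj W) (ap (W * A * adj W) (bas i)) = ap (adj W) (d i *\<^sub>C bas i)" by (simp only: d)
    thus "ap A (ap (adj W) (bas i)) = d i *\<^sub>C ap (adj W) (bas i)" by (simp add: WW ap_scale)
  qed
  hence "\<forall>i. \<exists>n. d i = lam n" by blast
  then obtain lb where lb: "\<And>i. d i = lam (lb i)" using choice[of "\<lambda>i n. d i = lam n"] by blast
  have dl: "d i = lam n \<longleftrightarrow> lb i = n" for i n using inj_lam by (auto simp: lb inj_eq)
  have "P n = adj W * pr {i. lb i = n} * W" for n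
  proof (rule proj_eqI)
    let ?p = "pr {i. lb i = n}"
    have "adj W * ?p * W * (adj W * ?p * W) = adj W * ?p * (W * adj W) * ?p * W"
      by (simp only: mult.assoc)
    also have "\<dots> = adj W * (?p * ?p) * W" by (simp only: W mult_1_right mult.assoc)
    finally show "adj W * ?p * W * (adj W * ?p * W) = adj W * ?p * W" by simp
    fix x
    define y where "y = ap W x"
    have x: "x = ap (adj W) y" by (simp add: y_def WW)
    have "ap A x = lam n *\<^sub>C x \<longleftrightarrow> ap W (ap A x) = ap W (lam n *\<^sub>C x)" by (metis WW(1))
    also have "\<dots> \<longleftrightarrow> ap (W * A * adj W) y = lam n *\<^sub>C y" by (simp add: x WW ap_scale)
    also have "\<dots> \<longleftrightarrow> (\<forall>i. d i * coord y i = lam n * coord y i)"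
      by (simp add: coord_eq_iff diagonal_coord[OF d] del: ap_simps(6))
    also have "\<dots> \<longleftrightarrow> (\<forall>i. (if lb i = n then coord y i else 0) = coord y i)"
      using dl by (auto split: if_splits)
    also have "\<dots> \<longleftrightarrow> ap ?p y = y"
      by (simp add: coord_eq_iff)
    also have "\<dots> \<longleftrightarrow> ap (adj W) (ap ?p y) = ap (adj W) y"
      by (metis WW(2))
    also have "\<dots> \<longleftrightarrow> ap (adj W * ?p * W) x = x"
      by (simp add: x WW)
    finally show "ap (P n) x = x \<longleftrightarrow> ap (adj W * ?p * W) x = x" by (simp add: P_range)
  qed (simp_all add: adj_P P_idem mult.assoc)
  thus thesis by (rule that)
qed

end

text \<open>The vectors \<open>ap (adj W) (bas i)\<close> are an eigenbasis labelled by
  \<open>lb\<close>. Sufficiency uses it with an arbitrary diagonalising unitary, necessity with one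
  that differs from the identity by an element of the ideal.\<close>

locale diagonalized_family = spectral_family +
  fixes W :: bop and lb :: "nat \<Rightarrow> nat"
  assumes W: "adj W * W = 1" "W * adj W = 1"
    and P_eq: "\<And>n. P n = adj W * pr {i. lb i = n} * W"
begin

lemma W_cancel: "ap (adj W) (ap W x) = x" "ap W (ap (adj W) x) = x"
  by (simp_all only: ap_simps(6)[symmetric] W ap_simps(2))

lemma P_bas: "ap (P n) (ap (adj W) (bas i)) = (if lb i = n then ap (adj W) (bas i) else 0)"
  by (simp add: P_eq W_cancel ap_lin)

lemma bop_eq_eigenbasis:
  assumes "\<And>i. ap M (ap (adj W) (bas i)) = ap N (ap (adj W) (bas i))"
  shows "M = N"
proof -
  have "M * adj W = N * adj W" by (rule bop_eq_bas) (simp add: assms)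
  hence "M * adj W * W = N * adj W * W" by simp
  thus ?thesis by (simp add: mult.assoc W)
qed

lemma P_orth: "n \<noteq> k \<Longrightarrow> P n * P k = 0"
  by (rule bop_eq_eigenbasis) (simp add: P_bas ap_lin)

lemma P_total:
  assumes "\<And>n. ap (P n) x = 0"
  shows "x = 0"
proof -
  have "coord (ap W x) i = 0" for i
  proof -
    have "coord (ap W x) i = cin (ap (adj W) (bas i)) x" by (simp add: adj_right[symmetric])
    also have "\<dots> = cin (ap (P (lb i)) (ap (adj W) (bas i))) x" by (simp add: P_bas)
    also have "\<dots> = 0" by (simp add: adj_left adj_P assms)
    finally show ?thesis .
  qed
  hence "ap W x = 0" by (intro coord_eqI) simp
  thus ?thesis by (metis W_cancel(1) ap_lin(4))
qed

lemma P_partial_sum: "(\<Sum>n<K. P n) = adj W * pr {i. lb i < K} * W"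
  by (rule bop_eq_eigenbasis) (auto simp: ap_sum_left P_bas W_cancel ap_lin)

lemma P_sums: "(\<lambda>K. \<Sum>n<K. ap (P n) x) \<longlonglongrightarrow> x"
proof -
  have "(\<lambda>K. ap (adj W) (ap (pr {i. lb i < K}) (ap W x))) \<longlonglongrightarrow> ap (adj W) (ap W x)"
    by (intro tendsto_ap pr_label_tendsto)
  moreover have "(\<Sum>n<K. ap (P n) x) = ap (adj W) (ap (pr {i. lb i < K}) (ap W x))" for K
    using arg_cong[OF P_partial_sum[of K], of "\<lambda>M. ap M x"] by (simp add: ap_sum_left)
  ultimately show ?thesis by (simp add: W_cancel)
qed

end

section \<open>Sufficiency: construction of the unitary near the identity\<close>

subsection \<open>Polar decomposition of a compression\<close>

text \<open>\<open>F n\<close> is the set of coordinates with label \<open>n\<close>; labels need to be unique only from \<open>N\<close> on.\<close>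

locale compression = bop_ideal I + diagonalized_family A lam P W lb
  for I A lam P W lb +
  fixes S :: bop and N :: nat and F :: "nat \<Rightarrow> nat set"
  assumes S_mem: "S \<in> I"
    and S_P: "\<And>n. S * P n = (1 - pr (F n)) * P n"
    and F_disj: "\<And>n k. n \<noteq> k \<Longrightarrow> {N..} \<inter> F n \<inter> F k = {}"
    and F_cover: "\<And>i. i \<ge> N \<Longrightarrow> \<exists>n. i \<in> F n"
    and S_small: "norm (pr {N..} * S) \<le> 1 / 4"
begin

abbreviation "Q \<equiv> pr {N..}"
abbreviation "D n \<equiv> pr ({N..} \<inter> F n)"

definition "X = 1 - S"
text \<open>The defect of \<open>Q * X\<close> from being a partial isometry with final projection
  \<open>Q\<close>; see \<open>L_eq\<close>.\<close>

definition "L = Q * (S + adj S - S * adj S) * Q"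

lemma X_P: "X * P n = pr (F n) * P n"
  unfolding X_def by (simp add: left_diff_distrib S_P)

text \<open>On an eigenvector with label \<open>k\<close>, \<open>X\<close> acts as
  \<open>pr (F k)\<close>, and beyond \<open>N\<close> the sets \<open>F n\<close> and
  \<open>F k\<close> are disjoint unless \<open>n = k\<close>.\<close>

lemma D_X: "D n * X = D n * P n"
proof (rule bop_eq_eigenbasis)
  fix i
  let ?w = "ap (adj W) (bas i)" and ?k = "lb i"
  have w: "ap (P ?k) ?w = ?w" by (simp add: P_bas)
  have "ap X ?w = ap (X * P ?k) ?w" by (simp add: w)
  also have "\<dots> = ap (pr (F ?k)) ?w" unfolding X_P by (simp add: w)
  finally have "ap (D n * X) ?w = ap (D n * pr (F ?k)) ?w" by (simp only: ap_simps(6))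
  also have "\<dots> = ap (D n * P n) ?w"
  proof (cases "?k = n")
    case True
    have "{N..} \<inter> F n \<inter> F n = {N..} \<inter> F n" by blast
    thus ?thesis using True w by (simp only: pr_mult) simp
  next
    case False
    have "{N..} \<inter> F n \<inter> F ?k = {}" using F_disj[of n ?k] False by auto
    thus ?thesis using False by (simp only: pr_mult) (simp add: P_bas ap_lin)
  qed
  finally show "ap (D n * X) ?w = ap (D n * P n) ?w" .
qed

lemma Q_X_P: "Q * X * P n = D n * X"
  by (simp only: mult.assoc X_P D_X) (simp flip: mult.assoc)

lemma L_eq: "Q * X * adj X * Q = Q - L"
  unfolding L_def X_def by (simp add: algebra_simps flip: mult.assoc)

lemma adj_L: "adj L = L"
  by (simp add: L_def algebra_simps)

text \<open>The three terms contribute 1/4, 1/4 and 1/16. The value 3/4 leaves room and has the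
  rational solution \<open>b = 1/2\<close> of \<open>c + b^2 = 2 * b\<close> in
  \<open>sqrt_one_minus\<close>.\<close>

lemma norm_L: "norm L \<le> 3 / 4"
proof -
  let ?B = "Q * S"
  have L: "L = ?B * Q + Q * adj ?B - ?B * adj ?B"
    by (simp add: L_def algebra_simps)
  have "norm (?B * Q) \<le> 1/4 * 1"
    by (rule order_trans[OF norm_mult_ineq]) (intro mult_mono S_small norm_pr_le, auto)
  moreover have "norm (Q * adj ?B) \<le> 1 * (1/4)"
    by (rule order_trans[OF norm_mult_ineq]) (intro mult_mono norm_pr_le, use S_small in \<open>simp_all del: adj_simps\<close>)
  moreover have "norm (?B * adj ?B) \<le> 1/4 * (1/4)"
    by (rule order_trans[OF norm_mult_ineq]) (intro mult_mono S_small, use S_small in \<open>simp_all del: adj_simps\<close>)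
  moreover have "norm L \<le> norm (?B * Q) + norm (Q * adj ?B) + norm (?B * adj ?B)"
    unfolding L by (meson norm_triangle_ineq4 norm_triangle_ineq order_trans add_right_mono)
  ultimately show ?thesis by linarith
qed

lemma Q_L: "Q * L = L" "L * Q = L"
  by (simp_all add: L_def flip: mult.assoc) (simp add: mult.assoc)

text \<open>\<open>Q * X\<close> intertwines \<open>P n\<close> with \<open>D n\<close>, so its
  product with its adjoint commutes with \<open>D n\<close>. The square root inherits this, and the
  polar part therefore still intertwines.\<close>

lemma D_L: "D n * L = L * D n"
proof -
  have DQ: "D n * Q = D n" "Q * D n = D n" by (simp_all add: Int_ac)
  have a: "P n * adj X * Q = adj X * D n"
    using arg_cong[OF Q_X_P[of n], of adj] by (simp add: adj_P mult.assoc)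
  have "D n * (Q * X * adj X * Q) = D n * X * adj X * Q"
    by (simp only: mult.assoc[symmetric] DQ)
  also have "\<dots> = Q * X * (P n * adj X * Q)" by (simp only: Q_X_P[symmetric] mult.assoc)
  also have "\<dots> = (Q * X * adj X * Q) * D n" by (simp only: a[unfolded mult.assoc] mult.assoc DQ)
  finally show ?thesis unfolding L_eq by (simp only: left_diff_distrib right_diff_distrib DQ) simp
qed

lemma L_mem: "L \<in> I"
  unfolding L_def
  by (intro mult_left_mem mult_right_mem diff_mem add_mem adj_mem S_mem)

text \<open>\<open>V\<close> is the partial isometry in the polar decomposition of \<open>Q * X\<close>.\<close>

lemma partial_isometry:
  obtains V where "V * adj V = Q" "Q * V = V" "\<And>n. V * P n = D n * V" "V - 1 \<in> I"
    "\<And>x. ap V x = 0 \<longleftrightarrow> ap (Q * X) x = 0"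
proof -
  obtain K where K: "norm K \<le> 1/2" "adj K = K" "(1 - K) * (1 - K) = 1 - L"
      "\<And>Z. Z * L = L * Z \<Longrightarrow> Z * K = K * Z"
    by (rule sqrt_one_minus[of L "3/4" "1/2"]) (use norm_L adj_L in \<open>auto simp: power2_eq_square\<close>)
  have "norm K < 1" using K(1) by simp
  then obtain M where M: "(1 - K) * M = 1" "M * (1 - K) = 1" using neumann[of K] by blast
  have M_comm: "Z * M = M * Z" if "Z * L = L * Z" for Z
    by (rule inverse_commute[OF M]) (simp add: algebra_simps K(4)[OF that])
  have QM: "Q * M = M * Q" by (rule M_comm) (simp add: Q_L)
  have DM: "D n * M = M * D n" for n by (rule M_comm) (rule D_L)
  have "adj M * (1 - K) = 1" using arg_cong[OF M(1), of adj] by (simp add: K(2))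
  hence adjM: "adj M = M" using M(1) by (metis mult.assoc mult_1_left mult_1_right)
  \<comment> \<open>\<open>K\<close> is a limit of polynomials in \<open>L\<close>, which need not
    stay in the ideal. Instead \<open>L = 2 (1 - K/2) K\<close> with \<open>1 - K/2\<close>
    invertible exhibits \<open>K\<close> as a multiple of \<open>L\<close>.\<close>
  have "K \<in> I"
  proof -
    have "norm ((1/2) *\<^sub>R K) < 1" using K(1) by simp
    then obtain Z where Z: "Z * (1 - (1/2) *\<^sub>R K) = 1" using neumann by blast
    have "L = 2 *\<^sub>R K - K * K" using K(3) by (simp add: algebra_simps scaleR_2)
    also have "\<dots> = 2 *\<^sub>R ((1 - (1/2) *\<^sub>R K) * K)" by (simp add: algebra_simps)
    finally have "Z * L = 2 *\<^sub>R (Z * (1 - (1/2) *\<^sub>R K) * K)" by (simp add: mult.assoc)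
    hence "K = ((1/2) *\<^sub>R Z) * L" by (simp add: Z)
    thus ?thesis using mult_left_mem[OF L_mem] by metis
  qed
  \<comment> \<open>\<open>M\<close> is the inverse square root of \<open>1 - L\<close>, so this
    normalises \<open>Q * X\<close> from the left.\<close>
  define V where "V = M * Q * X"
  show thesis
  proof (rule that[of V])
    have "V * adj V = M * (Q * X * adj X * Q) * M" by (simp add: V_def adjM mult.assoc)
    also have "\<dots> = M * (Q * (1 - L)) * M" unfolding L_eq by (simp add: algebra_simps Q_L)
    also have "\<dots> = (M * Q) * ((1 - K) * (1 - K)) * M" by (simp add: K(3) mult.assoc)
    also have "\<dots> = Q * (M * (1 - K)) * ((1 - K) * M)" by (simp only: QM[symmetric] mult.assoc)
    finally show "V * adj V = Q" by (simp add: M)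
    have "Q * V = (Q * M) * Q * X" by (simp only: V_def mult.assoc)
    also have "\<dots> = M * (Q * Q) * X" by (simp only: QM mult.assoc)
    finally show "Q * V = V" by (simp add: V_def)
    show "V * P n = D n * V" for n
    proof -
      have "V * P n = M * (D n * X)" by (simp only: V_def mult.assoc Q_X_P[unfolded mult.assoc])
      also have "D n * X = D n * Q * X" by (simp add: Int_ac)
      also have "M * (D n * Q * X) = (M * D n) * Q * X" by (simp only: mult.assoc)
      also have "\<dots> = D n * V" by (simp only: DM[symmetric] V_def mult.assoc)
      finally show ?thesis .
    qed
    have "1 - Q \<in> I" by (simp add: pr_compl pr_finite_mem)
    have "V - 1 = M * K * (Q * X) + (- (1 - Q) - Q * S)"
    proof -
      have "1 + M * K = M" using M(2) by (simp add: algebra_simps)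
      hence "V = (1 + M * K) * (Q * X)" by (simp add: V_def mult.assoc)
      hence "V = Q * X + M * K * (Q * X)" by (simp only: distrib_right mult_1_left)
      moreover have "Q * X = Q - Q * S" by (simp add: X_def algebra_simps)
      ultimately show ?thesis by simp
    qed
    also have "\<dots> \<in> I"
      by (intro add_mem diff_mem uminus_mem mult_left_mem mult_right_mem \<open>K \<in> I\<close> \<open>1 - Q \<in> I\<close> S_mem)
    finally show "V - 1 \<in> I" .
    show "ap V x = 0 \<longleftrightarrow> ap (Q * X) x = 0" for x
    proof -
      have "ap (1 - K) (ap V x) = ap ((1 - K) * M) (ap (Q * X) x)" by (simp add: V_def del: ap_simps(5))
      hence "ap (1 - K) (ap V x) = ap (Q * X) x" by (simp add: M)
      moreover have "ap V x = ap M (ap (Q * X) x)" by (simp add: V_def)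
      ultimately show ?thesis by (metis ap_lin(4))
    qed
  qed
qed

end

subsection \<open>Completing the partial isometry\<close>

text \<open>The remainder of \<open>ap F x\<close> after subtracting its expansion lies in the range
  of \<open>F\<close> and is orthogonal to the system, so maximality kills it.\<close>

lemma ons_expand:
  assumes f: "ons f" and z: "\<And>j. j \<ge> m \<Longrightarrow> f j = 0"
    and F: "\<And>x y. cin (ap F x) y = cin x (ap F y)" "\<And>j. ap F (f j) = f j" "\<And>x. ap F (ap F x) = ap F x"
    and max: "\<And>g. ap F g = g \<Longrightarrow> (\<And>j. j < m \<Longrightarrow> cin (f j) g = 0) \<Longrightarrow> g = 0"
  shows "ap F x = (\<Sum>j<m. cin (f j) x *\<^sub>C f j)"
proof -
  define g where "g = ap F x - (\<Sum>j<m. cin (f j) x *\<^sub>C f j)"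
  have "g = 0"
  proof (rule max)
    show "ap F g = g" by (simp add: g_def ap_lin ap_sum ap_scale F)
    show "cin (f j) g = 0" if "j < m" for j
    proof -
      have "cin (f j) (ap F x) = cin (f j) x" by (metis F(1,2))
      moreover have "(\<Sum>l<m. cin (f l) x * cin (f j) (f l)) = cin (f j) x"
        using ons_sum[OF f, of "{..<m}" j "\<lambda>l. cin (f l) x"] ons_self_mult[OF f, of j x] that
        by (simp add: mult.commute)
      ultimately show ?thesis by (simp add: g_def cin_simps)
    qed
  qed
  thus ?thesis by (simp add: g_def)
qed

context diagonalized_family
begin

text \<open>Computing the trace of \<open>F\<close> in two ways shows that a maximal orthonormal system of eigenvectors
  in its range has exactly \<open>N\<close> elements.\<close>

lemma eigenvectors_in_range:
  assumes F: "adj F = F" "F * F = F" "\<And>n. P n * F = F * P n"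
    and Z: "Z * Zi = 1" "Zi * Z = 1"
    and FZ: "\<And>x. ap F x = x \<longleftrightarrow> ap (pr {..<N}) (ap Z x) = ap Z x"
  obtains f where "ons f" "\<And>j. j < N \<Longrightarrow> norm (f j) = 1" "\<And>j. j < N \<Longrightarrow> \<exists>n. ap (P n) (f j) = f j"
    "\<And>j. ap F (f j) = f j" "\<And>x. ap F x = (\<Sum>j<N. cin (f j) x *\<^sub>C f j)"
proof -
  have Fx: "cin (ap F x) y = cin x (ap F y)" "ap F (ap F x) = ap F x" "ap (P n) (ap F x) = ap F (ap (P n) x)" for x y n
    by (simp_all only: adj_left F ap_simps(6)[symmetric])
  have ZZ: "ap Z (ap Zi x) = x" "ap Zi (ap Z x) = x" for x
    by (simp_all only: ap_simps(6)[symmetric] Z ap_simps(2))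
  define Fam where "Fam m f \<longleftrightarrow> ons f \<and> (\<forall>j<m. norm (f j) = 1) \<and> (\<forall>j\<ge>m. f j = 0) \<and>
      (\<forall>j<m. ap F (f j) = f j \<and> (\<exists>n. ap (P n) (f j) = f j))" for m :: nat and f
  \<comment> \<open>For an admissible family, \<open>ap Z (f j)\<close> lives on the first
    \<open>N\<close> coordinates. The double sum is the trace of \<open>Zi * Z\<close> over the span
    of the family, factored through these coordinates.\<close>
  have count: "of_nat m = (\<Sum>j<m. \<Sum>i<N. cin (f j) (ap Zi (bas i)) * cin (bas i) (ap Z (f j)))"
    if "Fam m f" for m f
  proof -
    have "of_nat m = (\<Sum>j<m. cin (f j) (f j))"
      using that by (simp add: Fam_def cin_norm)
    also have "\<dots> = (\<Sum>j<m. \<Sum>i<N. cin (f j) (ap Zi (bas i)) * cin (bas i) (ap Z (f j)))"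
    proof (rule sum.cong)
      fix j assume "j \<in> {..<m}"
      hence "ap (pr {..<N}) (ap Z (f j)) = ap Z (f j)" using that FZ[of "f j"] by (auto simp: Fam_def)
      hence "ap Z (f j) = (\<Sum>i<N. cin (bas i) (ap Z (f j)) *\<^sub>C bas i)"
        by (simp add: pr_finite ap_sum_left)
      hence "ap Zi (ap Z (f j)) = ap Zi (\<Sum>i<N. cin (bas i) (ap Z (f j)) *\<^sub>C bas i)" by (rule arg_cong)
      hence "f j = (\<Sum>i<N. cin (bas i) (ap Z (f j)) *\<^sub>C ap Zi (bas i))"
        unfolding ZZ by (simp add: ap_sum ap_scale)
      hence "cin (f j) (f j) = cin (f j) (\<Sum>i<N. cin (bas i) (ap Z (f j)) *\<^sub>C ap Zi (bas i))"
        by (rule arg_cong)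
      thus "cin (f j) (f j) = (\<Sum>i<N. cin (f j) (ap Zi (bas i)) * cin (bas i) (ap Z (f j)))"
        by (simp add: cin_sum_right cin_scale_right mult.commute)
    qed simp
    finally show ?thesis .
  qed
  \<comment> \<open>By Bessel the double sum is at most \<open>C\<close> whatever \<open>m\<close>
    is; hence admissible families have bounded length and a longest one exists.\<close>
  define C where "C = (\<Sum>i<N. (norm (ap Zi (bas i)))\<^sup>2 + (norm (ap (adj Z) (bas i)))\<^sup>2)"
  have bound: "real m \<le> C" if f: "Fam m f" for m f
  proof -
    have o: "ons f" using f by (simp add: Fam_def)
    have "real m = cmod (of_nat m)" by simp
    also have "\<dots> \<le> (\<Sum>j<m. \<Sum>i<N. cmod (cin (f j) (ap Zi (bas i)) * cin (bas i) (ap Z (f j))))"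
      unfolding count[OF f] by (intro order_trans[OF norm_sum] sum_mono norm_sum)
    also have "\<dots> \<le> (\<Sum>j<m. \<Sum>i<N. (cmod (cin (f j) (ap Zi (bas i))))\<^sup>2 + (cmod (cin (f j) (ap (adj Z) (bas i))))\<^sup>2)"
    proof (intro sum_mono)
      fix j i
      have "cmod (cin (bas i) (ap Z (f j))) = cmod (cin (f j) (ap (adj Z) (bas i)))"
        by (metis adj_right cin_commute complex_mod_cnj)
      moreover have "a * b \<le> a\<^sup>2 + b\<^sup>2" if "0 \<le> a" "0 \<le> b" for a b :: real
        using sum_squares_bound[of a b] mult_nonneg_nonneg[OF that] by linarith
      ultimately show "cmod (cin (f j) (ap Zi (bas i)) * cin (bas i) (ap Z (f j)))
          \<le> (cmod (cin (f j) (ap Zi (bas i))))\<^sup>2 + (cmod (cin (f j) (ap (adj Z) (bas i))))\<^sup>2"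
        by (simp only: norm_mult norm_ge_zero)
    qed
    also have "\<dots> = (\<Sum>i<N. (\<Sum>j<m. (cmod (cin (f j) (ap Zi (bas i))))\<^sup>2) + (\<Sum>j<m. (cmod (cin (f j) (ap (adj Z) (bas i))))\<^sup>2))"
      by (subst sum.swap) (simp add: sum.distrib)
    also have "\<dots> \<le> C" unfolding C_def by (intro sum_mono add_mono bessel o) auto
    finally show ?thesis .
  qed
  have "Fam 0 (\<lambda>_. 0)" by (simp add: Fam_def ons_def)
  hence ex: "\<exists>m f. Fam m f" by blast
  obtain m where m: "\<exists>f. Fam m f" "\<And>k. \<exists>f. Fam k f \<Longrightarrow> k \<le> m"
  proof -
    have b: "k \<le> nat \<lceil>C\<rceil>" if "\<exists>f. Fam k f" for k
    proof -
      have "real k \<le> real (nat \<lceil>C\<rceil>)" using that bound real_nat_ceiling_ge[of C] order_trans by blast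
      thus ?thesis by simp
    qed
    show thesis
      by (rule that[of "GREATEST k. \<exists>f. Fam k f"])
         (rule GreatestI_ex_nat[OF ex b], assumption, rule Greatest_le_nat[OF _ b])
  qed
  then obtain f where f: "Fam m f" by blast
  have o: "ons f" and f1: "\<And>j. j < m \<Longrightarrow> norm (f j) = 1" and f0: "\<And>j. j \<ge> m \<Longrightarrow> f j = 0"
    and fF: "\<And>j. j < m \<Longrightarrow> ap F (f j) = f j" and fP: "\<And>j. j < m \<Longrightarrow> \<exists>n. ap (P n) (f j) = f j"
    using f by (simp_all add: Fam_def)
  have fF': "ap F (f j) = f j" for j using fF f0 by (cases "j < m") (auto simp: ap_lin)
  have expand: "ap F x = (\<Sum>j<m. cin (f j) x *\<^sub>C f j)" for x
  proof (rule ons_expand[OF o f0 Fx(1) fF' Fx(2)])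
    fix g assume g: "ap F g = g" "\<And>j. j < m \<Longrightarrow> cin (f j) g = 0"
    \<comment> \<open>Otherwise some \<open>ap (P n) g\<close> is nonzero. It stays in the range of
      \<open>F\<close>, which commutes with \<open>P n\<close>, and is orthogonal to every
      \<open>f j\<close> because each \<open>f j\<close> lies in a single eigenspace; normalised, it
      would lengthen the family.\<close>
    show "g = 0"
    proof (rule P_total, rule ccontr)
      fix n assume ne: "ap (P n) g \<noteq> 0"
      define u where "u = inverse (norm (ap (P n) g)) *\<^sub>R ap (P n) g"
      have u1: "norm u = 1" using ne by (simp add: u_def)
      have PP: "ap (P n) (ap (P n) x) = ap (P n) x" for x by (simp only: ap_simps(6)[symmetric] P_idem)
      have uF: "ap F u = u" unfolding u_def by (simp add: ap_lin Fx(3)[symmetric] g)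
      have uP: "ap (P n) u = u" unfolding u_def by (simp add: ap_lin PP)
      have fu: "cin (f j) u = 0" if "j < m" for j
      proof -
        obtain k where k: "ap (P k) (f j) = f j" using fP[OF \<open>j < m\<close>] by blast
        have "cin (f j) (ap (P n) g) = cin (ap (P n) (ap (P k) (f j))) g"
          by (simp only: adj_right adj_P k)
        also have "\<dots> = 0"
        proof (cases "n = k")
          case True thus ?thesis using k g(2)[OF that] by simp
        next
          case False
          have "ap (P n * P k) (f j) = 0" by (simp only: P_orth[OF False] ap_simps)
          thus ?thesis by simp
        qed
        finally show ?thesis by (simp add: u_def scaleR_cscale cin_scale_right)
      qed
      have "Fam (Suc m) (f(m := u))"
        unfolding Fam_def ons_def
      proof (intro conjI allI impI)
        fix k l :: nat assume "k \<noteq> l"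
        thus "cin ((f(m := u)) k) ((f(m := u)) l) = 0"
          using ons_orth[OF o] fu f0 by (auto simp: fun_upd_def) (metis cin_commute cin_zero(1) complex_cnj_zero linorder_not_le)+
      next
        show "norm ((f(m := u)) k) = 0 \<or> norm ((f(m := u)) k) = 1" for k
          using o u1 by (simp add: ons_def)
        show "norm ((f(m := u)) k) = 1" if "k < Suc m" for k using that f1 u1 by auto
        show "(f(m := u)) k = 0" if "k \<ge> Suc m" for k using that f0 by auto
        show "ap F ((f(m := u)) k) = (f(m := u)) k" if "k < Suc m" for k using that fF' uF by simp
        show "\<exists>n. ap (P n) ((f(m := u)) k) = (f(m := u)) k" if "k < Suc m" for k
          using that fP[of k] uP by (cases "k = m") auto
      qed
      hence "Suc m \<le> m" using m(2) by blast
      thus False by simp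
    qed
  qed
  \<comment> \<open>The same double sum in the other order: for \<open>i < N\<close> the vector
    \<open>ap Zi (bas i)\<close> lies in the range of \<open>F\<close>, which the maximal family now
    spans, so each inner sum is 1.\<close>
  have "of_nat N = (\<Sum>i<N. \<Sum>j<m. cin (f j) (ap Zi (bas i)) * cin (bas i) (ap Z (f j)))"
  proof -
    have "of_nat N = (\<Sum>i<N. cin (bas i) (bas i))" by simp
    also have "\<dots> = (\<Sum>i<N. \<Sum>j<m. cin (f j) (ap Zi (bas i)) * cin (bas i) (ap Z (f j)))"
    proof (rule sum.cong)
      fix i assume "i \<in> {..<N}"
      hence "ap F (ap Zi (bas i)) = ap Zi (bas i)" by (simp add: FZ ZZ)
      hence "ap Zi (bas i) = (\<Sum>j<m. cin (f j) (ap Zi (bas i)) *\<^sub>C f j)"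
        using expand[of "ap Zi (bas i)"] by simp
      hence "ap Z (ap Zi (bas i)) = ap Z (\<Sum>j<m. cin (f j) (ap Zi (bas i)) *\<^sub>C f j)" by (rule arg_cong)
      hence "bas i = (\<Sum>j<m. cin (f j) (ap Zi (bas i)) *\<^sub>C ap Z (f j))"
        unfolding ZZ by (simp add: ap_sum ap_scale)
      hence "cin (bas i) (bas i) = cin (bas i) (\<Sum>j<m. cin (f j) (ap Zi (bas i)) *\<^sub>C ap Z (f j))"
        by (rule arg_cong)
      thus "cin (bas i) (bas i) = (\<Sum>j<m. cin (f j) (ap Zi (bas i)) * cin (bas i) (ap Z (f j)))"
        by (simp only: cin_sum_right cin_scale_right)
    qed simp
    finally show ?thesis .
  qed
  also have "\<dots> = of_nat m" unfolding count[OF f] by (rule sum.swap)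
  finally have "N = m" by (simp only: of_nat_eq_iff)
  show thesis
    by (rule that[of f]) (use o f1 fP fF' expand \<open>N = m\<close> in auto)
qed

end

context compression
begin

text \<open>\<open>U = V + Y\<close>, where \<open>Y\<close> carries eigenvectors spanning the
  kernel of \<open>V\<close> to the first \<open>N\<close> basis vectors. For \<open>i >= N\<close>
  the intertwining relation puts \<open>ap (adj V) (bas i)\<close> into the eigenspace labelled by
  \<open>i\<close>; for \<open>i < N\<close> the vector is \<open>f i\<close>.\<close>

lemma eigenbasis_near_identity:
  obtains U where "adj U * U = 1" "U * adj U = 1" "U - 1 \<in> I"
    "\<And>i. \<exists>n. ap (P n) (ap (adj U) (bas i)) = ap (adj U) (bas i)"
proof -
  obtain V where V: "V * adj V = Q" "Q * V = V" "\<And>n. V * P n = D n * V" "V - 1 \<in> I"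
    "\<And>x. ap V x = 0 \<longleftrightarrow> ap (Q * X) x = 0"
    by (rule partial_isometry, rule that)
  have aV: "P n * adj V = adj V * D n" for n
    using arg_cong[OF V(3)[of n], of adj] by (simp add: adj_P)
  have aVQ: "adj V * Q = adj V"
    using arg_cong[OF V(2), of adj] by simp
  \<comment> \<open>The projection onto the kernel of \<open>V\<close>.\<close>
  define G where "G = 1 - adj V * V"
  have VV: "adj V * V * (adj V * V) = adj V * V"
    by (metis V(1,2) mult.assoc)
  have G: "adj G = G" "G * G = G" "P n * G = G * P n" for n
  proof -
    show "adj G = G" by (simp add: G_def)
    show "G * G = G" using VV by (simp add: G_def algebra_simps)
    have "P n * (adj V * V) = adj V * V * P n" by (metis aV V(3) mult.assoc)
    thus "P n * G = G * P n" by (simp add: G_def algebra_simps)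
  qed
  have VG: "V * G = 0" unfolding G_def using V(1,2) by (simp add: algebra_simps flip: mult.assoc)
  \<comment> \<open>Invertible because \<open>Q * S\<close> is small, and equal to \<open>X\<close>
    after multiplication by \<open>Q\<close>: so the kernel of \<open>V\<close> is the preimage
    under \<open>Z\<close> of the span of the first \<open>N\<close> basis vectors.\<close>
  define Z where "Z = 1 - Q * S"
  have "norm (Q * S) < 1" using S_small by simp
  then obtain Zi where Zi: "Z * Zi = 1" "Zi * Z = 1" unfolding Z_def using neumann by blast
  have QZ: "Q * Z = Q * X" by (simp add: Z_def X_def algebra_simps flip: mult.assoc)
  have cQ: "pr {..<N} = 1 - Q" by (simp add: pr_compl)
  have GZ: "ap G x = x \<longleftrightarrow> ap (pr {..<N}) (ap Z x) = ap Z x" for x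
  proof -
    have "ap G x = x \<longleftrightarrow> ap (adj V * V) x = 0" by (simp add: G_def)
    also have "\<dots> \<longleftrightarrow> ap V x = 0"
    proof
      assume "ap (adj V * V) x = 0"
      hence "ap V (ap (adj V * V) x) = 0" by (simp only: ap_lin)
      hence "ap (Q * V) x = 0" by (simp only: V(1)[symmetric] ap_simps)
      thus "ap V x = 0" by (simp only: V(2))
    qed (simp add: ap_lin)
    also have "\<dots> \<longleftrightarrow> ap Q (ap Z x) = 0" by (simp only: V(5) QZ[symmetric] ap_simps(6))
    also have "\<dots> \<longleftrightarrow> ap (pr {..<N}) (ap Z x) = ap Z x" by (simp add: cQ)
    finally show ?thesis .
  qed
  obtain f where f: "ons f" "\<And>j. j < N \<Longrightarrow> \<exists>n. ap (P n) (f j) = f j"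
    "\<And>j. ap G (f j) = f j" "\<And>x. ap G x = (\<Sum>j<N. cin (f j) x *\<^sub>C f j)"
    "\<And>j. j < N \<Longrightarrow> norm (f j) = 1"
    by (rule eigenvectors_in_range[OF G Zi GZ], rule that)
  define Y where "Y = (\<Sum>i<N. r1 (bas i) (f i))"
  have aY: "ap (adj Y) x = (\<Sum>i<N. cin (bas i) x *\<^sub>C f i)" for x
  proof -
    have "adj Y = (\<Sum>i<N. r1 (f i) (bas i))" unfolding Y_def
      by (rule adj_unique) (simp add: ap_sum_left cin_simps cin_commute[of _ "f _"] mult.commute)
    thus ?thesis by (simp add: ap_sum_left)
  qed
  have aYb: "ap (adj Y) (bas i) = (if i < N then f i else 0)" for i
  proof -
    have "ap (adj Y) (bas i) = (\<Sum>j<N. if j = i then f i else 0)"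
      unfolding aY by (rule sum.cong) auto
    thus ?thesis by simp
  qed
  have Yx: "ap Y x = (\<Sum>i<N. cin (f i) x *\<^sub>C bas i)" for x
    by (simp add: Y_def ap_sum_left)
  have YYG: "adj Y * Y = G"
    by (rule bop_eqI) (simp add: Yx ap_sum ap_scale aYb f(4))
  have VaY: "V * adj Y = 0"
  proof (rule bop_eq_bas)
    fix i
    have "ap V (f i) = ap (V * G) (f i)" by (simp add: f(3))
    hence "ap V (f i) = 0" by (simp add: VG)
    thus "ap (V * adj Y) (bas i) = ap 0 (bas i)" by (simp add: aYb ap_lin)
  qed
  have YaV: "Y * adj V = 0" using arg_cong[OF VaY, of adj] by simp
  have aVY: "adj V * Y = 0"
  proof -
    have "Q * Y = 0" by (rule bop_eqI) (simp add: Yx ap_sum ap_scale)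
    hence "adj V * Q * Y = 0" by (simp add: mult.assoc)
    thus ?thesis by (simp add: aVQ)
  qed
  have aYV: "adj Y * V = 0" using arg_cong[OF aVY, of adj] by simp
  have YaY: "Y * adj Y = 1 - Q"
  proof (rule bop_eq_bas)
    fix i
    have "ap Y (f k) = bas k" if "k < N" for k
    proof -
      have "ap Y (f k) = (\<Sum>j<N. if j = k then bas k else 0)"
        unfolding Yx by (rule sum.cong) (use f(5)[OF that] in \<open>auto simp: ons_orth[OF f(1)] cin_norm\<close>)
      thus ?thesis using that by simp
    qed
    thus "ap (Y * adj Y) (bas i) = ap (1 - Q) (bas i)" by (auto simp: aYb ap_lin)
  qed
  define U where "U = V + Y"
  have aV0: "ap (adj V) (bas i) = 0" if "i < N" for i
  proof -
    have "ap (adj V * Q) (bas i) = 0" using that by (simp add: ap_lin)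
    thus ?thesis by (simp add: aVQ)
  qed
  show thesis
  proof (rule that[of U])
    show "adj U * U = 1" by (simp add: U_def algebra_simps aVY aYV YYG G_def)
    show "U * adj U = 1" by (simp add: U_def algebra_simps VaY YaV YaY V(1))
    have "Y \<in> I" unfolding Y_def by (intro sum_mem r1_mem)
    moreover have "U - 1 = (V - 1) + Y" by (simp add: U_def)
    ultimately show "U - 1 \<in> I" using V(4) add_mem by metis
    show "\<exists>n. ap (P n) (ap (adj U) (bas i)) = ap (adj U) (bas i)" for i
    proof (cases "i < N")
      case True
      hence "ap (adj U) (bas i) = f i" by (simp add: U_def aV0 aYb)
      thus ?thesis using f(2) True by simp
    next
      case False
      hence U: "ap (adj U) (bas i) = ap (adj V) (bas i)" by (simp add: U_def aYb)
      obtain n where n: "i \<in> F n" using F_cover[of i] False by auto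
      have "ap (P n * adj V) (bas i) = ap (adj V) (bas i)"
        unfolding aV using n False by simp
      thus ?thesis unfolding U by auto
    qed
  qed
qed

end

section \<open>Necessity: block-diagonal parts and sums of singular values\<close>

subsection \<open>Block-diagonal parts\<close>

lemma sum_pr_blocks: "(\<Sum>n<m. ap (pr {i. lb i = n}) x) = ap (pr {i. lb i < m}) x" for lb :: "nat \<Rightarrow> nat"
  by (rule coord_eqI) (simp add: coord_sum)

lemma sum_norm_blocks: "(\<Sum>n<m. (norm (ap (pr {i. lb i = n}) x))\<^sup>2) \<le> (norm x)\<^sup>2" for lb :: "nat \<Rightarrow> nat"
proof -
  have p: "(norm (ap (pr J) x))\<^sup>2 = Re (cin x (ap (pr J) x))" for J
    by (simp only: norm_adj_mult_eq adj_pr pr_mult Int_absorb)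
  have "(\<Sum>n<m. (norm (ap (pr {i. lb i = n}) x))\<^sup>2) = Re (cin x (\<Sum>n<m. ap (pr {i. lb i = n}) x))"
    by (simp only: p cin_sum_right Re_sum)
  also have "\<dots> = (norm (ap (pr {i. lb i < m}) x))\<^sup>2" by (simp only: sum_pr_blocks p)
  also have "\<dots> \<le> (norm x)\<^sup>2" by (intro power_mono norm_pr_ap) simp
  finally show ?thesis .
qed

text \<open>Grouping coordinates by label, block \<open>n\<close> contributes at most
  \<open>(norm K)^2\<close> times the squared norm of the part of \<open>x\<close> in block
  \<open>n\<close>, and these parts are orthogonal.\<close>

lemma block_diag_exists:
  fixes lb :: "nat \<Rightarrow> nat"
  shows "\<exists>M. \<forall>x i. coord (ap M x) i = coord (ap K (ap (pr {j. lb j = lb i}) x)) i"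
    and "(\<And>x i. coord (ap M x) i = coord (ap K (ap (pr {j. lb j = lb i}) x)) i) \<Longrightarrow> norm M \<le> norm K"
proof -
  define f where "f x i = coord (ap K (ap (pr {j. lb j = lb i}) x)) i" for x i
  have bd: "(\<Sum>i<N. (cmod (f x i))\<^sup>2) \<le> (norm K * norm x)\<^sup>2" for x N
  proof -
    \<comment> \<open>Exceeds every label among the first \<open>N\<close> coordinates; the inserted
      0 covers \<open>N = 0\<close>.\<close>
    define m where "m = Suc (Max (insert 0 (lb ` {..<N})))"
    have lt: "lb i < m" if "i < N" for i
      using that by (simp add: m_def less_Suc_eq_le)
    have "(\<Sum>i<N. (cmod (f x i))\<^sup>2) = (\<Sum>n<m. \<Sum>i\<in>{i \<in> {..<N}. lb i = n}. (cmod (f x i))\<^sup>2)"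
      by (rule sum.group[symmetric]) (use lt in auto)
    also have "\<dots> \<le> (\<Sum>n<m. (norm K)\<^sup>2 * (norm (ap (pr {i. lb i = n}) x))\<^sup>2)"
    proof (rule sum_mono)
      fix n
      let ?y = "ap K (ap (pr {i. lb i = n}) x)"
      have "(\<Sum>i\<in>{i \<in> {..<N}. lb i = n}. (cmod (f x i))\<^sup>2) = (\<Sum>i\<in>{i \<in> {..<N}. lb i = n}. (cmod (coord ?y i))\<^sup>2)"
        by (rule sum.cong) (auto simp: f_def)
      also have "\<dots> \<le> (norm ?y)\<^sup>2" by (rule sum_coord_le) simp
      also have "\<dots> \<le> (norm K * norm (ap (pr {i. lb i = n}) x))\<^sup>2" by (intro power_mono norm_ap) simp
      finally show "(\<Sum>i\<in>{i \<in> {..<N}. lb i = n}. (cmod (f x i))\<^sup>2) \<le> (norm K)\<^sup>2 * (norm (ap (pr {i. lb i = n}) x))\<^sup>2"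
        by (simp only: power_mult_distrib)
    qed
    also have "\<dots> \<le> (norm K)\<^sup>2 * (norm x)\<^sup>2"
      unfolding sum_distrib_left[symmetric] by (intro mult_left_mono sum_norm_blocks) simp
    finally show ?thesis by (simp only: power_mult_distrib)
  qed
  note l = l2I_bounded[OF bd, OF mult_nonneg_nonneg[OF norm_ge_zero norm_ge_zero]]
  have c: "coord (Abs_ell2 (f x)) i = f x i" for x i using coord_Abs[OF l(1)] by simp
  have "\<exists>M. \<forall>x. ap M x = Abs_ell2 (f x)"
    by (rule bop_ext[of _ "norm K"]) (auto intro!: coord_eqI l(2) simp: c f_def ap_lin ap_scale)
  then obtain T where "\<And>x. ap T x = Abs_ell2 (f x)" by blast
  thus "\<exists>M. \<forall>x i. coord (ap M x) i = coord (ap K (ap (pr {j. lb j = lb i}) x)) i"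
    by (intro exI[of _ T]) (simp add: c f_def)
  assume "\<And>x i. coord (ap M x) i = coord (ap K (ap (pr {j. lb j = lb i}) x)) i"
  hence "ap M x = Abs_ell2 (f x)" for x by (intro coord_eqI) (simp add: c f_def)
  thus "norm M \<le> norm K" by (intro norm_bop_le) (simp_all add: l(2))
qed

text \<open>The sum over all labels \<open>n\<close> of \<open>E K E\<close> with
  \<open>E = pr {i. lb i = n}\<close>, written row by row to avoid an infinite sum of
  operators.\<close>

definition block_diag :: "(nat \<Rightarrow> nat) \<Rightarrow> bop \<Rightarrow> bop" where
  "block_diag lb K = (SOME M. \<forall>x i. coord (ap M x) i = coord (ap K (ap (pr {j. lb j = lb i}) x)) i)"

lemma coord_block_diag:
  "coord (ap (block_diag lb K) x) i = coord (ap K (ap (pr {j. lb j = lb i}) x)) i"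
  unfolding block_diag_def using someI_ex[OF block_diag_exists(1)[of K lb]] by blast

lemma norm_block_diag: "norm (block_diag lb K) \<le> norm K"
  by (rule block_diag_exists(2)) (rule coord_block_diag)

lemma block_diag_add: "block_diag lb (K + M) = block_diag lb K + block_diag lb M"
  by (rule bop_eqI, rule coord_eqI) (simp add: coord_block_diag)

lemma block_diag_zero: "block_diag lb 0 = 0"
  by (rule bop_eqI, rule coord_eqI) (simp add: coord_block_diag)

lemma block_diag_sum: "block_diag lb (sum K A) = (\<Sum>a\<in>A. block_diag lb (K a))"
  by (induction A rule: infinite_finite_induct) (auto simp: block_diag_add block_diag_zero)

lemma block_diag_pr: "block_diag lb (pr J * K) = pr J * block_diag lb K"
  by (rule bop_eqI, rule coord_eqI) (simp add: coord_block_diag)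

lemma pr_block_diag: "pr {i. lb i = n} * block_diag lb K = pr {i. lb i = n} * K * pr {i. lb i = n}"
  by (rule bop_eqI, rule coord_eqI) (simp add: coord_block_diag)

lemma block_diag_partial:
  "ap (pr {i. lb i < m}) (ap (block_diag lb K) x) =
    (\<Sum>n<m. ap (pr {i. lb i = n}) (ap K (ap (pr {i. lb i = n}) x)))"
proof -
  have "ap (pr {i. lb i < m}) (ap (block_diag lb K) x) = (\<Sum>n<m. ap (pr {i. lb i = n} * block_diag lb K) x)"
    by (simp add: sum_pr_blocks)
  thus ?thesis unfolding pr_block_diag by simp
qed

lemma sum_prod_le:
  fixes a b :: "'i \<Rightarrow> real"
  assumes "(\<Sum>i\<in>A. (a i)\<^sup>2) \<le> c\<^sup>2" "(\<Sum>i\<in>A. (b i)\<^sup>2) \<le> d\<^sup>2" "c \<ge> 0" "d \<ge> 0"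
  shows "(\<Sum>i\<in>A. \<bar>a i\<bar> * \<bar>b i\<bar>) \<le> c * d"
proof -
  have "L2_set a A \<le> c" "L2_set b A \<le> d"
    unfolding L2_set_def using assms by (metis real_sqrt_le_mono real_sqrt_unique)+
  thus ?thesis
    using L2_set_mult_ineq[of a b A] mult_mono[of "L2_set a A" c "L2_set b A" d] assms L2_set_nonneg
    by (smt (verit))
qed

subsection \<open>A pairing with orthonormal systems\<close>

text \<open>By Ky Fan's principle, sums of matrix entries along orthonormal systems detect the sum
  of the first \<open>m\<close> singular values, here of the block-diagonal part. Being additive in
  \<open>K\<close>, the pairing can be estimated piece by piece.\<close>

definition pairing :: "(nat \<Rightarrow> nat) \<Rightarrow> (nat \<Rightarrow> ell2) \<Rightarrow> (nat \<Rightarrow> ell2) \<Rightarrow> nat \<Rightarrow> bop \<Rightarrow> complex" where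
  "pairing lb x y m K = (\<Sum>k<m. cin (y k) (ap (block_diag lb K) (x k)))"

lemma pairing_add: "pairing lb x y m (K + M) = pairing lb x y m K + pairing lb x y m M"
  by (simp add: pairing_def block_diag_add cin_simps sum.distrib)

lemma pairing_sum: "pairing lb x y m (sum K A) = (\<Sum>a\<in>A. pairing lb x y m (K a))"
  unfolding pairing_def block_diag_sum by (simp add: ap_sum_left cin_sum_right) (rule sum.swap)

lemma pairing_norm_le:
  assumes "ons x" "ons y"
  shows "cmod (pairing lb x y m K) \<le> m * norm K"
proof -
  have "cmod (pairing lb x y m K) \<le> (\<Sum>k<m. norm K)"
    unfolding pairing_def
  proof (rule order_trans[OF norm_sum], rule sum_mono)
    fix k
    have "cmod (cin (y k) (ap (block_diag lb K) (x k))) \<le> norm (y k) * norm (ap (block_diag lb K) (x k))"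
      by (rule cin_cauchy_schwarz)
    also have "\<dots> \<le> 1 * (norm K * 1)"
      by (intro mult_mono ons_norm[OF assms(2)] order_trans[OF norm_ap] norm_block_diag ons_norm[OF assms(1)]) auto
    finally show "cmod (cin (y k) (ap (block_diag lb K) (x k))) \<le> norm K" by simp
  qed
  thus ?thesis by simp
qed

text \<open>The trace-norm endpoint, uniform in \<open>m\<close>; \<open>pairing_norm_le\<close> is
  the operator-norm endpoint. Block \<open>n\<close> of \<open>r1 u v\<close> is again of rank one:
  Bessel in \<open>k\<close> bounds its share by the norms of the parts of \<open>u\<close> and
  \<open>v\<close> in block \<open>n\<close>, and Cauchy-Schwarz over \<open>n\<close> reassembles
  them.\<close>

lemma pairing_r1_le:
  assumes x: "ons x" and y: "ons y"
  shows "cmod (pairing lb x y m (r1 u v)) \<le> norm u * norm v"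
proof -
  let ?E = "\<lambda>n. pr {i. lb i = n}"
  define B where "B = block_diag lb (r1 u v)"
  have "cmod (\<Sum>k<m. cin (y k) (ap (pr {i. lb i < M}) (ap B (x k)))) \<le> norm u * norm v" for M
  proof -
    have e: "cin (y k) (ap (pr {i. lb i < M}) (ap B (x k))) =
        (\<Sum>n<M. cin (y k) (ap (?E n) u) * cnj (cin (x k) (ap (?E n) v)))" for k
    proof -
      have "cin v (ap (?E n) (x k)) = cnj (cin (x k) (ap (?E n) v))" for n
        by (metis adj_pr adj_right cin_commute)
      thus ?thesis unfolding B_def block_diag_partial
        by (simp add: cin_sum_right ap_scale cin_scale_right mult.commute)
    qed
    have "cmod (\<Sum>k<m. cin (y k) (ap (pr {i. lb i < M}) (ap B (x k)))) \<le>
        (\<Sum>k<m. \<Sum>n<M. cmod (cin (y k) (ap (?E n) u) * cnj (cin (x k) (ap (?E n) v))))"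
      unfolding e by (intro order_trans[OF norm_sum] sum_mono norm_sum)
    also have "\<dots> = (\<Sum>n<M. \<Sum>k<m. \<bar>cmod (cin (y k) (ap (?E n) u))\<bar> * \<bar>cmod (cin (x k) (ap (?E n) v))\<bar>)"
      by (subst sum.swap) (simp add: norm_mult)
    also have "\<dots> \<le> (\<Sum>n<M. \<bar>norm (ap (?E n) u)\<bar> * \<bar>norm (ap (?E n) v)\<bar>)"
    proof (rule sum_mono)
      fix n
      show "(\<Sum>k<m. \<bar>cmod (cin (y k) (ap (?E n) u))\<bar> * \<bar>cmod (cin (x k) (ap (?E n) v))\<bar>)
          \<le> \<bar>norm (ap (?E n) u)\<bar> * \<bar>norm (ap (?E n) v)\<bar>"
        using sum_prod_le[OF bessel[OF y finite_lessThan] bessel[OF x finite_lessThan] norm_ge_zero norm_ge_zero]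
        by simp
    qed
    also have "\<dots> \<le> norm u * norm v"
      by (rule sum_prod_le[OF sum_norm_blocks sum_norm_blocks norm_ge_zero norm_ge_zero])
    finally show ?thesis .
  qed
  moreover have "(\<lambda>M. cmod (\<Sum>k<m. cin (y k) (ap (pr {i. lb i < M}) (ap B (x k))))) \<longlonglongrightarrow>
      cmod (\<Sum>k<m. cin (y k) (ap B (x k)))"
    by (intro tendsto_norm tendsto_sum tendsto_cin pr_label_tendsto)
  ultimately show ?thesis unfolding pairing_def B_def[symmetric]
    by (intro LIMSEQ_le_const2) auto
qed

subsection \<open>Finite rank and singular values\<close>

lemma rank_le_mtI:
  assumes A: "finite A" "card A \<le> n" and F: "\<And>x. ap F x = (\<Sum>i\<in>A. a x i *\<^sub>C w i)"
  shows "rank_le (mt F) n"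
  unfolding rank_le_def
proof (intro exI conjI ballI)
  show "finite ((\<lambda>i. coord (w i)) ` A)" using A by simp
  show "card ((\<lambda>i. coord (w i)) ` A) \<le> n" using card_image_le[OF A(1)] A(2) order_trans by blast
  show "(\<lambda>i. coord (w i)) ` A \<subseteq> l2" using coord by auto
  fix x assume x: "x \<in> l2"
  \<comment> \<open>\<open>rank_le\<close> speaks of a set of vectors, so the coefficients of
    indices with the same vector are added up.\<close>
  show "mat_apply (mt F) x = (\<lambda>k. \<Sum>v\<in>(\<lambda>i. coord (w i)) ` A.
      (\<Sum>i\<in>{i\<in>A. coord (w i) = v}. a (Abs_ell2 x) i) * v k)"
  proof
    fix k
    define z where "z = Abs_ell2 x"
    have z: "x = coord z" using x by (simp add: z_def coord_Abs)
    have "mat_apply (mt F) x k = (\<Sum>i\<in>A. a z i * coord (w i) k)"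
      by (simp add: z mat_apply_mt F coord_sum)
    also have "\<dots> = (\<Sum>v\<in>(\<lambda>i. coord (w i)) ` A. \<Sum>i\<in>{i\<in>A. coord (w i) = v}. a z i * coord (w i) k)"
      by (rule sum.image_gen[OF A(1)])
    also have "\<dots> = (\<Sum>v\<in>(\<lambda>i. coord (w i)) ` A. (\<Sum>i\<in>{i\<in>A. coord (w i) = v}. a z i) * v k)"
      by (rule sum.cong) (auto simp: sum_distrib_right)
    finally show "mat_apply (mt F) x k =
        (\<Sum>v\<in>(\<lambda>i. coord (w i)) ` A. (\<Sum>i\<in>{i\<in>A. coord (w i) = v}. a (Abs_ell2 x) i) * v k)"
      unfolding z_def .
  qed
qed

lemma rank_le_mtE:
  assumes "rank_le (mt F) n"
  obtains g m where "ons g" "m \<le> n" "\<And>x. ap F x = (\<Sum>l<m. cin (g l) (ap F x) *\<^sub>C g l)"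
proof -
  obtain V where V: "finite V" "card V \<le> n" "V \<subseteq> l2"
    and r: "\<And>x. x \<in> l2 \<Longrightarrow> \<exists>c. mat_apply (mt F) x = (\<lambda>i. \<Sum>v\<in>V. c v * v i)"
    using assms unfolding rank_le_def by blast
  define V' where "V' = Abs_ell2 ` V"
  have fin: "finite V'" and card: "card V' \<le> n"
    unfolding V'_def using V(1,2) card_image_le[OF V(1), of Abs_ell2] by auto
  have cV: "coord (Abs_ell2 v) = v" if "v \<in> V" for v using that V(3) coord_Abs by auto
  have inj: "inj_on Abs_ell2 V" by (rule inj_on_inverseI[of _ coord]) (rule cV)
  obtain g where g: "ons g" "\<And>v. v \<in> V' \<Longrightarrow> v = (\<Sum>l<card V'. cin (g l) v *\<^sub>C g l)"
    by (rule gram_schmidt_finite[OF fin], rule that)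
  show thesis
  proof (rule that[OF g(1) card])
    fix x
    obtain c where c: "coord (ap F x) = (\<lambda>i. \<Sum>v\<in>V. c v * v i)"
      using r[OF coord[of x]] by (auto simp: mat_apply_mt)
    have "ap F x = (\<Sum>v\<in>V'. c (coord v) *\<^sub>C v)"
      by (rule coord_eqI) (simp add: c V'_def coord_sum sum.reindex[OF inj] cV)
    thus "ap F x = (\<Sum>l<card V'. cin (g l) (ap F x) *\<^sub>C g l)"
      using span_ons[OF g(2), where c = "\<lambda>v. c (coord v)"] by simp
  qed
qed

lemma rank_le_mono: "rank_le F n \<Longrightarrow> n \<le> k \<Longrightarrow> rank_le F k"
  unfolding rank_le_def using order_trans by blast

lemma rank_le_mt_diff:
  assumes "rank_le (mt F) n" "rank_le (mt G) k"
  shows "rank_le (mt (F - G)) (n + k)"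
proof -
  obtain g m where g: "ons g" "m \<le> n" "\<And>x. ap F x = (\<Sum>l<m. cin (g l) (ap F x) *\<^sub>C g l)"
    by (rule rank_le_mtE[OF assms(1)], rule that)
  obtain h p where h: "ons h" "p \<le> k" "\<And>x. ap G x = (\<Sum>l<p. cin (h l) (ap G x) *\<^sub>C h l)"
    by (rule rank_le_mtE[OF assms(2)], rule that)
  show ?thesis
  proof (rule rank_le_mtI[of "{..<m} <+> {..<p}" _ _ "\<lambda>x. case_sum (\<lambda>l. cin (g l) (ap F x)) (\<lambda>l. - cin (h l) (ap G x))" "case_sum g h"])
    show "card ({..<m} <+> {..<p}) \<le> n + k" using g(2) h(2) by (simp add: card_Plus)
    show "ap (F - G) x = (\<Sum>i\<in>{..<m} <+> {..<p}. case_sum (\<lambda>l. cin (g l) (ap F x)) (\<lambda>l. - cin (h l) (ap G x)) i *\<^sub>C case_sum g h i)" for x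
    proof -
      have "(\<Sum>l<p. - cin (h l) (ap G x) *\<^sub>C h l) = - (\<Sum>l<p. cin (h l) (ap G x) *\<^sub>C h l)"
        by (rule coord_eqI) (simp add: coord_sum sum_negf)
      thus ?thesis using g(3)[of x] h(3)[of x] by (simp add: sum.Plus)
    qed
  qed simp
qed

lemma pairing_rank_le:
  assumes x: "ons x" and y: "ons y" and F: "rank_le (mt F) r"
  shows "cmod (pairing lb x y m F) \<le> r * norm F"
proof -
  obtain g p where g: "ons g" "p \<le> r" "\<And>x. ap F x = (\<Sum>l<p. cin (g l) (ap F x) *\<^sub>C g l)"
    by (rule rank_le_mtE[OF F], rule that)
  have "F = (\<Sum>l<p. r1 (g l) (ap (adj F) (g l)))"
    by (rule bop_eqI) (simp add: ap_sum_left adj_right[symmetric] g(3)[symmetric])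
  hence "pairing lb x y m F = (\<Sum>l<p. pairing lb x y m (r1 (g l) (ap (adj F) (g l))))"
    by (metis pairing_sum)
  hence "cmod (pairing lb x y m F) \<le> (\<Sum>l<p. cmod (pairing lb x y m (r1 (g l) (ap (adj F) (g l)))))"
    by (simp only: norm_sum)
  also have "\<dots> \<le> (\<Sum>l<p. norm F)"
  proof (rule sum_mono)
    fix l
    have "cmod (pairing lb x y m (r1 (g l) (ap (adj F) (g l)))) \<le> norm (g l) * norm (ap (adj F) (g l))"
      by (rule pairing_r1_le[OF x y])
    also have "\<dots> \<le> 1 * (norm (adj F) * 1)"
      by (intro mult_mono ons_norm[OF g(1)] order_trans[OF norm_ap]) auto
    finally show "cmod (pairing lb x y m (r1 (g l) (ap (adj F) (g l)))) \<le> norm F" by simp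
  qed
  also have "\<dots> \<le> r * norm F" using g(2) by (simp add: mult_right_mono)
  finally show ?thesis .
qed

definition sing :: "bop \<Rightarrow> nat \<Rightarrow> real" where
  "sing B n = Inf {norm (B - F) | F. rank_le (mt F) n}"

lemma sing_val_mt: "sing_val (mt B) n = sing B n"
proof -
  have "{opnorm (mat_diff (mt B) F) |F. bounded_op F \<and> rank_le F n} = {norm (B - F) | F. rank_le (mt F) n}"
    (is "?L = ?R")
  proof
    show "?L \<subseteq> ?R"
    proof
      fix s assume "s \<in> ?L"
      then obtain F where F: "s = opnorm (mat_diff (mt B) F)" "bounded_op F" "rank_le F n" by blast
      obtain F' where "F = mt F'" by (rule bounded_op_imp_mt[OF F(2)])
      thus "s \<in> ?R" using F by (auto simp: opnorm_mt simp flip: mt_diff)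
    qed
    show "?R \<subseteq> ?L" by (force simp: mt_diff bounded_op_mt simp flip: opnorm_mt)
  qed
  thus ?thesis by (simp add: sing_val_def sing_def)
qed

lemma rank_le_mt_zero: "rank_le (mt 0) n"
  by (rule rank_le_mtI[of "{}"]) auto

lemma sing_bdd: "bdd_below {norm (B - F) | F. rank_le (mt F) n}"
  by (rule bdd_belowI[of _ 0]) auto

lemma sing_le: "rank_le (mt F) n \<Longrightarrow> sing B n \<le> norm (B - F)"
  unfolding sing_def by (rule cInf_lower[OF _ sing_bdd]) blast

lemma sing_nonneg: "0 \<le> sing B n"
  unfolding sing_def by (rule cInf_greatest) (use rank_le_mt_zero in auto)

lemma sing_mono: "n \<le> k \<Longrightarrow> sing B k \<le> sing B n"
  unfolding sing_def
  by (rule cInf_superset_mono[OF _ sing_bdd]) (use rank_le_mt_zero rank_le_mono in blast)+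

lemma sing_approx:
  assumes "\<delta> > 0"
  obtains F where "rank_le (mt F) n" "norm (B - F) < sing B n + \<delta>"
proof -
  have "{norm (B - F) | F. rank_le (mt F) n} \<noteq> {}" using rank_le_mt_zero by blast
  moreover have "Inf {norm (B - F) | F. rank_le (mt F) n} < sing B n + \<delta>" using assms by (simp add: sing_def)
  ultimately obtain s where "s \<in> {norm (B - F) | F. rank_le (mt F) n}" "s < sing B n + \<delta>"
    using cInf_lessD[of "{norm (B - F) | F. rank_le (mt F) n}"] by blast
  thus thesis using that by blast
qed

subsection \<open>Block-diagonal parts do not increase the means of the singular values\<close>

text \<open>Cauchy condensation: the block from \<open>2^q\<close> up to \<open>2^(q+1) - 1\<close>
  has \<open>2^q\<close> terms, all at least the last one.\<close>

lemma dyadic_sum_le: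
  fixes a :: "nat \<Rightarrow> real"
  assumes "\<And>n k. n \<le> k \<Longrightarrow> a k \<le> a n" "\<And>n. 0 \<le> a n"
  shows "(\<Sum>j\<le>q. 2 ^ j * a (2 ^ j - 1)) \<le> 2 * (\<Sum>k<2 ^ q. a k)"
proof (induction q)
  case (Suc q)
  have "2 ^ q * a (2 ^ Suc q - 1) = (\<Sum>k\<in>{2 ^ q..<2 ^ Suc q :: nat}. a (2 ^ Suc q - 1))" by simp
  also have "\<dots> \<le> (\<Sum>k\<in>{2 ^ q..<2 ^ Suc q}. a k)"
    by (rule sum_mono) (use assms(1) in auto)
  finally have "2 ^ Suc q * a (2 ^ Suc q - 1) \<le> 2 * (\<Sum>k\<in>{2 ^ q..<2 ^ Suc q}. a k)" by simp
  moreover have "(\<Sum>k<2 ^ Suc q. a k) = (\<Sum>k<2 ^ q. a k) + (\<Sum>k\<in>{2 ^ q..<2 ^ Suc q}. a k)"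
    by (simp add: lessThan_atLeast0 sum.atLeastLessThan_concat)
  ultimately show ?case using Suc by simp
qed (use assms(2)[of 0] in simp)

text \<open>Write \<open>K\<close> as a telescoping sum of near-optimal approximants of rank below \<open>2\<^sup>j\<close>.\<close>

lemma pairing_upper:
  assumes x: "ons x" and y: "ons y" and m: "m \<ge> 1"
  shows "cmod (pairing lb x y m K) \<le> 12 * (\<Sum>k<m. sing K k)"
proof -
  \<comment> \<open>Ranks below \<open>2^j\<close>, with \<open>r 0 = 0\<close>: the first
    approximant pairs to 0, and the indices are those of \<open>dyadic_sum_le\<close>.\<close>
  define r where "r j = 2 ^ j - (1::nat)" for j
  obtain q where q: "2 ^ q \<le> m" "m < 2 ^ Suc q"
    using ex_power_ivl1[of 2 m] m by auto
  have main: "cmod (pairing lb x y m K) \<le> 12 * (\<Sum>k<m. sing K k) + \<delta>" if d: "\<delta> > 0" for \<delta>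
  proof -
    \<comment> \<open>The total coefficient of the slack \<open>e\<close> in the estimate
      below.\<close>
    define C where "C = (\<Sum>j<q. 6 * 2 ^ j) + real m"
    have "C \<ge> 1" unfolding C_def using m by (simp add: sum_nonneg add_increasing)
    define e where "e = \<delta> / C"
    have e: "e > 0" using d \<open>C \<ge> 1\<close> by (simp add: e_def)
    have "\<forall>j. \<exists>F. rank_le (mt F) (r j) \<and> norm (K - F) < sing K (r j) + e"
      using sing_approx[OF e] by metis
    then obtain F where F: "\<And>j. rank_le (mt (F j)) (r j)" "\<And>j. norm (K - F j) < sing K (r j) + e"
      using choice[of "\<lambda>j F. rank_le (mt F) (r j) \<and> norm (K - F) < sing K (r j) + e"] by blast
    have "K = F 0 + (\<Sum>j<q. F (Suc j) - F j) + (K - F q)" by (simp add: sum_lessThan_telescope)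
    hence "pairing lb x y m K = pairing lb x y m (F 0 + (\<Sum>j<q. F (Suc j) - F j) + (K - F q))"
      by (rule arg_cong)
    hence "cmod (pairing lb x y m K) = cmod (pairing lb x y m (F 0) +
        (\<Sum>j<q. pairing lb x y m (F (Suc j) - F j)) + pairing lb x y m (K - F q))"
      by (simp only: pairing_add pairing_sum)
    also have "\<dots> \<le> cmod (pairing lb x y m (F 0)) +
        (\<Sum>j<q. cmod (pairing lb x y m (F (Suc j) - F j))) + cmod (pairing lb x y m (K - F q))"
      by (intro order_trans[OF norm_triangle_ineq] add_mono norm_sum order_refl)
    \<comment> \<open>Each difference has rank at most \<open>3 * 2^j\<close> and norm at most
      \<open>2 * (sing K (r j) + e)\<close>, whence 6. The last term uses the operator norm and
      \<open>m < 2^(q+1)\<close>. Condensation then doubles 6 to 12.\<close>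
    also have "\<dots> \<le> 0 + (\<Sum>j<q. 6 * (2 ^ j * sing K (r j)) + 6 * 2 ^ j * e) + (2 * (2 ^ q * sing K (r q)) + real m * e)"
    proof (intro add_mono sum_mono)
      show "cmod (pairing lb x y m (F 0)) \<le> 0"
        using pairing_rank_le[OF x y F(1)[of 0]] by (simp add: r_def)
      show "cmod (pairing lb x y m (F (Suc j) - F j)) \<le> 6 * (2 ^ j * sing K (r j)) + 6 * 2 ^ j * e" for j
      proof -
        have "norm (F (Suc j) - F j) \<le> norm (K - F j) + norm (K - F (Suc j))"
          using norm_triangle_ineq4[of "K - F j" "K - F (Suc j)"] by simp
        also have "\<dots> \<le> 2 * (sing K (r j) + e)"
        proof -
          have "sing K (r (Suc j)) \<le> sing K (r j)"
            by (rule sing_mono) (simp add: r_def diff_le_mono)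
          thus ?thesis using F(2)[of j] F(2)[of "Suc j"] by simp
        qed
        finally have n: "norm (F (Suc j) - F j) \<le> 2 * (sing K (r j) + e)" .
        have rr: "real (r (Suc j) + r j) \<le> 3 * 2 ^ j"
        proof -
          have "r (Suc j) + r j \<le> 3 * 2 ^ j" by (simp add: r_def)
          hence "real (r (Suc j) + r j) \<le> real (3 * 2 ^ j)" by (simp only: of_nat_le_iff)
          thus ?thesis by simp
        qed
        have "cmod (pairing lb x y m (F (Suc j) - F j)) \<le> real (r (Suc j) + r j) * norm (F (Suc j) - F j)"
          by (rule pairing_rank_le[OF x y rank_le_mt_diff[OF F(1) F(1)]])
        also have "\<dots> \<le> (3 * 2 ^ j) * (2 * (sing K (r j) + e))"
          by (intro mult_mono rr n) auto
        finally show ?thesis by (simp add: algebra_simps)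
      qed
      have "cmod (pairing lb x y m (K - F q)) \<le> real m * norm (K - F q)" by (rule pairing_norm_le[OF x y])
      also have "\<dots> \<le> real m * (sing K (r q) + e)" using F(2)[of q] by (intro mult_left_mono) auto
      also have "\<dots> \<le> 2 * (2 ^ q * sing K (r q)) + real m * e"
      proof -
        have "real m \<le> real (2 ^ Suc q)" using q(2) by (simp only: of_nat_le_iff)
        hence "real m * sing K (r q) \<le> (2 * 2 ^ q) * sing K (r q)"
          by (intro mult_right_mono sing_nonneg) simp
        thus ?thesis by (simp add: algebra_simps)
      qed
      finally show "cmod (pairing lb x y m (K - F q)) \<le> 2 * (2 ^ q * sing K (r q)) + real m * e" .
    qed
    also have "\<dots> = 6 * (\<Sum>j<q. 2 ^ j * sing K (r j)) + 2 * (2 ^ q * sing K (r q)) + C * e"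
      by (simp add: C_def sum.distrib sum_distrib_left sum_distrib_right algebra_simps)
    also have "\<dots> \<le> 6 * (\<Sum>j\<le>q. 2 ^ j * sing K (r j)) + C * e"
      using sing_nonneg[of K "r q"] by (simp add: lessThan_Suc_atMost[symmetric])
    also have "(\<Sum>j\<le>q. 2 ^ j * sing K (r j)) \<le> 2 * (\<Sum>k<2 ^ q. sing K k)"
      unfolding r_def by (rule dyadic_sum_le) (auto intro: sing_mono sing_nonneg)
    also have "(\<Sum>k<2 ^ q. sing K k) \<le> (\<Sum>k<m. sing K k)"
      by (rule sum_mono2) (use q(1) sing_nonneg in auto)
    also have "C * e = \<delta>" using \<open>C \<ge> 1\<close> by (simp add: e_def)
    finally show ?thesis by simp
  qed
  show ?thesis by (rule field_le_epsilon) (rule main)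
qed

text \<open>Stands in for the Schmidt decomposition. Compressing \<open>B\<close> away from the
  first \<open>m\<close> vectors on both sides changes it by rank at most \<open>2 * m\<close>,
  hence the index \<open>2 * k\<close>; a vector attaining the remaining norm up to a factor 2 gives
  the next pair. The entries are real with nonnegative lower bounds, so they add up without
  cancellation.\<close>

lemma biorthogonal_systems:
  "\<exists>x y. ons x \<and> ons y \<and> (\<forall>k\<ge>m. x k = 0 \<and> y k = 0) \<and>
     (\<forall>k<m. \<exists>r. cin (y k) (ap B (x k)) = of_real r \<and> sing B (2 * k) / 2 \<le> r)"
proof (induction m)
  case 0
  show ?case by (intro exI[of _ "\<lambda>_. 0"]) (simp add: ons_def)
next
  case (Suc m)
  then obtain x y where x: "ons x" and y: "ons y" and z: "\<And>k. k \<ge> m \<Longrightarrow> x k = 0 \<and> y k = 0"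
    and r: "\<And>k. k < m \<Longrightarrow> \<exists>r. cin (y k) (ap B (x k)) = of_real r \<and> sing B (2 * k) / 2 \<le> r" by blast
  define T where "T = (1 - oproj y m) * B * (1 - oproj x m)"
  have "rank_le (mt (B - T)) (2 * m)"
  proof (rule rank_le_mtI[of "{..<m} <+> {..<m}" _ _
        "\<lambda>v. case_sum (\<lambda>l. cin (y l) (ap B v)) (\<lambda>l. cin (x l) v)" "case_sum y (\<lambda>l. ap ((1 - oproj y m) * B) (x l))"])
    fix v
    have "B - T = oproj y m * B + (1 - oproj y m) * B * oproj x m" by (simp add: T_def algebra_simps)
    hence "ap (B - T) v = ap (oproj y m) (ap B v) + ap ((1 - oproj y m) * B) (ap (oproj x m) v)"
      by simp
    also have "ap ((1 - oproj y m) * B) (ap (oproj x m) v) = (\<Sum>l<m. cin (x l) v *\<^sub>C ap ((1 - oproj y m) * B) (x l))"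
      by (simp only: ap_oproj[of x] ap_sum ap_scale)
    also have "ap (oproj y m) (ap B v) = (\<Sum>l<m. cin (y l) (ap B v) *\<^sub>C y l)" by (rule ap_oproj)
    finally show "ap (B - T) v = (\<Sum>i\<in>{..<m} <+> {..<m}. case_sum (\<lambda>l. cin (y l) (ap B v)) (\<lambda>l. cin (x l) v) i *\<^sub>C
        case_sum y (\<lambda>l. ap ((1 - oproj y m) * B) (x l)) i)"
      by (simp add: sum.Plus del: ap_simps)
  qed (simp_all add: card_Plus)
  from sing_le[OF this, of B] have sT: "sing B (2 * m) \<le> norm T" by simp
  show ?case
  proof (cases "norm T = 0")
    \<comment> \<open>Nothing is left to pick up: the zero vectors already at index \<open>m\<close>
      serve.\<close>
    case True
    hence "sing B (2 * m) / 2 \<le> 0" using sT by simp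
    hence "\<exists>r. cin (y k) (ap B (x k)) = of_real r \<and> sing B (2 * k) / 2 \<le> r" if "k < Suc m" for k
      using r[of k] z[of k] that by (cases "k = m") (auto intro!: exI[of _ 0])
    thus ?thesis using x y z by (intro exI[of _ x] exI[of _ y]) auto
  next
    case False
    have "\<exists>v. \<not> norm (ap T v) \<le> norm T / 2 * norm v"
    proof (rule ccontr)
      assume "\<not> ?thesis"
      hence "norm T \<le> norm T / 2" by (intro norm_bop_le) auto
      thus False using False by simp
    qed
    then obtain v where v: "norm (ap T v) > norm T / 2 * norm v" by (auto simp: not_le)
    \<comment> \<open>Projecting off the earlier \<open>x j\<close> leaves the image under
      \<open>T\<close> unchanged and does not increase the norm, so the ratio can only
      improve.\<close>
    define v' where "v' = v - ap (oproj x m) v"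
    have Tv: "ap T v' = ap T v"
      by (simp add: T_def v'_def ap_lin oproj_idem[OF x])
    have Tv': "ap T v' = ap B v' - ap (oproj y m) (ap B v')"
      by (simp add: T_def v'_def ap_lin oproj_idem[OF x])
    have v'n: "norm v' \<le> norm v" unfolding v'_def by (rule norm_sub_oproj[OF x])
    have "norm T / 2 * norm v' \<le> norm T / 2 * norm v" using v'n by (intro mult_left_mono) auto
    hence gt: "norm (ap T v') > norm T / 2 * norm v'" using v Tv by simp
    have v0: "v' \<noteq> 0" using gt by (auto simp: ap_lin)
    define a where "a = inverse (norm v') *\<^sub>R v'"
    have a1: "norm a = 1" using v0 by (simp add: a_def)
    have xa: "cin (x j) a = 0" if "j < m" for j
      by (simp add: a_def v'_def scaleR_cscale cin_simps cin_oproj[OF x that])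
    define w where "w = ap B a - ap (oproj y m) (ap B a)"
    have wT: "w = inverse (norm v') *\<^sub>R ap T v'"
      unfolding w_def Tv' a_def by (simp add: ap_lin scaleR_diff_right)
    have wn: "norm w \<ge> norm T / 2"
      unfolding wT using gt v0 by (simp add: field_simps)
    hence w0: "w \<noteq> 0" using False by auto
    define b where "b = inverse (norm w) *\<^sub>R w"
    have b1: "norm b = 1" using w0 by (simp add: b_def)
    have yb: "cin (y j) b = 0" if "j < m" for j
      by (simp add: b_def w_def scaleR_cscale cin_simps cin_oproj[OF y that])
    have by': "cin b (y j) = 0" if "j < m" for j using yb[OF that] by (metis cin_commute complex_cnj_zero)
    have ax': "cin a (x j) = 0" if "j < m" for j using xa[OF that] by (metis cin_commute complex_cnj_zero)
    have "cin b (ap (oproj y m) (ap B a)) = 0" by (simp add: ap_oproj cin_simps by')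
    moreover have "cin b w = of_real (norm w)"
      using w0 by (simp add: b_def scaleR_cscale cin_scale_left cin_norm power2_eq_square)
    ultimately have bBa: "cin b (ap B a) = of_real (norm w)" by (simp add: w_def cin_diff_right)
    have upd: "ons (g(m := c))" if "ons g" "\<And>k. k \<ge> m \<Longrightarrow> g k = 0" "norm c = 1"
      "\<And>j. j < m \<Longrightarrow> cin (g j) c = 0" "\<And>j. j < m \<Longrightarrow> cin c (g j) = 0" for g :: "nat \<Rightarrow> ell2" and c
      unfolding ons_def
    proof (intro conjI allI impI)
      show "norm ((g(m := c)) k) = 0 \<or> norm ((g(m := c)) k) = 1" for k
        using that(1,3) by (simp add: ons_def)
      fix k l :: nat assume "k \<noteq> l"
      thus "cin ((g(m := c)) k) ((g(m := c)) l) = 0"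
        using ons_orth[OF that(1)] that(2,4,5) by (cases "k < m"; cases "l < m") auto
    qed
    show ?thesis
    proof (intro exI conjI allI impI)
      show "ons (x(m := a))" by (rule upd[OF x _ a1 xa ax']) (use z in auto)
      show "ons (y(m := b))" by (rule upd[OF y _ b1 yb by']) (use z in auto)
      show "(x(m := a)) k = 0" "(y(m := b)) k = 0" if "k \<ge> Suc m" for k using that z by auto
      fix k assume k: "k < Suc m"
      show "cin ((y(m := b)) k) (ap B ((x(m := a)) k)) = of_real (if k = m then norm w else SOME r. cin (y k) (ap B (x k)) = of_real r \<and> sing B (2 * k) / 2 \<le> r)"
        using k someI_ex[OF r[of k]] bBa by auto
      show "sing B (2 * k) / 2 \<le> (if k = m then norm w else SOME r. cin (y k) (ap B (x k)) = of_real r \<and> sing B (2 * k) / 2 \<le> r)"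
        using k someI_ex[OF r[of k]] wn sT by auto
    qed
  qed
qed

lemma sum_even_ge:
  fixes a :: "nat \<Rightarrow> real"
  assumes "\<And>n k. n \<le> k \<Longrightarrow> a k \<le> a n" "\<And>n. 0 \<le> a n"
  shows "(\<Sum>k<m. a k) \<le> 2 * (\<Sum>k<m. a (2 * k))"
proof -
  have "(\<Sum>k<m. a k) \<le> (\<Sum>k<2 * m. a k)" by (rule sum_mono2) (use assms in auto)
  also have "\<dots> \<le> 2 * (\<Sum>k<m. a (2 * k))"
  proof (induction m)
    case (Suc m)
    have "a (Suc (2 * m)) \<le> a (2 * m)" by (rule assms) simp
    thus ?case using Suc by simp
  qed simp
  finally show ?thesis .
qed

text \<open>48 is 12 from \<open>pairing_upper\<close>, times 2 for the near-maximal vectors, times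
  2 for using even indices only.\<close>

lemma sum_sing_block_diag_le: "(\<Sum>k<m. sing (block_diag lb K) k) \<le> 48 * (\<Sum>k<m. sing K k)"
proof (cases "m = 0")
  case False
  define B where "B = block_diag lb K"
  obtain x y where xy: "ons x" "ons y"
    and r: "\<forall>k<m. \<exists>r. cin (y k) (ap B (x k)) = of_real r \<and> sing B (2 * k) / 2 \<le> r"
    using biorthogonal_systems[of m B] by blast
  obtain r where r: "\<And>k. k < m \<Longrightarrow> cin (y k) (ap B (x k)) = of_real (r k) \<and> sing B (2 * k) / 2 \<le> r k"
    using r by metis
  have "(\<Sum>k<m. sing B (2 * k)) / 2 \<le> (\<Sum>k<m. r k)"
    unfolding sum_divide_distrib by (rule sum_mono) (use r in auto)
  also have "\<dots> \<le> cmod (of_real (\<Sum>k<m. r k))" by (simp only: norm_of_real abs_ge_self)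
  also have "complex_of_real (\<Sum>k<m. r k) = pairing lb x y m K"
    unfolding pairing_def B_def[symmetric] of_real_sum by (rule sum.cong) (use r in auto)
  also have "cmod \<dots> \<le> 12 * (\<Sum>k<m. sing K k)" by (rule pairing_upper) (use xy False in auto)
  finally have "(\<Sum>k<m. sing B (2 * k)) \<le> 24 * (\<Sum>k<m. sing K k)" by simp
  thus ?thesis using sum_even_ge[of "sing B" m, OF sing_mono sing_nonneg] by (simp add: B_def)
qed simp

subsection \<open>Compactness of block-diagonal parts\<close>

lemma compact_op_tail:
  assumes "compact_op (mt K)" "\<epsilon> > 0"
  obtains N where "norm (pr {N..} * K) \<le> \<epsilon>"
proof -
  obtain F0 where F0: "bounded_op F0" "finite_rank F0" "opnorm (mat_diff (mt K) F0) < \<epsilon> / 2"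
    using assms unfolding compact_op_def by (metis half_gt_zero)
  obtain F where F: "F0 = mt F" by (rule bounded_op_imp_mt[OF F0(1)])
  have KF: "norm (K - F) < \<epsilon> / 2" using F0(3) by (simp add: F opnorm_mt flip: mt_diff)
  obtain n where "rank_le (mt F) n" using F0(2) F by (auto simp: finite_rank_def)
  then obtain g m where g: "ons g" "\<And>x. ap F x = (\<Sum>l<m. cin (g l) (ap F x) *\<^sub>C g l)"
    using rank_le_mtE by metis
  have "(\<lambda>n. (\<Sum>l<m. norm (ap (pr {n..}) (g l))) * norm F) \<longlonglongrightarrow> 0 * norm F"
    by (intro tendsto_intros pr_tail_sum)
  hence "\<forall>\<^sub>F n in sequentially. (\<Sum>l<m. norm (ap (pr {n..}) (g l))) * norm F < \<epsilon> / 2"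
    using assms(2) by (intro order_tendstoD) auto
  then obtain N where N: "(\<Sum>l<m. norm (ap (pr {N..}) (g l))) * norm F < \<epsilon> / 2"
    unfolding eventually_sequentially by blast
  show thesis
  proof (rule that)
    have "norm (pr {N..} * K) \<le> norm (pr {N..} * F) + norm (pr {N..} * (K - F))"
      by (rule order_trans[OF _ norm_triangle_ineq]) (simp add: algebra_simps)
    also have "norm (pr {N..} * F) \<le> \<epsilon> / 2"
      using norm_pr_finite_rank[OF g, of "{N..}"] N by linarith
    also have "norm (pr {N..} * (K - F)) \<le> 1 * (\<epsilon> / 2)"
      by (rule order_trans[OF norm_mult_ineq]) (intro mult_mono norm_pr_le, use KF in auto)
    finally show "norm (pr {N..} * K) \<le> \<epsilon>" by simp
  qed
qed

text \<open>Left multiplication by a coordinate projection commutes with taking block-diagonal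
  parts, so the tail of the block-diagonal part is the block-diagonal part of a small tail.\<close>

lemma compact_op_block_diag:
  assumes "compact_op (mt K)"
  shows "compact_op (mt (block_diag lb K))"
  unfolding compact_op_def
proof (intro conjI allI impI bounded_op_mt)
  fix \<epsilon> :: real assume "\<epsilon> > 0"
  then obtain N where N: "norm (pr {N..} * K) \<le> \<epsilon> / 2" using compact_op_tail[OF assms, of "\<epsilon> / 2"] by auto
  define F where "F = pr {..<N} * block_diag lb K"
  have "block_diag lb K - F = (1 - pr {..<N}) * block_diag lb K" by (simp add: F_def algebra_simps)
  also have "1 - pr {..<N} = pr {N..}" by (simp add: pr_compl)
  finally have "block_diag lb K - F = block_diag lb (pr {N..} * K)" by (simp add: block_diag_pr)
  hence "norm (block_diag lb K - F) \<le> \<epsilon> / 2" using norm_block_diag N order_trans by metis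
  hence "opnorm (mat_diff (mt (block_diag lb K)) (mt F)) < \<epsilon>"
    using \<open>\<epsilon> > 0\<close> by (simp add: opnorm_mt flip: mt_diff)
  moreover have "rank_le (mt F) N"
    by (rule rank_le_mtI[of "{..<N}" _ _ "\<lambda>x i. cin (bas i) (ap (block_diag lb K) x)" bas])
       (simp_all add: F_def pr_finite ap_sum_left)
  ultimately show "\<exists>F. bounded_op F \<and> finite_rank F \<and> opnorm (mat_diff (mt (block_diag lb K)) F) < \<epsilon>"
    by (intro exI[of _ "mt F"]) (auto simp: bounded_op_mt finite_rank_def)
qed

lemma arith_mean_block_diag:
  "arith_mean (sing_val (mt (block_diag lb K))) \<in> O(arith_mean (sing_val (mt K)))"
proof (rule bigoI[where c = 48], rule always_eventually, rule allI)
  fix n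
  have "arith_mean (sing_val (mt (block_diag lb K))) n \<le> 48 * arith_mean (sing_val (mt K)) n"
    using sum_sing_block_diag_le[of lb K "Suc n"] unfolding arith_mean_def sing_val_mt lessThan_Suc_atMost
    by (simp add: divide_right_mono)
  moreover have "0 \<le> arith_mean (sing_val (mt M)) n" for M
    unfolding arith_mean_def sing_val_mt by (intro divide_nonneg_nonneg sum_nonneg sing_nonneg) auto
  ultimately show "norm (arith_mean (sing_val (mt (block_diag lb K))) n) \<le> 48 * norm (arith_mean (sing_val (mt K)) n)"
    by simp
qed

section \<open>Transfer to matrices and assembly of both implications\<close>

subsection \<open>Translation to matrices\<close>

lemma mt_eq_iff [simp]: "mt M = mt N \<longleftrightarrow> M = N"
  using mt_inj by auto

lemma is_proj_mt: "is_proj (mt E) \<longleftrightarrow> adj E = E \<and> E * E = E"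
  by (simp add: is_proj_def bounded_op_mt flip: mt_adj mt_mult)

lemma unitary_mt: "unitary (mt U) \<longleftrightarrow> adj U * U = 1 \<and> U * adj U = 1"
  by (simp add: unitary_def bounded_op_mt flip: mt_adj mt_mult mt_one)

lemma diagonal_mt: "diagonal (mt M) \<longleftrightarrow> (\<forall>i. \<exists>c. ap M (bas i) = c *\<^sub>C bas i)"
proof
  assume d: "diagonal (mt M)"
  have "ap M (bas i) = coord (ap M (bas i)) i *\<^sub>C bas i" for i
    by (rule coord_eqI) (use d in \<open>auto simp: diagonal_def mt_def\<close>)
  thus "\<forall>i. \<exists>c. ap M (bas i) = c *\<^sub>C bas i" by blast
next
  assume *: "\<forall>i. \<exists>c. ap M (bas i) = c *\<^sub>C bas i"
  show "diagonal (mt M)"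
    unfolding diagonal_def mt_def
  proof (intro allI impI)
    fix i j :: nat assume "i \<noteq> j"
    obtain c where "ap M (bas j) = c *\<^sub>C bas j" using * by blast
    thus "coord (ap M (bas j)) i = 0" using \<open>i \<noteq> j\<close> by simp
  qed
qed

lemma diagonal_proj_mt:
  assumes "diagonal (mt E)" "is_proj (mt E)"
  obtains F where "E = pr F"
proof -
  obtain c where c: "\<And>i. ap E (bas i) = c i *\<^sub>C bas i"
    using assms(1) unfolding diagonal_mt by metis
  have "c i * c i = c i" for i
  proof -
    have "ap (E * E) (bas i) = ap E (bas i)" using assms(2) by (simp only: is_proj_mt)
    hence "coord ((c i * c i) *\<^sub>C bas i) i = coord (c i *\<^sub>C bas i) i"
      by (simp add: c ap_scale cscale_simps)
    thus ?thesis by simp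
  qed
  hence c01: "c i = 0 \<or> c i = 1" for i by (metis mult_cancel_right1)
  have "E = pr {i. c i = 1}"
  proof (rule bop_eq_bas)
    fix i
    show "ap E (bas i) = ap (pr {i. c i = 1}) (bas i)" using c01[of i] by (auto simp: c)
  qed
  thus thesis by (rule that)
qed

lemma coord_cscale: "(\<lambda>i. c * coord x i) = coord (c *\<^sub>C x)"
  by (rule ext) simp

lemma coord_zero: "(\<lambda>_. 0) = coord 0"
  by (rule ext) simp

lemma l2_coord: "x \<in> l2 \<longleftrightarrow> (\<exists>z. x = coord z)"
  using coord coord_Abs by metis

lemma coord_eq [simp]: "coord x = coord y \<longleftrightarrow> x = y"
  by (rule coord_inject)

lemma point_spectrum_mt: "point_spectrum (mt A) = {c. \<exists>x. x \<noteq> 0 \<and> ap A x = c *\<^sub>C x}"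
  unfolding point_spectrum_def
proof (intro Collect_cong iffI)
  fix c assume "\<exists>x\<in>l2. x \<noteq> (\<lambda>_. 0) \<and> mat_apply (mt A) x = (\<lambda>i. c * x i)"
  then obtain z where "coord z \<noteq> (\<lambda>_. 0)" "mat_apply (mt A) (coord z) = (\<lambda>i. c * coord z i)"
    by (auto simp: l2_coord)
  thus "\<exists>x. x \<noteq> 0 \<and> ap A x = c *\<^sub>C x"
    by (auto simp only: coord_zero coord_cscale mat_apply_mt coord_eq)
next
  fix c assume "\<exists>x. x \<noteq> 0 \<and> ap A x = c *\<^sub>C x"
  then obtain x where x: "x \<noteq> 0" "ap A x = c *\<^sub>C x" by blast
  show "\<exists>x\<in>l2. x \<noteq> (\<lambda>_. 0) \<and> mat_apply (mt A) x = (\<lambda>i. c * x i)"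
    by (rule bexI[of _ "coord x"])
       (simp_all only: coord_zero coord_cscale mat_apply_mt coord_eq x coord not_False_eq_True)
qed

lemma spectral_proj_mt:
  "spectral_proj (mt A) c (mt P) \<longleftrightarrow>
    adj P = P \<and> P * P = P \<and> (\<forall>x. ap P x = x \<longleftrightarrow> ap A x = c *\<^sub>C x)"
proof -
  have "(\<forall>x\<in>l2. mat_apply (mt P) x = x \<longleftrightarrow> mat_apply (mt A) x = (\<lambda>i. c * x i)) \<longleftrightarrow>
      (\<forall>z. mat_apply (mt P) (coord z) = coord z \<longleftrightarrow> mat_apply (mt A) (coord z) = (\<lambda>i. c * coord z i))"
    by (auto simp: l2_coord)
  thus ?thesis
    by (simp only: spectral_proj_def is_proj_mt coord_cscale mat_apply_mt coord_eq conj_assoc)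
qed

lemma wot_has_sum_mt:
  "wot_has_sum (\<lambda>n. mt (B n)) (mt S) \<longleftrightarrow>
    (\<forall>x y. (\<lambda>N. cin x (\<Sum>n<N. ap (B n) y)) \<longlonglongrightarrow> cin x (ap S y))"
proof -
  have "mat_apply (\<lambda>i j. \<Sum>n<N. mt (B n) i j) (coord y) = coord (\<Sum>n<N. ap (B n) y)" for N y
    by (simp only: mt_sum[symmetric] mat_apply_mt ap_sum_left)
  hence e: "l2inner (coord x) (mat_apply (\<lambda>i j. \<Sum>n<N. mt (B n) i j) (coord y)) = cin x (\<Sum>n<N. ap (B n) y)" for N x y
    by (simp only: cin_def)
  have "wot_has_sum (\<lambda>n. mt (B n)) (mt S) \<longleftrightarrow>
      (\<forall>x y. (\<lambda>N. l2inner (coord x) (mat_apply (\<lambda>i j. \<Sum>n<N. mt (B n) i j) (coord y)))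
        \<longlonglongrightarrow> l2inner (coord x) (mat_apply (mt S) (coord y)))"
    unfolding wot_has_sum_def by (auto simp: l2_coord bounded_op_mt)
  thus ?thesis unfolding e mat_apply_mt cin_def[symmetric] .
qed

lemma bop_ideal_mt:
  assumes "proper_ideal J"
  shows "bop_ideal {X. mt X \<in> J}"
proof
  from assms have J: "J \<subseteq> {M. bounded_op M}" "mat_zero \<in> J" "\<And>X Y. X \<in> J \<Longrightarrow> Y \<in> J \<Longrightarrow> mat_add X Y \<in> J"
    "\<And>X M. X \<in> J \<Longrightarrow> bounded_op M \<Longrightarrow> mat_mult M X \<in> J \<and> mat_mult X M \<in> J"
    "J \<noteq> {mat_zero}" "J \<noteq> {M. bounded_op M}"
    unfolding proper_ideal_def ideal_op_def by blast+
  show "0 \<in> {X. mt X \<in> J}" using J(2) by (simp add: mt_zero)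
  show "X + Y \<in> {X. mt X \<in> J}" if "X \<in> {X. mt X \<in> J}" "Y \<in> {X. mt X \<in> J}" for X Y
    using that J(3) by (simp add: mt_add)
  show lm: "M * X \<in> {X. mt X \<in> J}" and "X * M \<in> {X. mt X \<in> J}" if "X \<in> {X. mt X \<in> J}" for X M
    using that J(4) by (simp_all add: mt_mult bounded_op_mt)
  obtain Y where Y: "Y \<in> J" "Y \<noteq> mat_zero" using J(2,5) by blast
  obtain M where M: "Y = mt M" using Y(1) J(1) bounded_op_imp_mt by blast
  have "mt M \<in> J" "M \<noteq> 0" using Y by (auto simp: M mt_zero)
  thus "\<exists>X\<in>{X. mt X \<in> J}. X \<noteq> 0" by blast
  show "1 \<notin> {X. mt X \<in> J}"
  proof
    assume 1: "1 \<in> {X. mt X \<in> J}"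
    have "M \<in> J" if M: "bounded_op M" for M
    proof -
      obtain M' where "M = mt M'" by (rule bounded_op_imp_mt[OF M])
      thus ?thesis using lm[OF 1, of M'] by simp
    qed
    thus False using J(1,6) by blast
  qed
qed

lemma unitary_J_mt: "mt U \<in> unitary_J J \<longleftrightarrow> adj U * U = 1 \<and> U * adj U = 1 \<and> mt (U - 1) \<in> J"
  by (simp add: unitary_J_def unitary_mt mt_diff mt_one)

lemma UJ_diagonalizable_mt:
  "UJ_diagonalizable J (mt A) \<longleftrightarrow> (\<exists>U. adj U * U = 1 \<and> U * adj U = 1 \<and> mt (U - 1) \<in> J \<and>
     (\<forall>i. \<exists>c. ap (U * A * adj U) (bas i) = c *\<^sub>C bas i))"
proof -
  have "UJ_diagonalizable J (mt A) \<longleftrightarrow> (\<exists>U. mt U \<in> unitary_J J \<and> diagonal (mt (U * A * adj U)))"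
    unfolding UJ_diagonalizable_def Bex_def
  proof (intro iffI; elim exE conjE)
    fix U assume U: "U \<in> unitary_J J" "diagonal (mat_mult (mat_mult U (mt A)) (mat_adj U))"
    have "bounded_op U" using U(1) by (simp add: unitary_J_def unitary_def)
    then obtain U' where "U = mt U'" by (rule bounded_op_imp_mt)
    thus "\<exists>U. mt U \<in> unitary_J J \<and> diagonal (mt (U * A * adj U))"
      using U by (auto simp: mt_mult mt_adj)
  qed (auto simp: mt_mult mt_adj)
  thus ?thesis unfolding unitary_J_mt diagonal_mt by auto
qed

lemma diagonalizable_mt:
  "diagonalizable (mt A) \<longleftrightarrow> (\<exists>U. adj U * U = 1 \<and> U * adj U = 1 \<and>
     (\<forall>i. \<exists>c. ap (U * A * adj U) (bas i) = c *\<^sub>C bas i))"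
proof -
  \<comment> \<open>For \<open>J = UNIV\<close> the condition on \<open>U - 1\<close> is
    void.\<close>
  have "diagonalizable (mt A) \<longleftrightarrow> UJ_diagonalizable UNIV (mt A)"
    by (auto simp: diagonalizable_def UJ_diagonalizable_def unitary_J_def)
  thus ?thesis by (simp add: UJ_diagonalizable_mt)
qed

subsection \<open>Sufficiency\<close>

text \<open>The sum of the \<open>E n\<close> is a diagonal matrix which differs from the identity by \<open>T - S\<close>; its
  diagonal entries count labels, so far out every coordinate has exactly one label.\<close>

lemma (in diagonalized_family) unique_labels:
  assumes S: "\<And>x y. (\<lambda>M. cin x (\<Sum>n<M. ap ((1 - pr (F n)) * P n) y)) \<longlonglongrightarrow> cin x (ap S y)"
    and T: "\<And>x y. (\<lambda>M. cin x (\<Sum>n<M. ap (pr (F n) * (1 - P n)) y)) \<longlonglongrightarrow> cin x (ap T y)"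
    and small: "norm (pr {N..} * (T - S)) \<le> 1 / 4" and i: "i \<ge> N"
  shows "\<exists>!n. i \<in> F n"
proof -
  define s where "s M = card {n \<in> {..<M}. i \<in> F n}" for M
  let ?c = "coord (ap T (bas i)) i - coord (ap S (bas i)) i + 1"
  have "cin (bas i) (\<Sum>n<M. ap (pr (F n) * (1 - P n)) (bas i)) - cin (bas i) (\<Sum>n<M. ap ((1 - pr (F n)) * P n) (bas i))
      + cin (bas i) (\<Sum>n<M. ap (P n) (bas i)) = of_nat (s M)" for M
  proof -
    \<comment> \<open>\<open>E (1 - P) - (1 - E) P + P = E\<close>, so sums of the three known
      series give the sum of the diagonal projections.\<close>
    have "ap (pr (F n) * (1 - P n)) (bas i) - ap ((1 - pr (F n)) * P n) (bas i) + ap (P n) (bas i) = ap (pr (F n)) (bas i)" for n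
      by (simp add: ap_lin)
    hence "(\<Sum>n<M. ap (pr (F n) * (1 - P n)) (bas i)) - (\<Sum>n<M. ap ((1 - pr (F n)) * P n) (bas i))
        + (\<Sum>n<M. ap (P n) (bas i)) = (\<Sum>n<M. ap (pr (F n)) (bas i))"
      by (simp only: sum_subtractf[symmetric] sum.distrib[symmetric])
    hence "cin (bas i) (\<Sum>n<M. ap (pr (F n) * (1 - P n)) (bas i)) - cin (bas i) (\<Sum>n<M. ap ((1 - pr (F n)) * P n) (bas i))
      + cin (bas i) (\<Sum>n<M. ap (P n) (bas i)) = cin (bas i) (\<Sum>n<M. ap (pr (F n)) (bas i))"
      by (simp only: cin_add_right[symmetric] cin_diff_right[symmetric])
    also have "\<dots> = (\<Sum>n<M. if i \<in> F n then 1 else 0)"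
      unfolding cin_bas coord_sum by (rule sum.cong) auto
    also have "\<dots> = of_nat (s M)" by (simp add: s_def sum.If_cases Int_def)
    finally show ?thesis .
  qed
  moreover have "(\<lambda>M. cin (bas i) (\<Sum>n<M. ap (pr (F n) * (1 - P n)) (bas i)) - cin (bas i) (\<Sum>n<M. ap ((1 - pr (F n)) * P n) (bas i))
      + cin (bas i) (\<Sum>n<M. ap (P n) (bas i))) \<longlonglongrightarrow> cin (bas i) (ap T (bas i)) - cin (bas i) (ap S (bas i)) + cin (bas i) (bas i)"
    by (intro tendsto_add tendsto_diff S T tendsto_cin P_sums)
  ultimately have "(\<lambda>M. of_nat (s M)) \<longlonglongrightarrow> ?c" by simp
  hence "(\<lambda>M. cmod (of_nat (s M) - 1)) \<longlonglongrightarrow> cmod (?c - 1)"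
    by (intro tendsto_intros)
  moreover have "cmod (?c - 1) < 1 / 2"
  proof -
    have "?c - 1 = coord (ap (pr {N..} * (T - S)) (bas i)) i" using i by simp
    hence "cmod (?c - 1) \<le> norm (ap (pr {N..} * (T - S)) (bas i))" by (metis cmod_coord_le)
    also have "\<dots> \<le> 1 / 4" using norm_ap[of "pr {N..} * (T - S)" "bas i"] small by (simp del: ap_simps)
    finally show ?thesis by simp
  qed
  ultimately have "\<forall>\<^sub>F M in sequentially. cmod (of_nat (s M) - 1) < 1 / 2" by (rule order_tendstoD)
  then obtain M0 where M0: "\<And>M. M \<ge> M0 \<Longrightarrow> cmod (of_nat (s M) - 1) < 1 / 2"
    unfolding eventually_sequentially by blast
  \<comment> \<open>An integer within 1/2 of 1 is 1; the limit of \<open>s M - 1\<close> is a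
    diagonal entry of \<open>T - S\<close> beyond \<open>N\<close>, of modulus at most 1/4.\<close>
  have s1: "s M = 1" if "M \<ge> M0" for M
  proof -
    have "cmod (of_nat (s M) - 1) = \<bar>real (s M) - 1\<bar>"
      by (metis norm_of_real of_real_1 of_real_diff of_real_of_nat_eq)
    thus ?thesis using M0[OF that] by linarith
  qed
  show ?thesis
  proof (rule ex_ex1I)
    have "{n \<in> {..<M0}. i \<in> F n} \<noteq> {}"
    proof
      assume "{n \<in> {..<M0}. i \<in> F n} = {}"
      hence "s M0 = 0" by (simp only: s_def card.empty)
      thus False using s1[of M0] by simp
    qed
    thus "\<exists>n. i \<in> F n" by blast
    fix n k assume nk: "i \<in> F n" "i \<in> F k"
    \<comment> \<open>The bound is taken beyond \<open>n\<close> and \<open>k\<close>, so both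
      indices are counted, yet the count is 1.\<close>
    obtain a where a: "{l \<in> {..<max M0 (Suc (max n k))}. i \<in> F l} = {a}"
      by (rule card_1_singletonE[OF s1[OF max.cobounded1[of M0 "Suc (max n k)"], unfolded s_def]], rule that)
    have "n \<in> {l \<in> {..<max M0 (Suc (max n k))}. i \<in> F l}" "k \<in> {l \<in> {..<max M0 (Suc (max n k))}. i \<in> F l}"
      using nk by auto
    thus "n = k" unfolding a by simp
  qed
qed

text \<open>On the range of \<open>P k\<close> only the term with index \<open>k\<close> survives,
  so the partial sums are constant from \<open>M = k + 1\<close> on and the weak limit is read
  off.\<close>

lemma (in diagonalized_family) wot_sum_mult_P:
  assumes S: "\<And>x y. (\<lambda>M. cin x (\<Sum>n<M. ap (B n * P n) y)) \<longlonglongrightarrow> cin x (ap S y)"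
  shows "S * P k = B k * P k"
proof (rule bop_eqI, rule cin_ext)
  fix y x
  have "(\<lambda>M. cin x (\<Sum>n<M. ap (B n * P n) (ap (P k) y))) \<longlonglongrightarrow> cin x (ap (B k * P k) y)"
  proof (rule tendsto_eventually, unfold eventually_sequentially, intro exI allI impI)
    fix M assume M: "Suc k \<le> M"
    have PP: "ap (P n) (ap (P k) y) = (if n = k then ap (P k) y else 0)" for n
      using P_orth[of n k] P_idem[of k] by (auto simp flip: ap_simps(6))
    have "(\<Sum>n<M. ap (B n * P n) (ap (P k) y)) = (\<Sum>n<M. if n = k then ap (B k * P k) y else 0)"
      by (rule sum.cong) (auto simp: PP ap_lin)
    thus "cin x (\<Sum>n<M. ap (B n * P n) (ap (P k) y)) = cin x (ap (B k * P k) y)"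
      using M by simp
  qed
  hence "cin x (ap S (ap (P k) y)) = cin x (ap (B k * P k) y)"
    using S LIMSEQ_unique by blast
  thus "cin (ap (S * P k) y) x = cin (ap (B k * P k) y) x"
    by (metis ap_simps(6) cin_commute)
qed

lemma sufficiency:
  assumes "bop_ideal I" "diagonalized_family A lam P W lb"
    and S: "\<And>x y. (\<lambda>M. cin x (\<Sum>n<M. ap ((1 - pr (F n)) * P n) y)) \<longlonglongrightarrow> cin x (ap S y)" "S \<in> I"
    and T: "\<And>x y. (\<lambda>M. cin x (\<Sum>n<M. ap (pr (F n) * (1 - P n)) y)) \<longlonglongrightarrow> cin x (ap T y)" "T \<in> I"
  shows "\<exists>U. adj U * U = 1 \<and> U * adj U = 1 \<and> U - 1 \<in> I \<and>
     (\<forall>i. \<exists>c. ap (U * A * adj U) (bas i) = c *\<^sub>C bas i)"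
proof -
  interpret bop_ideal I by fact
  interpret diagonalized_family A lam P W lb by fact
  obtain N1 where N1: "\<And>M. M \<ge> N1 \<Longrightarrow> norm (pr {M..} * S) \<le> 1 / 4"
    by (rule tail_small[OF S(2), of "1/4"]) auto
  obtain N2 where N2: "\<And>M. M \<ge> N2 \<Longrightarrow> norm (pr {M..} * (T - S)) \<le> 1 / 4"
    by (rule tail_small[OF diff_mem[OF T(2) S(2)], of "1/4"]) auto
  define N where "N = max N1 N2"
  have lab: "\<exists>!n. i \<in> F n" if "i \<ge> N" for i
    by (rule unique_labels[OF S(1) T(1) _ that], rule N2) (simp add: N_def)
  interpret compression I A lam P W lb S N F
  proof
    show "S * P n = (1 - pr (F n)) * P n" for n by (rule wot_sum_mult_P[OF S(1)])
    show "{N..} \<inter> F n \<inter> F k = {}" if "n \<noteq> k" for n k using lab that by blast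
    show "\<exists>n. i \<in> F n" if "i \<ge> N" for i using lab[OF that] by blast
    show "norm (pr {N..} * S) \<le> 1 / 4" by (rule N1) (simp add: N_def)
  qed (rule S(2))
  obtain U where U: "adj U * U = 1" "U * adj U = 1" "U - 1 \<in> I"
    "\<And>i. \<exists>n. ap (P n) (ap (adj U) (bas i)) = ap (adj U) (bas i)"
    by (rule eigenbasis_near_identity, rule that)
  have "\<exists>c. ap (U * A * adj U) (bas i) = c *\<^sub>C bas i" for i
  proof -
    obtain n where "ap A (ap (adj U) (bas i)) = lam n *\<^sub>C ap (adj U) (bas i)"
      using U(4)[of i] P_range by blast
    hence "ap (U * A * adj U) (bas i) = lam n *\<^sub>C ap (U * adj U) (bas i)" by (simp add: ap_scale)
    thus ?thesis by (auto simp only: U(2) ap_simps)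
  qed
  thus ?thesis using U by blast
qed

subsection \<open>Necessity\<close>

lemma block_diag_mult_pr: "block_diag lb K * pr {i. lb i = n} = pr {i. lb i = n} * K * pr {i. lb i = n}"
proof (rule bop_eqI, rule coord_eqI)
  fix x i
  have "pr {j. lb j = lb i} * pr {i. lb i = n} = (if lb i = n then pr {i. lb i = n} else 0)"
    by (auto simp: Int_def) (rule arg_cong[of _ "{}" pr, simplified], auto)
  hence "ap (pr {j. lb j = lb i}) (ap (pr {i. lb i = n}) x) = ap (if lb i = n then pr {i. lb i = n} else 0) x"
    by (simp only: ap_simps(6)[symmetric])
  thus "coord (ap (block_diag lb K * pr {i. lb i = n}) x) i = coord (ap (pr {i. lb i = n} * K * pr {i. lb i = n}) x) i"
    by (simp add: coord_block_diag ap_lin)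
qed

context diagonalized_family
begin

text \<open>In \<open>P n = adj W * E n * W\<close> replace \<open>adj W\<close> by
  \<open>1 + K\<close>: the identity drops out since \<open>(1 - E n) * E n = 0\<close>. The first
  series then collects the off-diagonal blocks of \<open>K\<close> by columns, the second by rows,
  and both converge strongly.\<close>

lemma off_diagonal_sums:
  defines "K \<equiv> adj W - 1"
  defines "R \<equiv> (K - block_diag lb K) * W"
  shows "(\<lambda>M. \<Sum>n<M. ap ((1 - pr {i. lb i = n}) * P n) y) \<longlonglongrightarrow> ap R y"
    and "(\<lambda>M. \<Sum>n<M. ap (pr {i. lb i = n} * (1 - P n)) y) \<longlonglongrightarrow> ap R y"
proof -
  let ?E = "\<lambda>n. pr {i. lb i = n}"
  have aW: "adj W = 1 + K" by (simp add: K_def)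
  have EE: "?E n * ?E n = ?E n" for n by simp
  have 1: "(1 - ?E n) * P n = (K - block_diag lb K) * ?E n * W" for n
  proof -
    have "(K - block_diag lb K) * ?E n = (1 - ?E n) * K * ?E n"
      by (simp add: left_diff_distrib block_diag_mult_pr)
    also have "\<dots> = (1 - ?E n) * (1 + K) * ?E n"
      by (simp add: algebra_simps)
    finally show ?thesis by (simp only: P_eq aW mult.assoc)
  qed
  have "(\<Sum>n<M. ap ((1 - ?E n) * P n) y) = ap (K - block_diag lb K) (ap (pr {i. lb i < M}) (ap W y))" for M
    unfolding 1 by (simp only: ap_simps(6) ap_sum[symmetric] sum_pr_blocks)
  moreover have "(\<lambda>M. ap (K - block_diag lb K) (ap (pr {i. lb i < M}) (ap W y))) \<longlonglongrightarrow> ap (K - block_diag lb K) (ap W y)"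
    by (intro tendsto_ap pr_label_tendsto)
  ultimately show "(\<lambda>M. \<Sum>n<M. ap ((1 - ?E n) * P n) y) \<longlonglongrightarrow> ap R y"
    by (simp only: R_def ap_simps(6))
  have 2: "?E n * (1 - P n) = ?E n * (K - block_diag lb K) * W" for n
  proof -
    have "?E n * (1 - P n) = ?E n * (adj W * W - adj W * ?E n * W)" by (simp only: W P_eq)
    also have "\<dots> = ?E n * adj W * (1 - ?E n) * W" by (simp add: algebra_simps)
    also have "?E n * adj W * (1 - ?E n) = ?E n * K * (1 - ?E n)"
      unfolding aW by (simp add: algebra_simps)
    also have "\<dots> = ?E n * (K - block_diag lb K)"
      by (simp add: right_diff_distrib pr_block_diag)
    finally show ?thesis .
  qed
  have "(\<Sum>n<M. ap (?E n * (1 - P n)) y) = ap (pr {i. lb i < M}) (ap (K - block_diag lb K) (ap W y))" for M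
    unfolding 2 by (simp only: ap_simps(6) sum_pr_blocks)
  moreover have "(\<lambda>M. ap (pr {i. lb i < M}) (ap (K - block_diag lb K) (ap W y))) \<longlonglongrightarrow> ap (K - block_diag lb K) (ap W y)"
    by (rule pr_label_tendsto)
  ultimately show "(\<lambda>M. \<Sum>n<M. ap (?E n * (1 - P n)) y) \<longlonglongrightarrow> ap R y"
    by (simp only: R_def ap_simps(6))
qed

end

text \<open>The place where arithmetic mean closure enters; the comparison sequence is that of
  \<open>K\<close> itself.\<close>

lemma am_closed_block_diag:
  assumes "am_closed J" "mt K \<in> J"
  shows "mt (block_diag lb K) \<in> J"
proof -
  have J: "J = {A. compact_op A \<and> (\<exists>\<alpha>\<in>sing_seqs J. arith_mean (sing_val A) \<in> O(arith_mean \<alpha>))}"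
    using assms(1) unfolding am_closed_def .
  hence "compact_op (mt K)" using assms(2) by blast
  moreover have "sing_val (mt K) \<in> sing_seqs J" using assms(2) unfolding sing_seqs_def by blast
  ultimately have "mt (block_diag lb K) \<in> {A. compact_op A \<and> (\<exists>\<alpha>\<in>sing_seqs J. arith_mean (sing_val A) \<in> O(arith_mean \<alpha>))}"
    using compact_op_block_diag arith_mean_block_diag by blast
  thus ?thesis using J by blast
qed

theorem theorem3p2:
  fixes J :: "mat set" and A :: mat and lam :: "nat \<Rightarrow> complex" and P :: "nat \<Rightarrow> mat"
  assumes "proper_ideal J"
    and "bounded_op A" and "diagonalizable A"
    and "infinite (point_spectrum A)"
    and "inj lam" and "range lam = point_spectrum A"
    and "\<And>n. spectral_proj A (lam n) (P n)"
  shows "((\<exists>E. (\<forall>n. diagonal (E n) \<and> is_proj (E n)) \<and>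
            (\<exists>S. wot_has_sum (\<lambda>n. mat_mult (mat_diff mat_id (E n)) (P n)) S \<and> S \<in> J) \<and>
            (\<exists>T. wot_has_sum (\<lambda>n. mat_mult (E n) (mat_diff mat_id (P n))) T \<and> T \<in> J))
          \<longrightarrow> UJ_diagonalizable J A)
       \<and> (am_closed J \<and> UJ_diagonalizable J A \<longrightarrow>
          (\<exists>E. (\<forall>n. diagonal (E n) \<and> is_proj (E n)) \<and>
            (\<exists>S. wot_has_sum (\<lambda>n. mat_mult (mat_diff mat_id (E n)) (P n)) S \<and> S \<in> J) \<and>
            (\<exists>T. wot_has_sum (\<lambda>n. mat_mult (E n) (mat_diff mat_id (P n))) T \<and> T \<in> J)))"
proof -
  obtain A' where A: "A = mt A'" by (rule bounded_op_imp_mt[OF assms(2)])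
  have "\<exists>P'. P n = mt P'" for n
    using assms(7)[of n] bounded_op_imp_mt unfolding spectral_proj_def is_proj_def by blast
  then obtain P' where P: "\<And>n. P n = mt (P' n)" by metis
  interpret I: bop_ideal "{X. mt X \<in> J}" by (rule bop_ideal_mt[OF assms(1)])
  interpret sp: spectral_family A' lam P'
  proof
    show "inj lam" by fact
    show "c \<in> range lam" if "x \<noteq> 0" "ap A' x = c *\<^sub>C x" for x c
      using that unfolding assms(6) A point_spectrum_mt by blast
  qed (use assms(7)[unfolded A P spectral_proj_mt] in auto)
  have sumS: "mat_mult (mat_diff mat_id (mt E)) (P n) = mt ((1 - E) * P' n)"
    and sumT: "mat_mult (mt E) (mat_diff mat_id (P n)) = mt (E * (1 - P' n))" for E n
    by (simp_all add: mt_mult mt_diff mt_one P)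
  show ?thesis
  proof (intro conjI impI)
    assume "\<exists>E. (\<forall>n. diagonal (E n) \<and> is_proj (E n)) \<and>
            (\<exists>S. wot_has_sum (\<lambda>n. mat_mult (mat_diff mat_id (E n)) (P n)) S \<and> S \<in> J) \<and>
            (\<exists>T. wot_has_sum (\<lambda>n. mat_mult (E n) (mat_diff mat_id (P n))) T \<and> T \<in> J)"
    then obtain E S T where E: "\<And>n. diagonal (E n)" "\<And>n. is_proj (E n)"
      and S: "wot_has_sum (\<lambda>n. mat_mult (mat_diff mat_id (E n)) (P n)) S" "S \<in> J"
      and T: "wot_has_sum (\<lambda>n. mat_mult (E n) (mat_diff mat_id (P n))) T" "T \<in> J" by blast
    have "\<exists>F. E n = mt (pr F)" for n
    proof -
      obtain E' where E': "E n = mt E'" using E(2)[of n] bounded_op_imp_mt unfolding is_proj_def by blast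
      obtain F where "E' = pr F" by (rule diagonal_proj_mt[of E']) (use E[of n] E' in auto)
      thus ?thesis using E' by blast
    qed
    then obtain F where F: "\<And>n. E n = mt (pr (F n))" by metis
    obtain S' where S': "S = mt S'" using S(1) bounded_op_imp_mt unfolding wot_has_sum_def by blast
    obtain T' where T': "T = mt T'" using T(1) bounded_op_imp_mt unfolding wot_has_sum_def by blast
    obtain W where W: "adj W * W = 1" "W * adj W = 1" "\<And>i. \<exists>c. ap (W * A' * adj W) (bas i) = c *\<^sub>C bas i"
      using assms(3) unfolding A diagonalizable_mt by blast
    obtain lb where lb: "\<And>n. P' n = adj W * pr {i. lb i = n} * W"
      by (rule sp.P_conj[OF W], rule that)
    have "diagonalized_family A' lam P' W lb" by unfold_locales (rule W lb)+
    from sufficiency[OF I.bop_ideal_axioms this, of F S' T']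
    show "UJ_diagonalizable J A"
      using S T unfolding A UJ_diagonalizable_mt F sumS sumT S' T' wot_has_sum_mt by simp
  next
    assume *: "am_closed J \<and> UJ_diagonalizable J A"
    then obtain W where W: "adj W * W = 1" "W * adj W = 1" "\<And>i. \<exists>c. ap (W * A' * adj W) (bas i) = c *\<^sub>C bas i"
      and WJ: "mt (W - 1) \<in> J"
      unfolding A UJ_diagonalizable_mt by blast
    obtain lb where lb: "\<And>n. P' n = adj W * pr {i. lb i = n} * W"
      by (rule sp.P_conj[OF W], rule that)
    interpret d: diagonalized_family A' lam P' W lb by unfold_locales (rule W lb)+
    define K where "K = adj W - 1"
    define R where "R = (K - block_diag lb K) * W"
    \<comment> \<open>\<open>adj W - 1\<close> is a left multiple of \<open>W - 1\<close>, hence in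
      the ideal.\<close>
    have "K = (- adj W) * (W - 1)" by (simp add: K_def algebra_simps W)
    moreover have "(- adj W) * (W - 1) \<in> {X. mt X \<in> J}" by (rule I.mult_left_mem) (simp add: WJ)
    ultimately have KJ: "K \<in> {X. mt X \<in> J}" by (simp only:)
    hence "block_diag lb K \<in> {X. mt X \<in> J}" using am_closed_block_diag * by blast
    hence RJ: "mt R \<in> J" using KJ I.mult_right_mem I.diff_mem unfolding R_def by blast
    note sums = d.off_diagonal_sums[folded K_def, folded R_def]
    show "\<exists>E. (\<forall>n. diagonal (E n) \<and> is_proj (E n)) \<and>
            (\<exists>S. wot_has_sum (\<lambda>n. mat_mult (mat_diff mat_id (E n)) (P n)) S \<and> S \<in> J) \<and>
            (\<exists>T. wot_has_sum (\<lambda>n. mat_mult (E n) (mat_diff mat_id (P n))) T \<and> T \<in> J)"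
    proof (intro exI conjI allI)
      \<comment> \<open>These are the spectral projections conjugated by the diagonalising unitary,
        \<open>W * P' n * adj W\<close>.\<close>
      let ?E = "\<lambda>n. mt (pr {i. lb i = n})"
      show "diagonal (?E n)" for n
        by (auto simp: diagonal_def mt_def)
      show "is_proj (?E n)" for n by (simp add: is_proj_mt)
      show "wot_has_sum (\<lambda>n. mat_mult (mat_diff mat_id (?E n)) (P n)) (mt R)"
        unfolding sumS wot_has_sum_mt by (intro allI tendsto_cin sums)
      show "wot_has_sum (\<lambda>n. mat_mult (?E n) (mat_diff mat_id (P n))) (mt R)"
        unfolding sumT wot_has_sum_mt by (intro allI tendsto_cin sums)
    qed (rule RJ)+
  qed
qed

end
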